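(* Let $x+H$ be a homogeneous quasi-translation in dimension $n\le 4$ over $\mathbb{C}$. Then there exists an invertible $n\times n$ matrix $T$ over $\mathbb{C}$ such that $T^{-1}H(Tx)$ is of the form (1) $(0,0,g)$, where $g\in\mathbb{C}[x_1,x_2]$, if $n=3$; (2) $(0,0,b\,g,a\,g)$, where $a,b\in\mathbb{C}[x_1,x_2]$ and $g\in\mathbb{C}[x_1,x_2,a\,x_3-b\,x_4]$, if $n=4$.
   Context: Here $x=(x_1,\ldots,x_n)$, viewed as a column vector, and $\mathbb{C}[x]=\mathbb{C}[x_1,\ldots,x_n]$. For $H=(H_1,\ldots,H_n)$ with $H_i\in\mathbb{C}[x]$, the polynomial map $x+H$ is called a quasi-translation if $x-H$ is its inverse polynomial map, i.e. $(x-H)\circ(x+H)=x$. It is called homogeneous if there exists $d\in\mathbb{N}$ such that each $H_i$ is either zero or homogeneous of degree $d$. $H(Tx)$ means that the vector $Tx$ is substituted for $x$ in $H$. $\mathbb{C}[x_1,x_2,a\,x_3-b\,x_4]$ denotes the $\mathbb{C}$-subalgebra of $\mathbb{C}[x]$ generated by the listed elements. *)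

theory Defs
  imports "HOL-Library.Poly_Mapping" "Jordan_Normal_Form.Matrix" Complex_Main
begin

text \<open>
  Polynomials are formal: finitely supported coefficient functions on monomials, where a monomial
  is a finitely supported exponent function on the indices of the variables. Indices count from 0,
  in accordance with vector and matrix entries, so the variable usually called \<open>x\<^sub>i\<close> is \<open>X (i - 1)\<close>.
  The type has variables with all natural numbers as indices; the polynomial ring in \<open>n\<close> variables
  is the subalgebra generated by the first \<open>n\<close> of them.
\<close>

type_synonym cpoly = "(nat \<Rightarrow>\<^sub>0 nat) \<Rightarrow>\<^sub>0 complex"

definition Const :: "complex \<Rightarrow> cpoly" where
  "Const c = Poly_Mapping.single 0 c"

definition X :: "nat \<Rightarrow> cpoly" where
  "X i = Poly_Mapping.single (Poly_Mapping.single i 1) 1"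

definition subalgebra :: "cpoly set \<Rightarrow> bool" where
  "subalgebra A \<longleftrightarrow>
     (\<forall>c. Const c \<in> A) \<and> (\<forall>p\<in>A. \<forall>q\<in>A. p + q \<in> A) \<and> (\<forall>p\<in>A. \<forall>q\<in>A. p * q \<in> A)"

definition generated_subalgebra :: "cpoly set \<Rightarrow> cpoly set" where
  "generated_subalgebra G = subalgebra hull G"

definition poly_ring :: "nat \<Rightarrow> cpoly set" where
  "poly_ring n = generated_subalgebra (X ` {..<n})"

definition total_degree_monom :: "(nat \<Rightarrow>\<^sub>0 nat) \<Rightarrow> nat" where
  "total_degree_monom m = (\<Sum>i\<in>Poly_Mapping.keys m. Poly_Mapping.lookup m i)"

definition homogeneous_of_degree :: "nat \<Rightarrow> cpoly \<Rightarrow> bool" where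
  "homogeneous_of_degree d p \<longleftrightarrow> (\<forall>m\<in>Poly_Mapping.keys p. total_degree_monom m = d)"

definition subst_poly :: "(nat \<Rightarrow> cpoly) \<Rightarrow> cpoly \<Rightarrow> cpoly" where
  "subst_poly \<sigma> p =
     (\<Sum>m\<in>Poly_Mapping.keys p. Const (Poly_Mapping.lookup p m) *
        (\<Prod>i\<in>Poly_Mapping.keys m. \<sigma> i ^ Poly_Mapping.lookup m i))"

definition poly_map :: "nat \<Rightarrow> cpoly vec \<Rightarrow> bool" where
  "poly_map n F \<longleftrightarrow> F \<in> carrier_vec n \<and> (\<forall>i<n. F $ i \<in> poly_ring n)"

text \<open>
  \<open>subst_vec F G\<close> is \<open>F(G)\<close>, that is, \<open>F \<circ> G\<close> for polynomial maps. It is meaningful only if no variable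
  with an index beyond the dimension of \<open>G\<close> occurs in \<open>F\<close>.
\<close>

definition subst_vec :: "cpoly vec \<Rightarrow> cpoly vec \<Rightarrow> cpoly vec" where
  "subst_vec F G = map_vec (subst_poly (\<lambda>i. G $ i)) F"

definition xvec :: "nat \<Rightarrow> cpoly vec" where
  "xvec n = vec n X"

definition quasi_translation :: "nat \<Rightarrow> cpoly vec \<Rightarrow> bool" where
  "quasi_translation n H \<longleftrightarrow>
     poly_map n H \<and> subst_vec (xvec n - H) (xvec n + H) = xvec n"

definition homogeneous_map :: "nat \<Rightarrow> cpoly vec \<Rightarrow> bool" where
  "homogeneous_map n H \<longleftrightarrow> (\<exists>d. \<forall>i<n. H $ i = 0 \<or> homogeneous_of_degree d (H $ i))"

text \<open>\<open>S * H(T * x)\<close>; the conjugate of \<open>H\<close> by \<open>T\<close> when \<open>S\<close> is the inverse of \<open>T\<close>.\<close>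

definition linear_conjugate :: "nat \<Rightarrow> complex mat \<Rightarrow> complex mat \<Rightarrow> cpoly vec \<Rightarrow> cpoly vec" where
  "linear_conjugate n S T H =
     map_mat Const S *\<^sub>v subst_vec H (map_mat Const T *\<^sub>v xvec n)"

end

theory Submission
  imports Defs
    "HOL-Computational_Algebra.Polynomial_Factorial"
    "HOL-Computational_Algebra.Field_as_Ring"
    "HOL-Computational_Algebra.Fundamental_Theorem_Algebra"
    "HOL-Combinatorics.Transposition"
    "Jordan_Normal_Form.Determinant"
begin

text \<open>
  The proof works with polynomials as functions on complex points, which loses nothing because
  distinct polynomials are distinct functions. That \<open>x - H\<close> is inverse to \<open>x + H\<close> means that
  \<open>H (x + H x) = H x\<close>. By iteration and polynomiality \<open>H\<close> is constant along the lines
  \<open>x + t * H x\<close> (\<open>H_flow\<close>), and homogeneity extends this to \<open>H (s * x + t * H x) = s ^ d * H x\<close>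
  (\<open>H_span\<close>). There is nothing to prove in dimension at most 2, and dimension 3 is reduced to
  dimension 4 by adding a component that is zero.

  If the components of \<open>H\<close> are proportional, then \<open>H = c * f\<close> for a constant vector \<open>c\<close>, the
  function \<open>f\<close> is invariant under translation by \<open>c\<close>, and it suffices to choose coordinates in
  which \<open>c\<close> is the last basis vector (\<open>proportional_normal_form\<close>). Otherwise some ratio
  \<open>u = H i / H k\<close> is not constant. The structure of \<open>H\<close> then emerges in four stages, which
  recover the classical results of Gordan and Noether by elementary means.

  First, the gradients of all ratios of components are parallel (\<open>om_parallel\<close>), so that the
  image of \<open>H\<close> is a cone over a curve. If it were larger, the relations between the components
  would form a principal ideal by unique factorization. But after division by the greatest power
  of its generator that divides all of them, the components of \<open>H\<close> would themselves be
  relations, essentially because \<open>H (H x) = 0\<close>, and hence again be divisible by the generator.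

  Second, the level sets of \<open>u\<close> are hyperplanes (\<open>ratio_constant_on_hyperplanes\<close>). The value of
  \<open>u\<close> determines the line through \<open>H x\<close> and the tangent plane of the cone along this line. The
  level set of \<open>u\<close> is tangent to this plane because the Jacobian of \<open>H\<close> has no nonzero
  eigenvalues, and so it contains the translates of \<open>x\<close> by the plane. Together with the scalings
  of \<open>x\<close> this fills a hyperplane.

  Third, these hyperplanes form a pencil (\<open>pencil_exists\<close>). Where two of them meet, \<open>H i\<close> and
  \<open>H k\<close> vanish; but on one hyperplane \<open>H k\<close> vanishes on finitely many subspaces of codimension 1
  only, so the intersections with all others coincide. The pencil is given by two linear forms.
  They annihilate \<open>H\<close>, and all ratios of components are functions of these two forms
  (\<open>proportional_or_pencil\<close>). In three variables this forces the components to be proportional.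

  Fourth, take the two forms as the first two coordinates. Then \<open>H = (0, 0, b * g, a * g)\<close> with
  coprime \<open>a\<close> and \<open>b\<close> that depend on the first two variables only, and \<open>g\<close> is invariant under
  translation by multiples of \<open>(0, 0, b, a)\<close>. Comparing the expansions of \<open>g\<close> on two coordinate
  hyperplanes, and using that \<open>a\<close> and \<open>b\<close> are coprime, one finds that \<open>g\<close> is a polynomial in the
  first two variables and \<open>a * x\<^sub>3 - b * x\<^sub>4\<close> (\<open>two_component_structure\<close>).
\<close>

section \<open>Polynomial functions and their derivatives\<close>

type_synonym point = "nat \<Rightarrow> complex"

inductive polyfun :: "nat set \<Rightarrow> (point \<Rightarrow> complex) \<Rightarrow> bool" for V where
  polyfun_const: "polyfun V (\<lambda>x. c)"
| polyfun_var: "i \<in> V \<Longrightarrow> polyfun V (\<lambda>x. x i)"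
| polyfun_add: "polyfun V f \<Longrightarrow> polyfun V g \<Longrightarrow> polyfun V (\<lambda>x. f x + g x)"
| polyfun_mult: "polyfun V f \<Longrightarrow> polyfun V g \<Longrightarrow> polyfun V (\<lambda>x. f x * g x)"

lemma polyfun_uminus: "polyfun V f \<Longrightarrow> polyfun V (\<lambda>x. - f x)"
  using polyfun_mult[OF polyfun_const[of V "-1"], of f] by simp

lemma polyfun_diff: "polyfun V f \<Longrightarrow> polyfun V g \<Longrightarrow> polyfun V (\<lambda>x. f x - g x)"
  using polyfun_add[OF _ polyfun_uminus, of V f g] by simp

lemma polyfun_sum: "(\<And>i. i \<in> I \<Longrightarrow> polyfun V (f i)) \<Longrightarrow> polyfun V (\<lambda>x. \<Sum>i\<in>I. f i x)"
  by (induction I rule: infinite_finite_induct) (auto intro: polyfun_add polyfun_const)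

lemma polyfun_prod: "(\<And>i. i \<in> I \<Longrightarrow> polyfun V (f i)) \<Longrightarrow> polyfun V (\<lambda>x. \<Prod>i\<in>I. f i x)"
  by (induction I rule: infinite_finite_induct) (auto intro: polyfun_mult polyfun_const)

lemma polyfun_power: "polyfun V f \<Longrightarrow> polyfun V (\<lambda>x. f x ^ k)"
  by (induction k) (auto intro: polyfun_mult polyfun_const)

lemmas polyfun_intros =
  polyfun_const polyfun_var polyfun_add polyfun_mult polyfun_uminus polyfun_diff polyfun_sum
  polyfun_prod polyfun_power

lemma polyfun_mono: "polyfun V f \<Longrightarrow> V \<subseteq> U \<Longrightarrow> polyfun U f"
  by (induction rule: polyfun.induct) (auto intro: polyfun.intros)

lemma polyfun_cong_point: "polyfun V f \<Longrightarrow> (\<And>i. i \<in> V \<Longrightarrow> x i = y i) \<Longrightarrow> f x = f y"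
  by (induction rule: polyfun.induct) auto

lemma polyfun_comp:
  "polyfun V f \<Longrightarrow> (\<And>i. i \<in> V \<Longrightarrow> polyfun U (g i)) \<Longrightarrow> polyfun U (\<lambda>x. f (\<lambda>i. g i x))"
  by (induction rule: polyfun.induct) (auto intro: polyfun.intros)

lemma polyfun_curve: "polyfun V f \<Longrightarrow> \<exists>p. \<forall>t. f (\<lambda>i. poly (\<gamma> i) t) = poly p t"
proof (induction rule: polyfun.induct)
  case (polyfun_const c)
  show ?case by (rule exI[of _ "[:c:]"]) simp
next
  case (polyfun_add f g)
  then obtain p q where "\<forall>t. f (\<lambda>i. poly (\<gamma> i) t) = poly p t" "\<forall>t. g (\<lambda>i. poly (\<gamma> i) t) = poly q t"
    by blast
  then show ?case by (intro exI[of _ "p + q"]) simp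
next
  case (polyfun_mult f g)
  then obtain p q where "\<forall>t. f (\<lambda>i. poly (\<gamma> i) t) = poly p t" "\<forall>t. g (\<lambda>i. poly (\<gamma> i) t) = poly q t"
    by blast
  then show ?case by (intro exI[of _ "p * q"]) simp
qed auto

lemma polyfun_line:
  assumes "polyfun V f"
  obtains p where "\<And>t. f (\<lambda>i. x i + t * v i) = poly p t"
  using polyfun_curve[OF assms, of "\<lambda>i. [:x i, v i:]"] by (auto simp: mult.commute)

text \<open>
  Polynomial functions have no zero divisors: on the line through a point where \<open>f\<close> does not
  vanish and a point where \<open>g\<close> is to be evaluated both are polynomials in one variable.
\<close>

lemma polyfun_mult_eq_0:
  assumes "polyfun V f" "polyfun V g" "\<And>x. f x * g x = 0" "f x0 \<noteq> 0"
  shows "g y = 0"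
proof -
  obtain p where p: "\<And>t. f (\<lambda>i. x0 i + t * (y i - x0 i)) = poly p t"
    using polyfun_line[OF assms(1), of x0 "\<lambda>i. y i - x0 i"] by auto
  obtain q where q: "\<And>t. g (\<lambda>i. x0 i + t * (y i - x0 i)) = poly q t"
    using polyfun_line[OF assms(2), of x0 "\<lambda>i. y i - x0 i"] by auto
  have "poly (p * q) t = 0" for t using assms(3) by (simp add: p[symmetric] q[symmetric])
  then have "p * q = 0" using poly_all_0_iff_0 by blast
  moreover have "p \<noteq> 0" using p[of 0] assms(4) by auto
  ultimately have "q = 0" by simp
  then show ?thesis using q[of 1] by simp
qed

text \<open>
  This is the form in which the absence of zero divisors is used throughout: an identity between
  polynomial functions may be verified at generic points only, so that one may divide by any
  polynomial function that is not identically zero.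
\<close>

lemma polyfun_zero_generic:
  assumes "polyfun V f" "polyfun V g" "f x0 \<noteq> 0" "\<And>x. f x \<noteq> 0 \<Longrightarrow> g x = 0"
  shows "g y = 0"
  by (rule polyfun_mult_eq_0[OF assms(1,2) _ assms(3)]) (use assms(4) in auto)

text \<open>
  Partial derivatives are defined analytically; on polynomial functions they exist, and all
  formal rules follow from uniqueness of the derivative.
\<close>

definition pd :: "nat \<Rightarrow> (point \<Rightarrow> complex) \<Rightarrow> point \<Rightarrow> complex" where
  "pd i f x = (THE D. ((\<lambda>t. f (x(i := t))) has_field_derivative D) (at (x i)))"

lemma pd_eqI: "((\<lambda>t. f (x(i := t))) has_field_derivative D) (at (x i)) \<Longrightarrow> pd i f x = D"
  unfolding pd_def by (rule the_equality) (auto intro: DERIV_unique)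

lemma pd_works:
  assumes "polyfun V f"
  shows "((\<lambda>t. f (x(i := t))) has_field_derivative pd i f x) (at (x i))"
proof -
  obtain p where p: "\<And>t. f (\<lambda>j. poly (if j = i then [:0,1:] else [:x j:]) t) = poly p t"
    using polyfun_curve[OF assms, of "\<lambda>j. if j = i then [:0,1:] else [:x j:]"] by blast
  have "(\<lambda>j. poly (if j = i then [:0,1:] else [:x j:]) t) = x(i := t)" for t by auto
  then have "(\<lambda>t. f (x(i := t))) = poly p" using p by auto
  then have "((\<lambda>t. f (x(i := t))) has_field_derivative poly (pderiv p) (x i)) (at (x i))"
    by simp
  then show ?thesis using pd_eqI by metis
qed

lemma pd_const [simp]: "pd i (\<lambda>x. c) = (\<lambda>x. 0)"
  by (rule ext, rule pd_eqI) simp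

lemma pd_var [simp]: "pd i (\<lambda>x. x j) = (\<lambda>x. if i = j then 1 else 0)"
  by (rule ext, rule pd_eqI) auto

lemma pd_add:
  "polyfun V f \<Longrightarrow> polyfun V g \<Longrightarrow> pd i (\<lambda>x. f x + g x) = (\<lambda>x. pd i f x + pd i g x)"
  by (rule ext, rule pd_eqI) (rule DERIV_add; rule pd_works)

lemma pd_diff:
  "polyfun V f \<Longrightarrow> polyfun V g \<Longrightarrow> pd i (\<lambda>x. f x - g x) = (\<lambda>x. pd i f x - pd i g x)"
  by (rule ext, rule pd_eqI) (rule DERIV_diff; rule pd_works)

lemma pd_mult:
  assumes "polyfun V f" "polyfun V g"
  shows "pd i (\<lambda>x. f x * g x) = (\<lambda>x. pd i f x * g x + f x * pd i g x)"
proof (rule ext, rule pd_eqI)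
  fix x
  show "((\<lambda>t. f (x(i := t)) * g (x(i := t))) has_field_derivative pd i f x * g x + f x * pd i g x)
     (at (x i))"
    using DERIV_mult[OF pd_works[OF assms(1), of x i] pd_works[OF assms(2), of x i]]
    by (simp add: algebra_simps)
qed

lemma polyfun_pd: "polyfun V f \<Longrightarrow> polyfun V (pd i f)"
  by (induction rule: polyfun.induct) (auto simp: pd_add pd_mult intro: polyfun_intros)

lemma pd_commute: "polyfun V f \<Longrightarrow> pd i (pd j f) = pd j (pd i f)"
proof (induction rule: polyfun.induct)
  case (polyfun_add f g)
  then show ?case
    by (simp add: pd_add[OF polyfun_add.hyps] pd_add[OF polyfun_pd polyfun_pd, OF polyfun_add.hyps])
next
  case (polyfun_mult f g)
  note pf = polyfun_mult.hyps polyfun_pd[OF polyfun_mult.hyps(1)] polyfun_pd[OF polyfun_mult.hyps(2)]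
  show ?case
    by (simp add: pd_mult[OF pf(1,2)] pd_add[OF polyfun.polyfun_mult polyfun.polyfun_mult, OF pf(3,2,1,4)]
       pd_mult[OF pf(3) pf(2)] pd_mult[OF pf(1) pf(4)] polyfun_mult.IH) (simp add: algebra_simps)
qed auto

lemma pd_outside:
  assumes "polyfun V f" "i \<notin> V"
  shows "pd i f x = 0"
proof -
  have "f (x(i := t)) = f x" for t by (rule polyfun_cong_point[OF assms(1)]) (use assms(2) in auto)
  then show ?thesis by (intro pd_eqI) simp
qed

lemma polyfun_chain:
  assumes "polyfun V f" "finite V" "\<And>i. i \<in> V \<Longrightarrow> (\<gamma> i has_field_derivative \<gamma>' i) (at t)"
  shows "((\<lambda>t. f (\<lambda>i. \<gamma> i t)) has_field_derivative (\<Sum>i\<in>V. pd i f (\<lambda>i. \<gamma> i t) * \<gamma>' i)) (at t)"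
  using assms(1)
proof (induction rule: polyfun.induct)
  case (polyfun_var i)
  then show ?case using assms(2,3) by (simp add: if_distrib[of "\<lambda>c. c * _"] cong: if_cong)
next
  case (polyfun_add f g)
  then show ?case
    using DERIV_add[OF polyfun_add.IH] by (simp add: pd_add sum.distrib distrib_right)
next
  case (polyfun_mult f g)
  show ?case
    by (rule DERIV_cong[OF DERIV_mult[OF polyfun_mult.IH]])
      (simp add: pd_mult[OF polyfun_mult.hyps] sum.distrib distrib_left distrib_right sum_distrib_left
        sum_distrib_right mult_ac)
qed auto

definition dd :: "point \<Rightarrow> (point \<Rightarrow> complex) \<Rightarrow> point \<Rightarrow> complex" where
  "dd v f x = (\<Sum>i<4. pd i f x * v i)"

abbreviation "polyfun4 \<equiv> polyfun {..<4}"

lemma dd_chain: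
  assumes "polyfun4 f" "\<And>i. i < 4 \<Longrightarrow> (\<gamma> i has_field_derivative v i) (at t)"
  shows "((\<lambda>t. f (\<lambda>i. \<gamma> i t)) has_field_derivative dd v f (\<lambda>i. \<gamma> i t)) (at t)"
  unfolding dd_def by (rule polyfun_chain) (use assms in auto)

lemma dd_line:
  assumes "polyfun4 f"
  shows "((\<lambda>t. f (\<lambda>i. x i + t * v i)) has_field_derivative dd v f (\<lambda>i. x i + t * v i)) (at t)"
  by (rule dd_chain[OF assms]) (auto intro!: derivative_eq_intros)

lemma polyfun_dd: "polyfun V f \<Longrightarrow> polyfun V (dd v f)"
  unfolding dd_def by (intro polyfun_intros polyfun_pd)

lemma dd_mult:
  "polyfun V f \<Longrightarrow> polyfun V g \<Longrightarrow> dd v (\<lambda>x. f x * g x) x = dd v f x * g x + f x * dd v g x"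
  by (simp add: dd_def pd_mult sum.distrib distrib_left distrib_right sum_distrib_left sum_distrib_right
      mult_ac)

lemma dd_diff:
  "polyfun V f \<Longrightarrow> polyfun V g \<Longrightarrow> dd v (\<lambda>x. f x - g x) x = dd v f x - dd v g x"
  by (simp add: dd_def pd_diff sum_subtractf left_diff_distrib)

lemma dd_const [simp]: "dd v (\<lambda>x. c) x = 0"
  by (simp add: dd_def)

lemma dd_var [simp]: "j < 4 \<Longrightarrow> dd v (\<lambda>x. x j) x = v j"
  by (simp add: dd_def if_distrib[of "\<lambda>c. c * _"] cong: if_cong)

lemma dd_line_poly:
  assumes "polyfun4 f" "\<And>t. f (\<lambda>i. x i + t * v i) = poly p t"
  shows "poly (pderiv p) t = dd v f (\<lambda>i. x i + t * v i)"
proof -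
  have "(poly p has_field_derivative dd v f (\<lambda>i. x i + t * v i)) (at t)"
    using dd_line[OF assms(1), of x v t] by (simp add: assms(2))
  then show ?thesis using DERIV_unique poly_DERIV by blast
qed

text \<open>
  Differentiation lowers a positive order of vanishing by exactly one in characteristic zero.
  Applied to \<open>q / w\<close>, whose derivative is the Wronskian of \<open>w\<close> and \<open>q\<close> divided by \<open>w\<^sup>2\<close>, this
  replaces the uniqueness theorem for ordinary differential equations.
\<close>

lemma wronskian_order:
  fixes w q :: "complex poly"
  assumes "poly w 0 \<noteq> 0" "poly q 0 = 0" "[:0,1:] ^ e dvd w * (w * pderiv q - q * pderiv w)"
  shows "[:0,1:] ^ Suc e dvd q"
proof (rule ccontr)
  assume nd: "\<not> ?thesis"
  let ?f = "order 0 q"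
  have q0: "q \<noteq> 0" using nd by auto
  have f0: "?f \<noteq> 0" using q0 assms(2) by (simp add: order_root)
  have fe: "?f \<le> e" using nd order_divides[of 0 "Suc e" q] q0 by simp
  have q': "pderiv q \<noteq> 0"
  proof
    assume "pderiv q = 0"
    then have "degree q = 0" by (simp add: pderiv_eq_0_iff)
    then obtain c where "q = [:c:]" by (rule degree_eq_zeroE)
    then show False using q0 assms(2) by simp
  qed
  have of': "?f = Suc (order 0 (pderiv q))" using order_pderiv[OF q0 assms(2)] .
  have "[:0,1:] ^ ?f dvd w * (w * pderiv q - q * pderiv w)"
    using assms(3) fe power_le_dvd by blast
  moreover have "[:0,1:] ^ ?f dvd q" using order_1[of 0 q] by simp
  then have "[:0,1:] ^ ?f dvd q * (w * pderiv w)" by (rule dvd_mult2)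
  ultimately have "[:0,1:] ^ ?f dvd w * (w * pderiv q - q * pderiv w) + q * (w * pderiv w)"
    by (rule dvd_add)
  also have "\<dots> = w * (w * pderiv q)" by (simp add: algebra_simps)
  finally have dv: "[:0,1:] ^ ?f dvd w * (w * pderiv q)" .
  have wq: "w * pderiv q \<noteq> 0" "w * (w * pderiv q) \<noteq> 0" using q' assms(1) by auto
  have "?f \<le> order 0 (w * (w * pderiv q))" using dv wq(2) order_divides[of 0 ?f "w * (w * pderiv q)"] by simp
  also have "\<dots> = order 0 w + (order 0 w + order 0 (pderiv q))"
    by (simp only: order_mult[OF wq(1)] order_mult[OF wq(2)])
  also have "order 0 w = 0" using assms(1) by (simp add: order_0I)
  finally show False using of' by simp
qed

text \<open>
  Polynomials with vanishing Wronskian are proportional. The linear combination \<open>r\<close> in the proof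
  is the one that vanishes at 0, so it has infinite order there.
\<close>

lemma wronskian_zero:
  fixes p q :: "complex poly"
  assumes "pderiv p * q = p * pderiv q"
  shows "poly p t * poly q 0 = poly q t * poly p 0"
proof -
  have main: "poly p t * poly q 0 = poly q t * poly p 0"
    if pq: "pderiv p * q = p * pderiv q" and q: "poly q 0 \<noteq> 0" for p q :: "complex poly"
  proof -
    define r where "r = smult (poly q 0) p - smult (poly p 0) q"
    have "q * pderiv r - r * pderiv q = smult (poly q 0) (pderiv p * q - p * pderiv q)"
      by (simp add: r_def pderiv_diff pderiv_smult algebra_simps smult_diff_right)
    then have 0: "q * pderiv r - r * pderiv q = 0" using pq by simp
    have "r = 0"
    proof (rule ccontr)
      assume r: "r \<noteq> 0"
      have "poly r 0 = 0" by (simp add: r_def)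
      then have "[:0,1:] ^ Suc (order 0 r) dvd r" using wronskian_order[OF q] 0 by simp
      then show False using order_2[OF r, of 0] by simp
    qed
    then have "poly r t = 0" by simp
    then show ?thesis by (simp add: r_def mult.commute)
  qed
  show ?thesis
  proof (cases "poly q 0 = 0")
    case True
    show ?thesis
    proof (cases "poly p 0 = 0")
      case False
      show ?thesis using main[OF _ False, of q] assms by (simp add: mult.commute)
    qed (use True in simp)
  qed (use main assms in blast)
qed

definition line_poly :: "(point \<Rightarrow> complex) \<Rightarrow> point \<Rightarrow> point \<Rightarrow> complex poly" where
  "line_poly f x v = (SOME p. \<forall>t. f (\<lambda>i. x i + t * v i) = poly p t)"

lemma poly_line_poly: "polyfun V f \<Longrightarrow> poly (line_poly f x v) t = f (\<lambda>i. x i + t * v i)"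
proof -
  assume "polyfun V f"
  then have "\<exists>p. \<forall>t. f (\<lambda>i. x i + t * v i) = poly p t" using polyfun_line by metis
  then have "\<forall>t. f (\<lambda>i. x i + t * v i) = poly (line_poly f x v) t"
    unfolding line_poly_def by (rule someI_ex)
  then show ?thesis by simp
qed

lemma poly_pderiv_line_poly:
  "polyfun4 f \<Longrightarrow> poly (pderiv (line_poly f x v)) t = dd v f (\<lambda>i. x i + t * v i)"
  by (rule dd_line_poly) (auto simp: poly_line_poly)

text \<open>
  A quotient whose derivative along a line vanishes is constant on that line; the statement is
  free of denominators, so zeros of \<open>g\<close> do no harm.
\<close>

lemma constant_ratio_on_line:
  assumes f: "polyfun4 f" and g: "polyfun4 g"
    and eq: "\<And>t. dd v f (\<lambda>i. x i + t * v i) * g (\<lambda>i. x i + t * v i)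
                = f (\<lambda>i. x i + t * v i) * dd v g (\<lambda>i. x i + t * v i)"
  shows "f (\<lambda>i. x i + t * v i) * g x = g (\<lambda>i. x i + t * v i) * f x"
proof -
  obtain p where p: "\<And>t. f (\<lambda>i. x i + t * v i) = poly p t" using polyfun_line[OF f] by blast
  obtain q where q: "\<And>t. g (\<lambda>i. x i + t * v i) = poly q t" using polyfun_line[OF g] by blast
  have "poly (pderiv p * q) t = poly (p * pderiv q) t" for t
    using eq[of t] by (simp add: dd_line_poly[OF f p] dd_line_poly[OF g q] p q)
  then have "pderiv p * q = p * pderiv q" by (rule poly_eq_poly_eq_iff[THEN iffD1, OF ext])
  from wronskian_zero[OF this, of t] show ?thesis using p[of 0] q[of 0] by (simp add: p q)
qed

section \<open>Unique factorization and relations between polynomial functions\<close>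

type_synonym poly4 = "complex poly poly poly poly"

text \<open>
  Iterated univariate polynomials over the complex numbers form a factorial ring by their type,
  and they have a division with remainder in the outermost variable. The map \<open>\<pi>\<close> tells which
  coordinate of a point each level stands for; the outermost variable is the coordinate \<open>\<pi> 3\<close>.
\<close>

definition eval4 :: "(nat \<Rightarrow> nat) \<Rightarrow> poly4 \<Rightarrow> point \<Rightarrow> complex" where
  "eval4 \<pi> q x = poly (poly (poly (poly q [:[:[:x (\<pi> 3):]:]:]) [:[:x (\<pi> 2):]:]) [:x (\<pi> 1):]) (x (\<pi> 0))"

lemma eval4_simps [simp]:
  "eval4 \<pi> (p + q) x = eval4 \<pi> p x + eval4 \<pi> q x"
  "eval4 \<pi> (p * q) x = eval4 \<pi> p x * eval4 \<pi> q x"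
  "eval4 \<pi> (p ^ k) x = eval4 \<pi> p x ^ k"
  "eval4 \<pi> 0 x = 0" "eval4 \<pi> 1 x = 1"
  by (simp_all add: eval4_def)

text \<open>
  One level of iterated polynomials: \<open>E x\<close> evaluates the coefficients at \<open>x\<close>, and \<open>c x\<close> is the
  coordinate \<open>f x\<close>, seen as a constant of the coefficient ring.
\<close>

lemma polyfun_poly:
  assumes "polyfun V f" "\<And>k. polyfun V (\<lambda>x. E x (coeff p k))"
    and "\<And>x a b. E x (a + b) = E x a + E x b" "\<And>x a b. E x (a * b) = E x a * E x b"
    and "\<And>x. E x (c x) = f x" "\<And>x. E x 0 = 0" "\<And>x. E x 1 = 1"
  shows "polyfun V (\<lambda>x. E x (poly p (c x)))"
  using assms(2)
proof (induction p)
  case 0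
  then show ?case using assms(6) by (simp add: polyfun_const)
next
  case (pCons a p)
  have "polyfun V (\<lambda>x. E x (coeff (pCons a p) (Suc k)))" for k using pCons.prems[of "Suc k"] .
  then have "polyfun V (\<lambda>x. E x (poly p (c x)))" using pCons.IH by simp
  moreover have "polyfun V (\<lambda>x. E x a)" using pCons.prems[of 0] by simp
  ultimately have "polyfun V (\<lambda>x. E x a + f x * E x (poly p (c x)))"
    by (intro polyfun_intros assms(1))
  then show ?case by (simp add: assms(3,4,5))
qed

lemma polyfun_eval4: "polyfun (\<pi> ` {..<4}) (eval4 \<pi> q)"
  and polyfun_eval4_const: "polyfun (\<pi> ` {..<3}) (eval4 \<pi> [:r:])"
proof -
  have v: "polyfun (\<pi> ` {..<n}) (\<lambda>x. x (\<pi> i))" if "i < n" for n i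
    using that by (intro polyfun_var) auto
  have 1: "polyfun (\<pi> ` {..<n}) (\<lambda>x. poly c (x (\<pi> 0)))" if "n > 0" for n and c :: "complex poly"
    by (rule polyfun_poly[where E = "\<lambda>x. id", simplified])
       (use that v in \<open>auto intro: polyfun_intros\<close>)
  have 2: "polyfun (\<pi> ` {..<n}) (\<lambda>x. poly (poly c [:x (\<pi> 1):]) (x (\<pi> 0)))"
    if "n > 1" for n and c :: "complex poly poly"
    by (rule polyfun_poly[where E = "\<lambda>x q. poly q (x (\<pi> 0))", OF v[of 1]]) (use that 1 in auto)
  have 3: "polyfun (\<pi> ` {..<n}) (\<lambda>x. poly (poly (poly c [:[:x (\<pi> 2):]:]) [:x (\<pi> 1):]) (x (\<pi> 0)))"
    if "n > 2" for n and c :: "complex poly poly poly"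
    by (rule polyfun_poly[where E = "\<lambda>x q. poly (poly q [:x (\<pi> 1):]) (x (\<pi> 0))", OF v[of 2]])
       (use that 2 in auto)
  show "polyfun (\<pi> ` {..<3}) (eval4 \<pi> [:r:])" using 3[of 3 r] by (simp add: eval4_def[abs_def])
  show "polyfun (\<pi> ` {..<4}) (eval4 \<pi> q)" unfolding eval4_def[abs_def]
    by (rule polyfun_poly[where E = "\<lambda>x q. poly (poly (poly q [:[:x (\<pi> 2):]:]) [:x (\<pi> 1):]) (x (\<pi> 0))",
        OF v[of 3]]) (use 3 in auto)
qed

lemma eval4_surj:
  assumes "polyfun V f" "V \<subseteq> \<pi> ` {..<4}"
  obtains q where "f = eval4 \<pi> q"
proof -
  have "\<exists>q. f = eval4 \<pi> q"
    using assms(1)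
  proof (induction rule: polyfun.induct)
    case (polyfun_const c)
    have "(\<lambda>x. c) = eval4 \<pi> [:[:[:[:c:]:]:]:]" by (auto simp: eval4_def)
    then show ?case by blast
  next
    case (polyfun_var i)
    then obtain m where m: "m < 4" "i = \<pi> m" using assms(2) by blast
    from m(1) consider "m = 0" | "m = 1" | "m = 2" | "m = 3" by linarith
    then show ?case
    proof cases
      case 1
      then have "(\<lambda>x. x i) = eval4 \<pi> [:[:[:[:0,1:]:]:]:]" using m by (auto simp: eval4_def)
      then show ?thesis by blast
    next
      case 2
      then have "(\<lambda>x. x i) = eval4 \<pi> [:[:[:0,1:]:]:]" using m by (auto simp: eval4_def)
      then show ?thesis by blast
    next
      case 3
      then have "(\<lambda>x. x i) = eval4 \<pi> [:[:0,1:]:]" using m by (auto simp: eval4_def)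
      then show ?thesis by blast
    next
      case 4
      then have "(\<lambda>x. x i) = eval4 \<pi> [:0,1:]" using m by (auto simp: eval4_def)
      then show ?thesis by blast
    qed
  next
    case (polyfun_add f g)
    then obtain p q where "f = eval4 \<pi> p" "g = eval4 \<pi> q" by blast
    then have "(\<lambda>x. f x + g x) = eval4 \<pi> (p + q)" by auto
    then show ?case by blast
  next
    case (polyfun_mult f g)
    then obtain p q where "f = eval4 \<pi> p" "g = eval4 \<pi> q" by blast
    then have "(\<lambda>x. f x * g x) = eval4 \<pi> (p * q)" by auto
    then show ?case by blast
  qed
  then show ?thesis using that by blast
qed

lemma poly_nonroot_in_range:
  fixes q :: "'a::idom poly" and c :: "complex \<Rightarrow> 'a"
  assumes "q \<noteq> 0" "inj c"
  obtains t where "poly q (c t) \<noteq> 0"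
proof -
  have "infinite (range c)" using assms(2) infinite_UNIV_char_0 finite_imageD by blast
  moreover have "finite {x. poly q x = 0}" by (rule poly_roots_finite[OF assms(1)])
  ultimately have "\<not> range c \<subseteq> {x. poly q x = 0}" using finite_subset by blast
  then show ?thesis using that by blast
qed

lemma eval4_nonzero:
  assumes "q \<noteq> 0" "inj_on \<pi> {..<4}"
  obtains x where "eval4 \<pi> q x \<noteq> 0"
proof -
  obtain x3 where x3: "poly q [:[:[:x3:]:]:] \<noteq> 0"
    by (rule poly_nonroot_in_range[OF assms(1), where c = "\<lambda>x. [:[:[:x:]:]:]"]) (auto simp: inj_def)
  obtain x2 where x2: "poly (poly q [:[:[:x3:]:]:]) [:[:x2:]:] \<noteq> 0"
    by (rule poly_nonroot_in_range[OF x3, where c = "\<lambda>x. [:[:x:]:]"]) (auto simp: inj_def)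
  obtain x1 where x1: "poly (poly (poly q [:[:[:x3:]:]:]) [:[:x2:]:]) [:x1:] \<noteq> 0"
    by (rule poly_nonroot_in_range[OF x2, where c = "\<lambda>x. [:x:]"]) (auto simp: inj_def)
  obtain x0 where x0: "poly (poly (poly (poly q [:[:[:x3:]:]:]) [:[:x2:]:]) [:x1:]) x0 \<noteq> 0"
    by (rule poly_nonroot_in_range[OF x1, where c = "\<lambda>x. x"]) (auto simp: inj_def)
  define x where "x = (\<lambda>i. if i = \<pi> 0 then x0 else if i = \<pi> 1 then x1 else if i = \<pi> 2 then x2 else x3)"
  have "\<pi> 1 \<noteq> \<pi> 0" "\<pi> 2 \<noteq> \<pi> 0" "\<pi> 3 \<noteq> \<pi> 0" "\<pi> 2 \<noteq> \<pi> 1" "\<pi> 3 \<noteq> \<pi> 1" "\<pi> 3 \<noteq> \<pi> 2"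
    using assms(2) by (auto simp: inj_on_eq_iff)
  then have "eval4 \<pi> q x \<noteq> 0" using x0 by (simp add: eval4_def x_def)
  then show ?thesis using that by blast
qed

lemma eval4_inject:
  assumes "\<And>x. eval4 \<pi> p x = eval4 \<pi> q x" "inj_on \<pi> {..<4}"
  shows "p = q"
proof (rule ccontr)
  assume "p \<noteq> q"
  then have "p - q \<noteq> 0" by simp
  then obtain x where "eval4 \<pi> (p - q) x \<noteq> 0" using eval4_nonzero assms(2) by blast
  moreover have "eval4 \<pi> (p - q) x = eval4 \<pi> p x - eval4 \<pi> q x" by (simp add: eval4_def)
  ultimately show False using assms(1) by simp
qed

text \<open>
  Cancelling the greatest common divisor \<open>c\<close> of \<open>f\<close> and \<open>g\<close> leaves coprime \<open>a\<close> and \<open>b\<close>.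
  Coprimality is recorded as the divisibility that it is needed for: \<open>a ^ k\<close> divides \<open>v\<close> if it
  divides \<open>b ^ k * v\<close>.
\<close>

lemma polyfun_coprime_factorization:
  assumes f: "polyfun4 f" and g: "polyfun4 g" and nz: "g x0 \<noteq> 0"
  obtains a b c where "polyfun4 a" "polyfun4 b" "polyfun4 c"
    "\<And>x. f x = b x * c x" "\<And>x. g x = a x * c x"
    "\<And>k u v. polyfun4 u \<Longrightarrow> polyfun4 v \<Longrightarrow> (\<And>x. a x ^ k * u x = b x ^ k * v x) \<Longrightarrow>
       \<exists>r. polyfun4 r \<and> (\<forall>x. v x = a x ^ k * r x)"
proof -
  have id: "inj_on (id :: nat \<Rightarrow> nat) {..<4}" "{..<4} \<subseteq> (id :: nat \<Rightarrow> nat) ` {..<4}" by auto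
  have pf: "polyfun4 (eval4 id q)" for q using polyfun_eval4[of id q] by simp
  obtain F where F: "f = eval4 id F" using eval4_surj[OF f id(2)] .
  obtain G where G: "g = eval4 id G" using eval4_surj[OF g id(2)] .
  have "G \<noteq> 0" using nz G by auto
  define C where "C = gcd F G"
  have "C \<noteq> 0" using \<open>G \<noteq> 0\<close> by (simp add: C_def)
  have "gcd F G \<noteq> 0" using \<open>G \<noteq> 0\<close> by simp
  from gcd_coprime_exists[OF this] obtain A B
    where AB: "F = B * C" "G = A * C" "coprime B A" unfolding C_def by blast
  then have A: "G = A * C" and B: "F = B * C" and cop: "coprime A B" by (simp_all add: coprime_commute)
  show ?thesis
  proof (rule that[of "eval4 id A" "eval4 id B" "eval4 id C"])
    fix k u v assume u: "polyfun4 u" and v: "polyfun4 v"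
      and eq: "\<And>x. eval4 id A x ^ k * u x = eval4 id B x ^ k * v x"
    obtain U where U: "u = eval4 id U" using eval4_surj[OF u id(2)] .
    obtain V where V: "v = eval4 id V" using eval4_surj[OF v id(2)] .
    have "A ^ k * U = B ^ k * V"
      by (rule eval4_inject[OF _ id(1)]) (use eq U V in auto)
    then have "A ^ k dvd B ^ k * V" by (metis dvd_triv_left)
    then have "A ^ k dvd V" using cop by (simp add: coprime_dvd_mult_right_iff)
    then obtain R where "V = A ^ k * R" by (auto simp: dvd_def)
    then show "\<exists>r. polyfun4 r \<and> (\<forall>x. v x = eval4 id A x ^ k * r x)"
      using V pf by (intro exI[of _ "eval4 id R"]) auto
  qed (use pf A B F G in auto)
qed

text \<open>
  The polynomial relations between the components of \<open>H\<close> form a prime ideal \<open>I\<close>. If three of the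
  components, namely all but the one with index \<open>j\<close>, satisfy no relation among themselves, then
  \<open>I\<close> is principal. Indeed, take a prime \<open>p \<in> I\<close> of least degree in the variable with index \<open>j\<close>,
  which is positive because no nonzero relation is free of that variable. Pseudo-division of a
  relation \<open>F\<close> by \<open>p\<close> leaves the remainder 0 by minimality, so \<open>p\<close> divides \<open>s * F\<close> for a nonzero
  \<open>s\<close> without that variable. As \<open>p\<close> is prime and does not divide \<open>s\<close>, it divides \<open>F\<close>.

  The last conclusion bounds the powers of \<open>p\<close> that divide a given nonzero function.
\<close>

lemma relation_ideal_principal:
  assumes j: "j < 4" and H: "\<And>i. i < 4 \<Longrightarrow> polyfun4 (H i)"
    and P0: "polyfun4 P0" "P0 x0 \<noteq> 0" "\<And>x. P0 (\<lambda>i. H i x) = 0"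
    and indep: "\<And>F y. polyfun ({..<4} - {j}) F \<Longrightarrow> (\<And>x. F (\<lambda>i. H i x) = 0) \<Longrightarrow> F y = 0"
  obtains p where "polyfun4 p" "\<And>x. p (\<lambda>i. H i x) = 0"
    "\<And>F. polyfun4 F \<Longrightarrow> (\<And>x. F (\<lambda>i. H i x) = 0) \<Longrightarrow> \<exists>r. polyfun4 r \<and> (\<forall>x. F x = p x * r x)"
    "\<And>F y. polyfun4 F \<Longrightarrow> F y \<noteq> 0 \<Longrightarrow> \<exists>N. \<forall>e r. polyfun4 r \<longrightarrow> (\<forall>x. F x = p x ^ e * r x) \<longrightarrow> e \<le> N"
proof -
  define \<pi> where "\<pi> = transpose j (3::nat)"
  have \<pi>4: "\<pi> ` {..<4} = {..<4}" unfolding \<pi>_def using j by (intro transpose_image_eq) auto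
  have inj: "inj_on \<pi> {..<4}" unfolding \<pi>_def by (rule inj_on_subset[OF inj_transpose]) auto
  have "\<pi> ` {..<3} = \<pi> ` ({..<4} - {3})" by (rule arg_cong[of _ _ "image \<pi>"]) auto
  also have "\<dots> = {..<4} - {j}"
    using inj_on_image_set_diff[OF inj, of "{..<4}" "{3}"] \<pi>4 by (simp add: \<pi>_def)
  finally have \<pi>3: "\<pi> ` {..<3} = {..<4} - {j}" .
  have pf: "polyfun4 (eval4 \<pi> q)" for q using polyfun_eval4[of \<pi> q] by (simp add: \<pi>4)
  define I where "I = {q. \<forall>x. eval4 \<pi> q (\<lambda>i. H i x) = 0}"
  have polyH: "polyfun4 (\<lambda>x. eval4 \<pi> q (\<lambda>i. H i x))" for q
    by (rule polyfun_comp[OF pf]) (use H in auto)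
  have I_mult: "q * r \<in> I" if "q \<in> I" for q r using that by (auto simp: I_def)
  have I_diff: "q - r \<in> I" if "q \<in> I" "r \<in> I" for q r using that by (auto simp: I_def eval4_def)
  have I_prime: "q \<in> I \<or> r \<in> I" if "q * r \<in> I" for q r
    using polyfun_mult_eq_0[OF polyH polyH, of q r] that by (auto simp: I_def)
  have I_const: "r = 0" if "[:r:] \<in> I" for r
  proof -
    have "eval4 \<pi> [:r:] y = 0" for y
      by (rule indep) (use that polyfun_eval4_const[of \<pi> r] in \<open>auto simp: \<pi>3 I_def\<close>)
    then have "[:r:] = 0" using eval4_nonzero[OF _ inj] by blast
    then show ?thesis by simp
  qed
  obtain Q0 where Q0: "P0 = eval4 \<pi> Q0" using eval4_surj[OF P0(1), of \<pi>] \<pi>4 by auto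
  have "\<exists>q. q \<in> I \<and> q \<noteq> 0" using P0(2,3) Q0 by (intro exI[of _ Q0]) (auto simp: I_def)
  then obtain P where P: "P \<in> I" "P \<noteq> 0" and Pmin: "\<And>q. q \<in> I \<Longrightarrow> q \<noteq> 0 \<Longrightarrow> degree P \<le> degree q"
    using ex_has_least_nat[of "\<lambda>q. q \<in> I \<and> q \<noteq> 0" _ degree] by blast
  have prodI: "prod_mset M \<in> I \<Longrightarrow> \<exists>q. q \<in># M \<and> q \<in> I" for M
  proof (induction M)
    case empty
    then show ?case by (auto simp: I_def)
  next
    case (add q M)
    then show ?case using I_prime[of q "prod_mset M"] by auto
  qed
  have "normalize (prod_mset (prime_factorization P)) = normalize P"
    using P(2) by (rule prod_mset_prime_factorization_weak)
  then have "P dvd prod_mset (prime_factorization P)" by (rule associatedD1[OF sym])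
  then obtain k where "prod_mset (prime_factorization P) = P * k" by (auto simp: dvd_def)
  then have "prod_mset (prime_factorization P) \<in> I" using I_mult[OF P(1), of k] by simp
  then obtain p where pfac: "p \<in># prime_factorization P" and pI: "p \<in> I" using prodI by blast
  have pprime: "prime_elem p" using pfac in_prime_factors_imp_prime by blast
  then have p0: "p \<noteq> 0" by auto
  have "p dvd P" using pfac by (rule in_prime_factors_imp_dvd)
  then have pdeg: "degree p \<le> degree P" using P(2) by (rule dvd_imp_degree_le)
  have pmin: "degree p \<le> degree q" if "q \<in> I" "q \<noteq> 0" for q using Pmin[OF that] pdeg by simp
  have dpos: "degree p > 0"
  proof (rule ccontr)
    assume "\<not> ?thesis"
    then obtain r where "p = [:r:]" using degree_eq_zeroE by blast
    then show False using I_const pI p0 by auto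
  qed
  have dvd: "p dvd F" if F: "F \<in> I" for F
  proof -
    define r where "r = pseudo_mod F p"
    obtain a q where a: "a \<noteq> 0" "smult a F = p * q + r" "r = 0 \<or> degree r < degree p"
      using pseudo_mod[OF p0, of F] unfolding r_def by blast
    have "r = [:a:] * F - p * q" using a(2) by (simp add: algebra_simps)
    moreover have "[:a:] * F \<in> I" using I_mult[OF F, of "[:a:]"] by (simp add: mult.commute)
    ultimately have "r \<in> I" using I_diff I_mult[OF pI] by simp
    then have "r = 0" using a(3) pmin[of r] by force
    then have "p dvd [:a:] * F" using a(2) by simp
    moreover have "\<not> p dvd [:a:]"
    proof
      assume "p dvd [:a:]"
      then have "degree p \<le> degree [:a:]" by (rule dvd_imp_degree_le) (use a(1) in simp)
      then show False using dpos by simp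
    qed
    ultimately show ?thesis using pprime prime_elem_dvd_multD by blast
  qed
  show ?thesis
  proof (rule that[of "eval4 \<pi> p"])
    fix F assume F: "polyfun4 F" "\<And>x. F (\<lambda>i. H i x) = 0"
    obtain f where f: "F = eval4 \<pi> f" using eval4_surj[OF F(1), of \<pi>] \<pi>4 by auto
    have "f \<in> I" using F(2) f by (auto simp: I_def)
    then obtain r where "f = p * r" using dvd by (auto simp: dvd_def)
    then show "\<exists>r. polyfun4 r \<and> (\<forall>x. F x = eval4 \<pi> p x * r x)"
      using pf f by (intro exI[of _ "eval4 \<pi> r"]) auto
  next
    fix F y assume F: "polyfun4 F" "F y \<noteq> 0"
    obtain f where f: "F = eval4 \<pi> f" using eval4_surj[OF F(1), of \<pi>] \<pi>4 by auto
    have f0: "f \<noteq> 0" using F(2) f by auto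
    show "\<exists>N. \<forall>e r. polyfun4 r \<longrightarrow> (\<forall>x. F x = eval4 \<pi> p x ^ e * r x) \<longrightarrow> e \<le> N"
    proof (intro exI allI impI)
      fix e r assume r: "polyfun4 r" "\<forall>x. F x = eval4 \<pi> p x ^ e * r x"
      obtain s where s: "r = eval4 \<pi> s" using eval4_surj[OF r(1), of \<pi>] \<pi>4 by auto
      have "f = p ^ e * s" by (rule eval4_inject[OF _ inj]) (use r f s in auto)
      then have "degree (p ^ e) \<le> degree f" using f0 by (intro dvd_imp_degree_le) auto
      moreover have "e \<le> degree (p ^ e)" using dpos p0 by (simp add: degree_power_eq)
      ultimately show "e \<le> degree f" by simp
    qed
  qed (use pf pI in \<open>auto simp: I_def\<close>)
qed

section \<open>Homogeneous quasi-translations in four variables\<close>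

text \<open>
  Up to a unit the only factors of \<open>s ^ d\<close> are powers of \<open>s\<close>: over the complex numbers, a
  nonconstant factor has a zero, and this can only be 0.
\<close>

lemma poly_factor_of_power_constant:
  fixes p q :: "complex poly"
  assumes eq: "\<And>s. poly p s * poly q s = c * s ^ d" and c: "c \<noteq> 0" and q0: "d = 0 \<or> poly q 0 \<noteq> 0"
  shows "poly q s = poly q 0"
proof -
  have "poly q z \<noteq> 0" for z using eq[of z] c q0 by (cases "z = 0") auto
  then have "constant (poly q)" using fundamental_theorem_of_algebra by blast
  then show ?thesis by (simp add: constant_def)
qed

lemma poly_eq_at_0:
  fixes p q :: "complex poly"
  assumes "\<And>s. s \<noteq> 0 \<Longrightarrow> poly p s = poly q s"
  shows "poly p 0 = poly q 0"
proof -
  have "poly ([:0,1:] * (p - q)) s = 0" for s using assms[of s] by (cases "s = 0") auto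
  then have "[:0,1:] * (p - q) = 0" using poly_all_0_iff_0 by blast
  then show ?thesis by simp
qed

lemma polyfun_scaling:
  assumes "polyfun V f"
  shows "\<exists>p. \<forall>s. f (\<lambda>j. s * x j + u j) = poly p s"
  using polyfun_curve[OF assms, of "\<lambda>j. [:u j, x j:]"] by (simp add: add.commute)

text \<open>
  The iterated derivatives are the Taylor coefficients of \<open>f\<close> along the line through \<open>x\<close> in
  direction \<open>v\<close>.
\<close>

lemma polyfun_zero_on_line_if_derivatives_zero:
  assumes f: "polyfun4 f" and z: "\<And>n. (dd v ^^ n) f x = 0"
  shows "f (\<lambda>i. x i + v i) = 0"
proof -
  have pf: "polyfun4 ((dd v ^^ n) f)" for n by (induction n) (use f in \<open>auto intro: polyfun_dd\<close>)
  obtain p where p: "\<And>t. f (\<lambda>i. x i + t * v i) = poly p t" using polyfun_line[OF f] by blast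
  have der: "(dd v ^^ n) f (\<lambda>i. x i + t * v i) = poly ((pderiv ^^ n) p) t" for n t
  proof (induction n arbitrary: t)
    case 0
    then show ?case using p by simp
  next
    case (Suc n)
    then show ?case using dd_line_poly[OF pf[of n], of x v "(pderiv ^^ n) p" t] by simp
  qed
  have "coeff p n = 0" for n
  proof -
    have "coeff ((pderiv ^^ n) p) 0 = 0" using der[of n 0] z[of n] by (simp add: poly_0_coeff_0)
    then show ?thesis by (simp add: coeff_higher_pderiv pochhammer_fact[symmetric])
  qed
  then have "p = 0" by (simp add: poly_eq_iff)
  then show ?thesis using p[of 1] by simp
qed

text \<open>
  Maps in fewer than four variables are covered by adding components that are zero. The
  condition that \<open>x - H\<close> is inverse to \<open>x + H\<close> is equivalent to the invariance of \<open>H\<close> under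
  \<open>x \<mapsto> x + H x\<close>.
\<close>

locale homogeneous_quasi_translation =
  fixes H :: "nat \<Rightarrow> point \<Rightarrow> complex" and d :: nat
  assumes polyfun_H: "i < 4 \<Longrightarrow> polyfun4 (H i)"
    and H_homogeneous: "i < 4 \<Longrightarrow> H i (\<lambda>j. s * x j) = s ^ d * H i x"
    and H_shift: "i < 4 \<Longrightarrow> H i (\<lambda>j. x j + H j x) = H i x"
begin

lemma H_shift_nat: "i < 4 \<Longrightarrow> H i (\<lambda>j. x j + of_nat m * H j x) = H i x"
proof (induction m arbitrary: x)
  case (Suc m)
  have "H i (\<lambda>j. x j + of_nat (Suc m) * H j x)
      = H i (\<lambda>j. (\<lambda>j. x j + H j x) j + of_nat m * H j (\<lambda>j. x j + H j x))"
    by (rule polyfun_cong_point[OF polyfun_H[OF Suc.prems]]) (auto simp: H_shift algebra_simps)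
  also have "\<dots> = H i (\<lambda>j. x j + H j x)" by (rule Suc.IH[OF Suc.prems])
  also have "\<dots> = H i x" by (rule H_shift[OF Suc.prems])
  finally show ?case .
qed simp

text \<open>
  By iteration the invariance holds for all multiples \<open>t = 0, 1, 2, \<dots>\<close> of the shift, hence for
  all \<open>t\<close> because it is polynomial in \<open>t\<close>.
\<close>

lemma H_flow:
  assumes i: "i < 4"
  shows "H i (\<lambda>j. x j + t * H j x) = H i x"
proof -
  obtain p where p: "\<And>t. H i (\<lambda>j. x j + t * H j x) = poly p t"
    using polyfun_line[OF polyfun_H[OF i], of x "\<lambda>j. H j x"] by auto
  have "range of_nat \<subseteq> {t. poly (p - [:H i x:]) t = 0}"
    using H_shift_nat[OF i] by (auto simp: p[symmetric])
  moreover have "infinite (range (of_nat :: nat \<Rightarrow> complex))"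
    using finite_imageD[of of_nat UNIV] by (auto simp: inj_on_def)
  ultimately have "p - [:H i x:] = 0" using poly_roots_finite finite_subset by blast
  then have "poly p t = H i x" by simp
  then show ?thesis using p by simp
qed

lemma H_span:
  assumes i: "i < 4"
  shows "H i (\<lambda>j. s * x j + t * H j x) = s ^ d * H i x"
proof -
  from polyfun_scaling[OF polyfun_H[OF i], of x "\<lambda>j. t * H j x"]
  obtain p where p: "\<forall>s. H i (\<lambda>j. s * x j + t * H j x) = poly p s" ..
  have ne: "poly p s = s ^ d * H i x" if "s \<noteq> 0" for s
  proof -
    have "(\<lambda>j. s * x j + t * H j x) = (\<lambda>j. s * (x j + (t / s) * H j x))"
      using that by (simp add: distrib_left)
    then have "H i (\<lambda>j. s * x j + t * H j x) = s ^ d * H i (\<lambda>j. x j + (t / s) * H j x)"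
      using H_homogeneous[OF i] by simp
    then show ?thesis unfolding H_flow[OF i] p[rule_format] .
  qed
  have "poly p 0 = poly (monom (H i x) d) 0"
    by (rule poly_eq_at_0) (use ne in \<open>auto simp: poly_monom mult.commute\<close>)
  then have "poly p s = s ^ d * H i x" using ne[of s] by (cases "s = 0") (auto simp: poly_monom mult.commute)
  then show ?thesis unfolding p[rule_format] .
qed

lemma H_Euler:
  assumes i: "i < 4"
  shows "dd x (H i) x = of_nat d * H i x"
proof -
  have eq: "H i (\<lambda>j. x j + t * x j) = (1 + t) ^ d * H i x" for t
    using H_homogeneous[OF i, of "1 + t" x] by (simp add: distrib_right)
  have "((\<lambda>t. (1 + t) ^ d * H i x) has_field_derivative of_nat d * H i x) (at 0)"
    by (auto intro!: derivative_eq_intros)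
  then have 1: "((\<lambda>t. H i (\<lambda>j. x j + t * x j)) has_field_derivative of_nat d * H i x) (at 0)"
    by (simp add: eq)
  have "((\<lambda>t. H i (\<lambda>j. x j + t * x j)) has_field_derivative dd x (H i) x) (at 0)"
    using dd_line[OF polyfun_H[OF i], of x x 0] by simp
  then show ?thesis using 1 by (rule DERIV_unique)
qed

lemma dd_H_H:
  assumes i: "i < 4"
  shows "dd (\<lambda>j. H j x) (H i) x = 0"
proof -
  have "((\<lambda>t. H i (\<lambda>j. x j + t * H j x)) has_field_derivative dd (\<lambda>j. H j x) (H i) x) (at 0)"
    using dd_line[OF polyfun_H[OF i], of x "\<lambda>j. H j x" 0] by simp
  then have "((\<lambda>t. H i x) has_field_derivative dd (\<lambda>j. H j x) (H i) x) (at 0)"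
    by (simp add: H_flow[OF i])
  then show ?thesis using DERIV_const by (rule DERIV_unique)
qed

text \<open>
  The Jacobian of a quasi-translation is nilpotent, here in the form that it has no nonzero
  eigenvalues: if \<open>v\<close> is an eigenvector at \<open>x\<close> with eigenvalue \<open>lam\<close>, then the differential of
  \<open>y \<mapsto> y + t * H y\<close> at \<open>x\<close> multiplies \<open>v\<close> by \<open>1 + t * lam\<close>, and so kills it for \<open>t = - 1 / lam\<close>.
  But \<open>H\<close> is invariant under this map, so its differential kills \<open>v\<close> as well.
\<close>

lemma Jacobian_no_eigenvalue:
  assumes ev: "\<And>i. i < 4 \<Longrightarrow> dd v (H i) x = lam * v i" and lam: "lam \<noteq> 0" and i: "i < 4"
  shows "v i = 0"
proof -
  define t where "t = - 1 / lam"
  let ?\<gamma> = "\<lambda>j s. x j + s * v j + t * H j (\<lambda>j. x j + s * v j)"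
  have "(?\<gamma> j has_field_derivative 0) (at 0)" if "j < 4" for j
  proof -
    have "((\<lambda>s. H j (\<lambda>j. x j + s * v j)) has_field_derivative dd v (H j) x) (at 0)"
      using dd_line[OF polyfun_H[OF that], of x v 0] by simp
    then have "(?\<gamma> j has_field_derivative v j + t * dd v (H j) x) (at 0)"
      by (auto intro!: derivative_eq_intros)
    moreover have "v j + t * dd v (H j) x = 0" using ev[OF that] lam by (simp add: t_def)
    ultimately show ?thesis by simp
  qed
  then have "((\<lambda>s. H i (\<lambda>j. ?\<gamma> j s)) has_field_derivative dd (\<lambda>j. 0) (H i) (\<lambda>j. ?\<gamma> j 0)) (at 0)"
    by (intro dd_chain[OF polyfun_H[OF i]])
  moreover have "H i (\<lambda>j. ?\<gamma> j s) = H i (\<lambda>j. x j + s * v j)" for s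
    using H_flow[OF i, of "\<lambda>j. x j + s * v j" t] by simp
  ultimately have 1: "((\<lambda>s. H i (\<lambda>j. x j + s * v j)) has_field_derivative
      dd (\<lambda>j. 0) (H i) (\<lambda>j. ?\<gamma> j 0)) (at 0)" by simp
  have "((\<lambda>s. H i (\<lambda>j. x j + s * v j)) has_field_derivative dd v (H i) x) (at 0)"
    using dd_line[OF polyfun_H[OF i], of x v 0] by simp
  then have "dd v (H i) x = dd (\<lambda>j. 0) (H i) (\<lambda>j. ?\<gamma> j 0)" using 1 by (rule DERIV_unique)
  then show ?thesis using ev[OF i] lam by (simp add: dd_def)
qed

text \<open>
  This is \<open>(H k)\<^sup>2\<close> times the partial derivative of \<open>H l / H k\<close> with respect to the variable
  \<open>a\<close>.
\<close>

definition om :: "nat \<Rightarrow> nat \<Rightarrow> nat \<Rightarrow> point \<Rightarrow> complex" where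
  "om l k a x = H k x * pd a (H l) x - H l x * pd a (H k) x"

lemma polyfun_om: "l < 4 \<Longrightarrow> k < 4 \<Longrightarrow> polyfun4 (om l k a)"
  unfolding om_def[abs_def] by (intro polyfun_intros polyfun_pd polyfun_H)

lemma om_dd: "(\<Sum>a<4. om l k a x * v a) = H k x * dd v (H l) x - H l x * dd v (H k) x"
  unfolding om_def dd_def sum_distrib_left sum_subtractf[symmetric]
  by (rule sum.cong) (auto simp: algebra_simps)

text \<open>
  The ratios of the components are homogeneous of degree 0 and constant along \<open>H\<close>, so their
  gradients annihilate both \<open>x\<close> and \<open>H x\<close>.
\<close>

lemma om_x: "l < 4 \<Longrightarrow> k < 4 \<Longrightarrow> (\<Sum>a<4. om l k a x * x a) = 0"
  by (simp add: om_dd H_Euler)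

lemma om_H: "l < 4 \<Longrightarrow> k < 4 \<Longrightarrow> (\<Sum>a<4. om l k a x * H a x) = 0"
  by (simp add: om_dd dd_H_H)

definition proportional :: bool where
  "proportional \<longleftrightarrow> (\<exists>c f. polyfun4 f \<and> (\<forall>l<4. \<forall>x. H l x = c l * f x))"

lemma degree_pos:
  assumes "\<not> proportional"
  shows "d > 0"
proof (rule ccontr)
  assume "\<not> ?thesis"
  then have d0: "d = 0" by simp
  have "H l x = H l (\<lambda>j. 0) * 1" if "l < 4" for l x
  proof -
    have "H l (\<lambda>j. 0 * x j) = 0 ^ d * H l x" by (rule H_homogeneous[OF that])
    then show ?thesis unfolding d0 by simp
  qed
  then have proportional unfolding proportional_def
    by (intro exI[of _ "\<lambda>l. H l (\<lambda>j. 0)"] exI[of _ "\<lambda>x. 1"] conjI polyfun_const allI impI)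
  then show False using assms by simp
qed

lemma ratio_constant_if_om_zero:
  assumes "l < 4" "k < 4" "\<And>z. (\<Sum>a<4. om l k a (\<lambda>j. x j + z * v j) * v a) = 0"
  shows "H l (\<lambda>j. x j + t * v j) * H k x = H k (\<lambda>j. x j + t * v j) * H l x"
proof (rule constant_ratio_on_line[OF polyfun_H polyfun_H])
  fix s
  show "dd v (H l) (\<lambda>i. x i + s * v i) * H k (\<lambda>i. x i + s * v i) =
         H l (\<lambda>i. x i + s * v i) * dd v (H k) (\<lambda>i. x i + s * v i)"
    using assms(3)[of s] unfolding om_dd by (simp add: mult.commute)
qed (use assms in auto)

lemma ratio_constant_everywhere:
  assumes "l < 4" "k < 4" "\<And>a z. a < 4 \<Longrightarrow> om l k a z = 0"
  shows "H l y * H k x = H k y * H l x"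
  using ratio_constant_if_om_zero[OF assms(1,2), of x "\<lambda>j. y j - x j" 1] assms(3) by simp

lemma not_proportional_om_nonzero:
  assumes "\<not> proportional"
  obtains i k a x where "i < 4" "k < 4" "a < 4" "om i k a x \<noteq> 0"
proof (rule ccontr)
  assume neg: "\<not> thesis"
  note obt = that
  have z: "om i k a x = 0" if "i < 4" "k < 4" "a < 4" for i k a x using neg obt that by blast
  have proportional
  proof (cases "\<exists>k<4. \<exists>x. H k x \<noteq> 0")
    case True
    then obtain k x where k: "k < 4" "H k x \<noteq> 0" by blast
    have "H l y = H l x / H k x * H k y" if "l < 4" for l y
      using ratio_constant_everywhere[OF that k(1) z[OF that k(1)], of y x] k(2) by (simp add: field_simps)
    then show ?thesis unfolding proportional_def using polyfun_H[OF k(1)]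
      by (intro exI[of _ "\<lambda>l. H l x / H k x"] exI[of _ "H k"] conjI allI impI)
  next
    case False
    then show ?thesis unfolding proportional_def
      by (intro exI[of _ "\<lambda>l. 0"] exI[of _ "\<lambda>x. 0"]) (auto intro: polyfun_const)
  qed
  then show False using assms by simp
qed

end

section \<open>Parallel gradients of the ratios\<close>

context homogeneous_quasi_translation
begin

text \<open>
  Put \<open>s = 0\<close> in \<open>H (s * x + t * H x) = s ^ d * H x\<close>.
\<close>

lemma H_at_H:
  assumes "\<not> proportional" "i < 4"
  shows "H i (\<lambda>j. H j x) = 0"
  using H_span[OF assms(2), of 0 x 1] degree_pos[OF assms(1)] by simp

text \<open>
  If \<open>H l / H k\<close> and \<open>H i / H k\<close> have linearly independent gradients, then so have \<open>H k\<close>, \<open>H l\<close>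
  and \<open>H i\<close>: the gradients of the ratios annihilate \<open>x\<close>, while the gradient of \<open>H k\<close> does not,
  by Euler's formula. Differentiating a relation \<open>F\<close> between these three components therefore
  shows that all partial derivatives of \<open>F\<close> are relations again. By iteration every Taylor
  coefficient of \<open>F\<close> at a point of the image of \<open>H\<close> vanishes.
\<close>

lemma independent_gradients_no_relation:
  assumes np: "\<not> proportional"
    and klij: "distinct [k, l, i, j]" "{k, l, i, j} = {..<4}"
    and ab: "om l k a x0 * om i k b x0 \<noteq> om l k b x0 * om i k a x0"
    and F: "polyfun ({..<4} - {j}) F" and rel: "\<And>x. F (\<lambda>i. H i x) = 0"
  shows "F y = 0"
proof -
  have V: "{..<4} - {j} = {k, l, i}" using klij by auto
  have lt: "k < 4" "l < 4" "i < 4" "j < 4" using klij(2) by auto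
  define \<Delta> where "\<Delta> x = om l k a x * om i k b x - om l k b x * om i k a x" for x
  have pf\<Delta>: "polyfun4 \<Delta>" unfolding \<Delta>_def[abs_def] by (intro polyfun_intros polyfun_om lt)
  have \<Delta>0: "\<Delta> x0 \<noteq> 0" using ab by (simp add: \<Delta>_def)
  have step: "pd m G (\<lambda>i. H i x) = 0"
    if G: "polyfun ({..<4} - {j}) G" and relG: "\<And>x. G (\<lambda>i. H i x) = 0" and m: "m \<in> {k, l, i}" for G m x
  proof -
    have pfG: "polyfun4 (pd m G)" for m by (rule polyfun_mono[OF polyfun_pd[OF G]]) auto
    have comp: "polyfun4 (\<lambda>x. pd m G (\<lambda>i. H i x))" for m
      by (rule polyfun_comp[OF pfG]) (simp add: polyfun_H)
    show ?thesis
    proof (rule polyfun_zero_generic[OF pf\<Delta> comp[of m] \<Delta>0])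
      fix x assume \<Delta>: "\<Delta> x \<noteq> 0"
      define c where "c m = pd m G (\<lambda>i. H i x)" for m
      have lin: "c k * dd v (H k) x + c l * dd v (H l) x + c i * dd v (H i) x = 0" for v
      proof -
        have "((\<lambda>t. G (\<lambda>m. H m (\<lambda>j. x j + t * v j))) has_field_derivative
            (\<Sum>m\<in>{k,l,i}. pd m G (\<lambda>m. H m (\<lambda>j. x j + 0 * v j)) * dd v (H m) x)) (at 0)"
        proof (rule polyfun_chain)
          show "((\<lambda>t. H m (\<lambda>j. x j + t * v j)) has_field_derivative dd v (H m) x) (at 0)"
            if "m \<in> {k, l, i}" for m
            using dd_line[OF polyfun_H, of m x v 0] that lt by auto
        qed (use G V in auto)
        then have "((\<lambda>t. 0) has_field_derivative (\<Sum>m\<in>{k,l,i}. c m * dd v (H m) x)) (at (0::complex))"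
          by (simp add: relG c_def)
        then have "(\<Sum>m\<in>{k,l,i}. c m * dd v (H m) x) = 0"
          using DERIV_const by (rule DERIV_unique)
        then show ?thesis using klij(1) by (simp add: add.assoc)
      qed
      have "of_nat d * (c k * H k x + c l * H l x + c i * H i x) = 0"
        using lin[of x] lt by (simp add: H_Euler algebra_simps)
      then have eul: "c k * H k x + c l * H l x + c i * H i x = 0"
        using degree_pos[OF np] by simp
      have om0: "c l * om l k e x + c i * om i k e x = 0" if e: "e < 4" for e
      proof -
        have dde: "dd (\<lambda>n. if n = e then 1 else 0) f x = pd e f x" for f
          using e by (simp add: dd_def if_distrib[of "(*) _"] cong: if_cong)
        have "c l * om l k e x + c i * om i k e x
          = H k x * (c k * pd e (H k) x + c l * pd e (H l) x + c i * pd e (H i) x)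
            - (c k * H k x + c l * H l x + c i * H i x) * pd e (H k) x"
          by (simp add: om_def algebra_simps)
        then show ?thesis using lin[of "\<lambda>n. if n = e then 1 else 0"] eul by (simp add: dde)
      qed
      have oz: "om r s e x = 0" if "e \<ge> 4" "r < 4" "s < 4" for r s e
        using that by (simp add: om_def pd_outside[OF polyfun_H])
      have ab4: "a < 4 \<and> b < 4"
      proof (rule ccontr)
        assume "\<not> ?thesis"
        then have "a \<ge> 4 \<or> b \<ge> 4" by auto
        then have "\<Delta> x = 0" using oz[OF _ lt(2,1)] oz[OF _ lt(3,1)] by (auto simp: \<Delta>_def)
        then show False using \<Delta> by simp
      qed
      have "c l * \<Delta> x = (c l * om l k a x + c i * om i k a x) * om i k b x
          - (c l * om l k b x + c i * om i k b x) * om i k a x"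
        by (simp add: \<Delta>_def algebra_simps)
      then have cl: "c l = 0" using om0 ab4 \<Delta> by simp
      have "c i * \<Delta> x = (c l * om l k b x + c i * om i k b x) * om l k a x
          - (c l * om l k a x + c i * om i k a x) * om l k b x"
        by (simp add: \<Delta>_def algebra_simps)
      then have ci: "c i = 0" using om0 ab4 \<Delta> by simp
      have "H k x \<noteq> 0"
      proof
        assume "H k x = 0"
        then have "\<Delta> x = 0" by (simp add: \<Delta>_def om_def)
        then show False using \<Delta> by simp
      qed
      then have "c k = 0" using eul cl ci by simp
      then show "pd m G (\<lambda>i. H i x) = 0" using cl ci m by (auto simp: c_def)
    qed
  qed
  have pf4: "polyfun4 F" by (rule polyfun_mono[OF F]) auto
  let ?y = "\<lambda>i. H i x0"
  let ?v = "\<lambda>i. y i - ?y i"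
  have "polyfun ({..<4} - {j}) ((dd ?v ^^ n) F) \<and> (\<forall>x. (dd ?v ^^ n) F (\<lambda>i. H i x) = 0)" for n
  proof (induction n)
    case 0
    then show ?case using F rel by simp
  next
    case (Suc n)
    let ?G = "(dd ?v ^^ n) F"
    have G: "polyfun ({..<4} - {j}) ?G" "\<And>x. ?G (\<lambda>i. H i x) = 0" using Suc by auto
    have "pd m ?G (\<lambda>i. H i x) = 0" if "m < 4" for m x
    proof (cases "m = j")
      case True
      then show ?thesis using pd_outside[OF G(1)] by simp
    next
      case False
      then have "m \<in> {k, l, i}" using V that by auto
      then show ?thesis by (rule step[OF G])
    qed
    then have "dd ?v ?G (\<lambda>i. H i x) = 0" for x unfolding dd_def by simp
    then show ?case using polyfun_dd[OF G(1)] by simp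
  qed
  then have "F (\<lambda>i. ?y i + ?v i) = 0"
    by (intro polyfun_zero_on_line_if_derivatives_zero[OF pf4]) auto
  then show ?thesis by simp
qed

text \<open>
  The gradients of all ratios of components are parallel, or in other words, the image of \<open>H\<close> is
  at most two-dimensional. Otherwise the ideal of relations is generated by one function \<open>p\<close>.
  Let \<open>p ^ e\<close> be the greatest power of \<open>p\<close> that divides all components, say \<open>H m = p ^ e * R m\<close>.
  At \<open>s * x + t * H x\<close> this product is a multiple of \<open>s ^ d\<close>, which leaves two possibilities for
  each \<open>m\<close>: either \<open>R m\<close> vanishes at \<open>H x\<close> for all \<open>x\<close>, or \<open>R m\<close> is constant. If the former
  holds for all \<open>m\<close>, then each \<open>R m\<close> is a relation and \<open>p ^ Suc e\<close> still divides all components.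
  If some \<open>R m\<close> is a nonzero constant, then \<open>p ^ e\<close> is homogeneous of the same degree as \<open>H\<close>, so
  all \<open>R m\<close> are constant and the components are proportional.
\<close>

lemma om_parallel:
  assumes np: "\<not> proportional" and lt: "l < 4" "i < 4" "k < 4"
  shows "om l k a x * om i k b x = om l k b x * om i k a x"
proof (rule ccontr)
  assume ne: "\<not> ?thesis"
  have "l \<noteq> i" using ne by (auto simp: mult.commute)
  moreover have "l \<noteq> k" "i \<noteq> k" using ne by (auto simp: om_def)
  ultimately have dist: "distinct [k, l, i]" by auto
  then have "card ({..<4} - {k, l, i}) = 1" using lt by (simp add: card_Diff_subset)
  then obtain j where j: "{..<4} - {k, l, i} = {j}" by (auto simp: card_1_singleton_iff)
  then have klij: "distinct [k, l, i, j]" "{k, l, i, j} = {..<4}" using dist lt by auto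
  have j4: "j < 4" using klij(2) by auto
  have "H k x \<noteq> 0" using ne by (auto simp: om_def)
  obtain p where p: "polyfun4 p" "\<And>x. p (\<lambda>i. H i x) = 0"
    "\<And>F. polyfun4 F \<Longrightarrow> (\<And>x. F (\<lambda>i. H i x) = 0) \<Longrightarrow> \<exists>r. polyfun4 r \<and> (\<forall>x. F x = p x * r x)"
    "\<And>F y. polyfun4 F \<Longrightarrow> F y \<noteq> 0 \<Longrightarrow> \<exists>N. \<forall>e r. polyfun4 r \<longrightarrow> (\<forall>x. F x = p x ^ e * r x) \<longrightarrow> e \<le> N"
  proof (rule relation_ideal_principal[of j H "H k" x, OF j4 polyfun_H polyfun_H[OF lt(3)]
        \<open>H k x \<noteq> 0\<close> H_at_H[OF np lt(3)]], goal_cases)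
    case (2 F y)
    show ?case by (rule independent_gradients_no_relation[OF np klij ne 2(2,3)])
  next
    case (3 p)
    show ?case by (rule 3(1)[OF 3(2-5)])
  qed auto
  obtain p_nz where p_nz: "p p_nz \<noteq> 0"
    using p(3)[OF polyfun_H[OF lt(3)] H_at_H[OF np lt(3)]] \<open>H k x \<noteq> 0\<close> by (metis mult_zero_left)
  define D where "D e \<longleftrightarrow> (\<forall>m<4. \<exists>r. polyfun4 r \<and> (\<forall>x. H m x = p x ^ e * r x))" for e
  have "D 0" unfolding D_def using polyfun_H by auto
  moreover obtain N where "\<forall>e r. polyfun4 r \<longrightarrow> (\<forall>x. H k x = p x ^ e * r x) \<longrightarrow> e \<le> N"
    using p(4)[OF polyfun_H[OF lt(3)] \<open>H k x \<noteq> 0\<close>] by blast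
  then have "\<forall>e. D e \<longrightarrow> e \<le> N" unfolding D_def using lt(3) by blast
  ultimately obtain e where e: "D e" "\<And>e'. D e' \<Longrightarrow> e' \<le> e"
    using ex_has_greatest_nat[of D 0 id "Suc N"] by (auto simp: less_Suc_eq_le)
  from e(1) obtain R where R: "\<And>m. m < 4 \<Longrightarrow> polyfun4 (R m)" "\<And>m x. m < 4 \<Longrightarrow> H m x = p x ^ e * R m x"
    unfolding D_def by metis
  have pe: "polyfun4 (\<lambda>x. p x ^ e)" using p(1) by (rule polyfun_power)
  have const: "R m y = R m (\<lambda>j. 0)" if m: "m < 4" and x1: "R m (\<lambda>j. H j x1) \<noteq> 0" for m x1 y
  proof -
    have pRH: "polyfun4 (\<lambda>x. R m (\<lambda>j. H j x))" by (rule polyfun_comp[OF R(1)[OF m]]) (simp add: polyfun_H)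
    have "\<exists>x2. H m x2 \<noteq> 0"
    proof (rule ccontr)
      assume "\<nexists>x2. H m x2 \<noteq> 0"
      then have "p z ^ e * R m z = 0" for z using R(2)[OF m] by metis
      then have "R m (\<lambda>j. H j x1) = 0"
        by (intro polyfun_mult_eq_0[OF pe R(1)[OF m], of p_nz]) (use p_nz in auto)
      then show False using x1 by simp
    qed
    then obtain x2 where x2: "H m x2 \<noteq> 0" by blast
    have "\<exists>x3. R m (\<lambda>j. H j x3) * H m x3 \<noteq> 0"
      using polyfun_mult_eq_0[OF pRH polyfun_H[OF m], where ?x0.0 = x1 and y = x2] x1 x2 by blast
    then obtain x3 where x3: "R m (\<lambda>j. H j x3) * H m x3 \<noteq> 0" ..
    have "R m y - R m (\<lambda>j. 0) = 0"
    proof (rule polyfun_zero_generic[where g = "\<lambda>y. R m y - R m (\<lambda>j. 0)", OF polyfun_mult[OF pRH polyfun_H[OF m]] _ x3])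
      fix x assume "R m (\<lambda>j. H j x) * H m x \<noteq> 0"
      then have nz: "R m (\<lambda>j. H j x) \<noteq> 0" "H m x \<noteq> 0" by auto
      have prod: "p (\<lambda>j. s * x j + t * H j x) ^ e * R m (\<lambda>j. s * x j + t * H j x) = s ^ d * H m x" for s t
        using H_span[OF m, of s x t] R(2)[OF m] by simp
      \<comment> \<open>For \<open>s \<noteq> 0\<close> the product is a nonzero constant as a polynomial in \<open>t\<close>.\<close>
      have tconst: "R m (\<lambda>j. s * x j + H j x) = R m (\<lambda>j. s * x j)" if "s \<noteq> 0" for s
      proof -
        obtain P where P: "\<And>t. p (\<lambda>j. s * x j + t * H j x) ^ e = poly P t"
          using polyfun_line[OF pe, of "\<lambda>j. s * x j" "\<lambda>j. H j x"] by auto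
        obtain Q where Q: "\<And>t. R m (\<lambda>j. s * x j + t * H j x) = poly Q t"
          using polyfun_line[OF R(1)[OF m], of "\<lambda>j. s * x j" "\<lambda>j. H j x"] by auto
        have "poly Q 1 = poly Q 0"
          by (rule poly_factor_of_power_constant[of P Q "s ^ d * H m x" 0])
             (use prod[of s] that nz in \<open>auto simp: P Q\<close>)
        then show ?thesis using Q[of 0] Q[of 1] by simp
      qed
      from polyfun_scaling[OF pe, of x "\<lambda>j. H j x"]
      obtain P where P: "\<forall>s. p (\<lambda>j. s * x j + H j x) ^ e = poly P s" ..
      from polyfun_scaling[OF R(1)[OF m], of x "\<lambda>j. H j x"]
      obtain Q where Q: "\<forall>s. R m (\<lambda>j. s * x j + H j x) = poly Q s" ..
      \<comment> \<open>For \<open>t = 1\<close> the product is a multiple of \<open>s ^ d\<close>, and the second factor does not vanish at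
        \<open>s = 0\<close>.\<close>
      have Qc: "poly Q s = poly Q 0" for s
        by (rule poly_factor_of_power_constant[of P Q "H m x" d])
           (use prod[of _ 1] nz Q[rule_format, of 0] in \<open>auto simp: P Q mult.commute\<close>)
      from polyfun_scaling[OF R(1)[OF m], of x "\<lambda>j. 0"]
      obtain Q' where Q': "\<forall>s. R m (\<lambda>j. s * x j + 0) = poly Q' s" ..
      have "poly Q' s = poly [:poly Q 0:] s" if "s \<noteq> 0" for s
        using tconst[OF that] Q Q' Qc[of s] by simp
      from this[of 1] poly_eq_at_0[OF this] have "poly Q' 1 = poly Q' 0" by simp
      then show "R m x - R m (\<lambda>j. 0) = 0" using Q'[rule_format, of 0] Q'[rule_format, of 1] by simp
    qed (intro polyfun_intros R(1)[OF m])
    then show ?thesis by simp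
  qed
  show False
  proof (cases "\<forall>m<4. \<forall>x. R m (\<lambda>j. H j x) = 0")
    case True
    have "D (Suc e)" unfolding D_def
    proof (intro allI impI)
      fix m :: nat assume m: "m < 4"
      then obtain r where "polyfun4 r" "\<And>x. R m x = p x * r x" using p(3)[OF R(1)[OF m]] True by blast
      then show "\<exists>r. polyfun4 r \<and> (\<forall>x. H m x = p x ^ Suc e * r x)"
        using R(2)[OF m] by (intro exI[of _ r]) simp
    qed
    then show False using e(2)[of "Suc e"] by simp
  next
    case False
    then obtain m x1 where m: "m < 4" and x1: "R m (\<lambda>j. H j x1) \<noteq> 0" by blast
    define c where "c = R m (\<lambda>j. 0)"
    have Rm: "R m y = c" for y using const[OF m x1] by (simp add: c_def)
    then have c0: "c \<noteq> 0" using x1 by metis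
    have p_hom: "p (\<lambda>j. s * y j) ^ e = s ^ d * p y ^ e" for s y
      using H_homogeneous[OF m, of s y] c0 by (simp add: R(2)[OF m] Rm)
    have "R n y - R n (\<lambda>j. 0) = 0" if n: "n < 4" for n y
    proof (rule polyfun_zero_generic[where g = "\<lambda>y. R n y - R n (\<lambda>j. 0)", OF p(1) _ p_nz])
      fix y assume y: "p y \<noteq> 0"
      from polyfun_scaling[OF R(1)[OF n], of y "\<lambda>j. 0"]
      obtain Q' where Q': "\<forall>s. R n (\<lambda>j. s * y j + 0) = poly Q' s" ..
      have "poly Q' s = poly [:R n y:] s" if s: "s \<noteq> 0" for s
        using H_homogeneous[OF n, of s y] Q'[rule_format, of s] y s
        by (simp add: R(2)[OF n] p_hom)
      from poly_eq_at_0[OF this] show "R n y - R n (\<lambda>j. 0) = 0"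
        using Q'[rule_format, of 0] by simp
    qed (intro polyfun_intros R(1)[OF n])
    then have Rn: "R n y = R n (\<lambda>j. 0)" if "n < 4" for n y using that by (metis right_minus_eq)
    have "H n y = R n (\<lambda>j. 0) * p y ^ e" if "n < 4" for n y
      unfolding R(2)[OF that] by (subst Rn[OF that]) (rule mult.commute)
    then have proportional unfolding proportional_def
      by (intro exI[of _ "\<lambda>n. R n (\<lambda>j. 0)"] exI[of _ "\<lambda>x. p x ^ e"] conjI allI impI pe)
    then show False using np by simp
  qed
qed

end

section \<open>Level sets of the ratios\<close>

lemma dd_lin: "dd (\<lambda>j. u j + c * v j) f x = dd u f x + c * dd v f x"
  unfolding dd_def sum_distrib_left sum.distrib[symmetric]
  by (rule sum.cong) (auto simp: algebra_simps)

text \<open>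
  From here on \<open>u = H i / H k\<close> is a fixed nonconstant ratio; its derivative with respect to the
  variable \<open>a\<close> does not vanish identically.
\<close>

locale varying_ratio = homogeneous_quasi_translation +
  fixes i k a x0
  assumes np: "\<not> proportional" and lt: "i < 4" "k < 4" "a < 4" and om0: "om i k a x0 \<noteq> 0"
begin

text \<open>
  As all gradients of ratios are parallel, every \<open>H l / H k\<close> is, locally, a function \<open>\<psi> l\<close> of
  \<open>u\<close>. In terms of these, \<open>\<omega>\<close> is a multiple of the gradient of \<open>u\<close>, \<open>K\<close> is a multiple of the
  vector \<open>\<psi>' (u)\<close>, and \<open>w\<close> is its normalization, so that \<open>K l / w\<close> is the derivative of \<open>\<psi> l\<close> at
  \<open>u\<close>. The curve \<open>\<psi>\<close> parametrizes the lines through the origin on the cone spanned by the image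
  of \<open>H\<close>, and \<open>H x\<close> and \<open>K x\<close> span its tangent plane.
\<close>

definition w where "w = om i k a"
definition K where "K l = om l k a"
definition \<omega> where "\<omega> b = om i k b"

lemma polyfun_w: "polyfun4 w" unfolding w_def by (rule polyfun_om[OF lt(1,2)])
lemma polyfun_K: "l < 4 \<Longrightarrow> polyfun4 (K l)" unfolding K_def by (rule polyfun_om[OF _ lt(2)])
lemma polyfun_\<omega>: "polyfun4 (\<omega> b)" unfolding \<omega>_def by (rule polyfun_om[OF lt(1,2)])
lemmas polyfun_Hk = polyfun_H[OF lt(2)]

lemma K_i: "K i = w" and K_k: "K k x = 0" and \<omega>_a: "\<omega> a = w"
  by (simp_all add: K_def w_def \<omega>_def om_def)

lemma ik: "i \<noteq> k" using om0 by (auto simp: om_def)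

lemma om_w: "l < 4 \<Longrightarrow> om l k b x * w x = K l x * \<omega> b x"
  using om_parallel[OF np _ lt(1,2), of l b x a] by (simp add: w_def K_def \<omega>_def)

lemma w_nz: "w x0 \<noteq> 0" using om0 by (simp add: w_def)

lemma Hk_nz: "\<exists>x. H k x \<noteq> 0"
proof (rule ccontr)
  assume "\<nexists>x. H k x \<noteq> 0"
  then have "H k = (\<lambda>x. 0)" by auto
  then show False using om0 by (simp add: om_def)
qed

lemma generic:
  assumes "polyfun4 f" "\<And>x. w x \<noteq> 0 \<Longrightarrow> H k x \<noteq> 0 \<Longrightarrow> f x = 0"
  shows "f x = 0"
proof -
  obtain x1 where "H k x1 \<noteq> 0" using Hk_nz by blast
  then have "\<exists>x2. w x2 * H k x2 \<noteq> 0"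
    using polyfun_mult_eq_0[OF polyfun_w polyfun_Hk, where ?x0.0 = x0 and y = x1] w_nz by blast
  then obtain x2 where x2: "w x2 * H k x2 \<noteq> 0" ..
  show ?thesis
    by (rule polyfun_zero_generic[OF polyfun_mult[OF polyfun_w polyfun_Hk] assms(1) x2])
       (use assms(2) in auto)
qed

lemma w_dd_H:
  assumes l: "l < 4"
  shows "H k x * w x * dd v (H l) x = H l x * w x * dd v (H k) x + K l x * (\<Sum>b<4. \<omega> b x * v b)"
proof -
  have "(H k x * dd v (H l) x - H l x * dd v (H k) x) * w x = (\<Sum>b<4. om l k b x * v b) * w x"
    by (simp add: om_dd)
  also have "\<dots> = (\<Sum>b<4. (om l k b x * w x) * v b)"
    unfolding sum_distrib_right by (rule sum.cong) (auto simp: mult_ac)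
  also have "\<dots> = K l x * (\<Sum>b<4. \<omega> b x * v b)"
    unfolding om_w[OF l] sum_distrib_left by (simp add: mult.assoc)
  finally show ?thesis by (simp add: algebra_simps)
qed

text \<open>
  The level sets of \<open>u\<close> are tangent to \<open>\<psi>' (u)\<close>. Modulo \<open>H x\<close>, the Jacobian of \<open>H\<close> multiplies
  \<open>K x\<close> by the number \<open>lam\<close>, which is the derivative of \<open>u\<close> in direction \<open>K x\<close> up to a nonzero
  factor. As the Jacobian kills \<open>H x\<close>, adding a suitable multiple of \<open>H x\<close> to \<open>K x\<close> gives an
  eigenvector with this eigenvalue, so \<open>lam = 0\<close>.
\<close>

lemma \<omega>_K: "(\<Sum>b<4. \<omega> b x * K b x) = 0"
proof (rule generic[where f = "\<lambda>x. \<Sum>b<4. \<omega> b x * K b x"])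
  show "polyfun4 (\<lambda>x. \<Sum>b<4. \<omega> b x * K b x)" by (intro polyfun_intros polyfun_\<omega> polyfun_K) simp
  fix x assume w: "w x \<noteq> 0" and Hk: "H k x \<noteq> 0"
  let ?\<Lambda> = "\<Sum>b<4. \<omega> b x * K b x"
  show "?\<Lambda> = 0"
  proof (rule ccontr)
    assume \<Lambda>: "?\<Lambda> \<noteq> 0"
    define lam where "lam = ?\<Lambda> / (w x * H k x)"
    define \<eta> where "\<eta> = dd (\<lambda>j. K j x) (H k) x / H k x"
    define v where "v j = K j x + (\<eta> / lam) * H j x" for j
    have lam0: "lam \<noteq> 0" using \<Lambda> w Hk by (simp add: lam_def)
    have ev: "dd v (H l) x = lam * v l" if l: "l < 4" for l
    proof -
      have "dd v (H l) x = dd (\<lambda>j. K j x) (H l) x"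
        unfolding v_def[abs_def] dd_lin by (simp add: dd_H_H[OF l])
      also have "\<dots> = H l x * \<eta> + K l x * lam"
        using w_dd_H[OF l, of x "\<lambda>j. K j x"] w Hk by (simp add: \<eta>_def lam_def field_simps)
      also have "\<dots> = lam * v l" using lam0 by (simp add: v_def distrib_left)
      finally show ?thesis .
    qed
    have v0: "v l = 0" if "l < 4" for l using Jacobian_no_eigenvalue[OF ev lam0 that] by simp
    have "\<eta> / lam = 0" using v0[OF lt(2)] Hk by (simp add: v_def K_k)
    then have "w x = 0" using v0[OF lt(1)] unfolding v_def by (simp only: K_i) simp
    then show False using w by simp
  qed
qed

text \<open>
  This expresses that gradients are curl-free, for the gradient of \<open>H l / H k\<close> multiplied by
  \<open>(H k)\<^sup>2\<close>.
\<close>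

lemma om_closed:
  assumes l: "l < 4"
  shows "H k x * (pd c (om l k b) x - pd b (om l k c) x)
       = 2 * (pd c (H k) x * om l k b x - pd b (H k) x * om l k c x)"
proof -
  have d: "pd c (om l k b) x = pd c (H k) x * pd b (H l) x + H k x * pd c (pd b (H l)) x
       - (pd c (H l) x * pd b (H k) x + H l x * pd c (pd b (H k)) x)" for b c
    unfolding om_def[abs_def]
    by (simp add: pd_diff[OF polyfun_mult polyfun_mult, OF polyfun_Hk polyfun_pd polyfun_H[OF l] polyfun_pd,
          OF polyfun_H[OF l] polyfun_Hk]
        pd_mult[OF polyfun_Hk polyfun_pd[OF polyfun_H[OF l]]] pd_mult[OF polyfun_H[OF l] polyfun_pd[OF polyfun_Hk]])
  show ?thesis
    unfolding d pd_commute[OF polyfun_H[OF l], of b c] pd_commute[OF polyfun_Hk, of b c] om_def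
    by (simp add: algebra_simps)
qed

text \<open>
  The slopes \<open>K l / w\<close> are functions of \<open>u\<close> too. The gradient of \<open>H l / H k\<close> is \<open>K l / w\<close> times
  the gradient of \<open>u\<close>, and both gradients are curl-free; hence the exterior product of the
  gradients of \<open>K l / w\<close> and \<open>u\<close> vanishes.
\<close>

lemma slope_gradient_parallel:
  assumes l: "l < 4"
  shows "(w x * pd c (K l) x - K l x * pd c w x) * \<omega> b x
       = (w x * pd b (K l) x - K l x * pd b w x) * \<omega> c x"
proof -
  let ?f = "\<lambda>x. (w x * pd c (K l) x - K l x * pd c w x) * \<omega> b x
       - (w x * pd b (K l) x - K l x * pd b w x) * \<omega> c x"
  have "?f x = 0"
  proof (rule generic[where f = "?f"])
    show "polyfun4 ?f"
      by (intro polyfun_intros polyfun_w polyfun_K l polyfun_\<omega> polyfun_pd)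
    fix x assume w: "w x \<noteq> 0" and Hk: "H k x \<noteq> 0"
    have A: "polyfun4 (om l k b)" for b by (rule polyfun_om[OF l lt(2)])
    have E: "pd c (om l k b) x * w x + om l k b x * pd c w x
        = pd c (K l) x * \<omega> b x + K l x * pd c (\<omega> b) x" for b c
    proof -
      have "pd c (\<lambda>x. om l k b x * w x) x = pd c (\<lambda>x. K l x * \<omega> b x) x"
        by (simp add: om_w[OF l])
      then show ?thesis
        by (simp add: pd_mult[OF A polyfun_w] pd_mult[OF polyfun_K[OF l] polyfun_\<omega>])
    qed
    have clA: "H k x * (pd c (om l k b) x - pd b (om l k c) x)
       = 2 * (pd c (H k) x * om l k b x - pd b (H k) x * om l k c x)" by (rule om_closed[OF l])
    have cl\<omega>: "H k x * (pd c (\<omega> b) x - pd b (\<omega> c) x)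
       = 2 * (pd c (H k) x * \<omega> b x - pd b (H k) x * \<omega> c x)"
      unfolding \<omega>_def by (rule om_closed[OF lt(1)])
    have "H k x * ?f x
      = w x * w x * (H k x * (pd c (om l k b) x - pd b (om l k c) x))
        - w x * K l x * (H k x * (pd c (\<omega> b) x - pd b (\<omega> c) x))
        + H k x * pd c w x * (om l k b x * w x - K l x * \<omega> b x)
        - H k x * pd b w x * (om l k c x * w x - K l x * \<omega> c x)
        - H k x * w x * ((pd c (om l k b) x * w x + om l k b x * pd c w x
              - (pd c (K l) x * \<omega> b x + K l x * pd c (\<omega> b) x))
           - (pd b (om l k c) x * w x + om l k c x * pd b w x
              - (pd b (K l) x * \<omega> c x + K l x * pd b (\<omega> c) x)))"
      by (simp add: algebra_simps)
    also have "\<dots> = 2 * w x * (pd c (H k) x * (om l k b x * w x - K l x * \<omega> b x)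
        - pd b (H k) x * (om l k c x * w x - K l x * \<omega> c x))
        + H k x * pd c w x * (om l k b x * w x - K l x * \<omega> b x)
        - H k x * pd b w x * (om l k c x * w x - K l x * \<omega> c x)"
      unfolding E clA cl\<omega> by (simp add: algebra_simps)
    also have "\<dots> = 0" by (simp add: om_w[OF l])
    finally show "?f x = 0" using Hk by simp
  qed
  then show ?thesis by simp
qed

lemma slope_dd:
  assumes l: "l < 4"
  shows "w x * (w x * dd v (K l) x - K l x * dd v w x)
     = (w x * pd a (K l) x - K l x * pd a w x) * (\<Sum>b<4. \<omega> b x * v b)"
proof -
  have "w x * (w x * dd v (K l) x - K l x * dd v w x)
     = (\<Sum>c<4. (w x * pd c (K l) x - K l x * pd c w x) * \<omega> a x * v c)"
    unfolding dd_def \<omega>_a sum_distrib_left sum_subtractf[symmetric]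
    by (rule sum.cong) (auto simp: algebra_simps)
  also have "\<dots> = (\<Sum>c<4. (w x * pd a (K l) x - K l x * pd a w x) * \<omega> c x * v c)"
    by (subst slope_gradient_parallel[OF l, of x _ a]) rule
  also have "\<dots> = (w x * pd a (K l) x - K l x * pd a w x) * (\<Sum>b<4. \<omega> b x * v b)"
    unfolding sum_distrib_left by (simp add: mult.assoc)
  finally show ?thesis .
qed

text \<open>
  The function \<open>u\<close> is constant on the line through \<open>x\<close> in direction \<open>v = K x\<close>. As long as \<open>u\<close> is
  constant, so is the direction of \<open>K\<close>, which is tangent to the level set; so this is a matter
  of uniqueness for a differential equation. Algebraically, let the derivative \<open>M\<close> of \<open>u\<close> along
  the line vanish to order \<open>e\<close>. Then the slopes deviate from their initial values, as measured
  by \<open>q\<close>, only to order \<open>e + 1\<close>, because their derivatives are multiples of \<open>M\<close>. As \<open>\<omega>\<close>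
  annihilates \<open>K\<close>, the function \<open>M\<close> is determined by this deviation and vanishes to order
  \<open>e + 1\<close>.
\<close>

lemma \<omega>_along_slope:
  assumes w: "w x \<noteq> 0"
  shows "(\<Sum>b<4. \<omega> b (\<lambda>j. x j + t * K j x) * K b x) = 0"
proof -
  define v where "v j = K j x" for j
  define L where "L f = line_poly f x v" for f
  have L: "poly (L f) t = f (\<lambda>j. x j + t * v j)" if "polyfun4 f" for f t
    unfolding L_def by (rule poly_line_poly[OF that])
  have L': "poly (pderiv (L f)) t = dd v f (\<lambda>j. x j + t * v j)" if "polyfun4 f" for f t
    unfolding L_def by (rule poly_pderiv_line_poly[OF that])
  define M where "M = (\<Sum>b<4. smult (v b) (L (\<omega> b)))"
  have M: "poly M t = (\<Sum>b<4. \<omega> b (\<lambda>j. x j + t * v j) * v b)" for t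
    by (simp add: M_def poly_sum L polyfun_\<omega> mult.commute)
  define q where "q l = smult (w x) (L (K l)) - smult (v l) (L w)" for l
  have "M = 0"
  proof (rule ccontr)
    assume M0: "M \<noteq> 0"
    define e where "e = order 0 M"
    have W0: "poly (L w) 0 \<noteq> 0" using w by (simp add: L polyfun_w)
    have dvdM: "[:0,1:] ^ e dvd M" using order_1[of 0 M] by (simp add: e_def)
    have qd: "[:0,1:] ^ Suc e dvd q l" if l: "l < 4" for l
    proof (rule wronskian_order[OF W0])
      show "poly (q l) 0 = 0" by (simp add: q_def L polyfun_w polyfun_K[OF l]) (simp add: v_def)
      define \<kappa> where "\<kappa> x = w x * pd a (K l) x - K l x * pd a w x" for x
      have pf\<kappa>: "polyfun4 \<kappa>" unfolding \<kappa>_def[abs_def]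
        by (intro polyfun_intros polyfun_w polyfun_K l polyfun_pd)
      have "poly (L w * (L w * pderiv (L (K l)) - L (K l) * pderiv (L w))) t = poly (L \<kappa> * M) t" for t
        using slope_dd[OF l, of "\<lambda>j. x j + t * v j" v]
        by (simp add: L L' M polyfun_w polyfun_K[OF l] pf\<kappa>) (simp add: \<kappa>_def)
      then have "L w * (L w * pderiv (L (K l)) - L (K l) * pderiv (L w)) = L \<kappa> * M"
        by (rule poly_eq_poly_eq_iff[THEN iffD1, OF ext])
      then have "L w * (L w * pderiv (q l) - q l * pderiv (L w)) = smult (w x) (L \<kappa> * M)"
        by (simp add: q_def pderiv_diff pderiv_smult algebra_simps smult_diff_right smult_add_right)
      then show "[:0,1:] ^ e dvd L w * (L w * pderiv (q l) - q l * pderiv (L w))"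
        using dvdM by (simp add: dvd_smult)
    qed
    have "poly (L w * M) t = poly (- (\<Sum>l<4. L (\<omega> l) * q l)) t" for t
    proof -
      let ?z = "\<lambda>j. x j + t * v j"
      have "poly (- (\<Sum>l<4. L (\<omega> l) * q l)) t
          = - (\<Sum>l<4. \<omega> l ?z * (w x * K l ?z - v l * w ?z))"
        by (simp add: q_def poly_sum L polyfun_\<omega> polyfun_w polyfun_K)
      also have "\<dots> = w ?z * (\<Sum>l<4. \<omega> l ?z * v l) - w x * (\<Sum>l<4. \<omega> l ?z * K l ?z)"
        by (simp add: sum_distrib_left sum_subtractf right_diff_distrib mult_ac)
      also have "\<dots> = poly (L w * M) t" by (simp add: \<omega>_K M L polyfun_w)
      finally show ?thesis ..
    qed
    then have eq: "L w * M = - (\<Sum>l<4. L (\<omega> l) * q l)"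
      by (rule poly_eq_poly_eq_iff[THEN iffD1, OF ext])
    have "[:0,1:] ^ Suc e dvd L w * M" unfolding eq dvd_minus_iff
      by (intro dvd_sum dvd_mult qd) auto
    moreover have LM: "L w * M \<noteq> 0" using W0 M0 by auto
    ultimately have "Suc e \<le> order 0 (L w * M)" using order_divides[of 0 "Suc e" "L w * M"] by simp
    also have "\<dots> = e" using order_mult[OF LM] W0 by (simp add: order_0I e_def)
    finally show False by simp
  qed
  then show ?thesis using M[of t] by (simp add: v_def)
qed

lemma H_along_slope:
  assumes w: "w x \<noteq> 0" and l: "l < 4"
  shows "H l (\<lambda>j. x j + t * K j x) * H k x = H k (\<lambda>j. x j + t * K j x) * H l x"
proof (rule ratio_constant_if_om_zero[OF l lt(2)])
  fix s
  define L where "L f = line_poly f x (\<lambda>j. K j x)" for f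
  have L: "poly (L f) t = f (\<lambda>j. x j + t * K j x)" if "polyfun4 f" for f t
    unfolding L_def by (rule poly_line_poly[OF that])
  define M where "M = (\<Sum>b<4. smult (K b x) (L (om l k b)))"
  have pfo: "polyfun4 (om l k b)" for b by (rule polyfun_om[OF l lt(2)])
  have M: "poly M t = (\<Sum>b<4. om l k b (\<lambda>j. x j + t * K j x) * K b x)" for t
    by (simp add: M_def poly_sum L pfo mult.commute)
  have "poly (L w * M) t = 0" for t
  proof -
    let ?z = "\<lambda>j. x j + t * K j x"
    have "poly (L w * M) t = (\<Sum>b<4. (om l k b ?z * w ?z) * K b x)"
      by (simp add: L polyfun_w M sum_distrib_left mult_ac)
    also have "\<dots> = K l ?z * (\<Sum>b<4. \<omega> b ?z * K b x)"
      unfolding om_w[OF l] sum_distrib_left by (simp add: mult.assoc)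
    finally show ?thesis by (simp add: \<omega>_along_slope[OF w])
  qed
  then have "L w * M = 0" using poly_all_0_iff_0 by blast
  moreover have "poly (L w) 0 \<noteq> 0" using w by (simp add: L polyfun_w)
  then have "L w \<noteq> 0" by auto
  ultimately have "M = 0" by simp
  then show "(\<Sum>b<4. om l k b (\<lambda>j. x j + s * K j x) * K b x) = 0" using M[of s] by simp
qed

text \<open>
  The ratio is constant on the span of \<open>x\<close>, \<open>H x\<close> and \<open>K x\<close>. First move along \<open>K x\<close> to a point
  \<open>z'\<close> with \<open>H z'\<close> parallel to \<open>H x\<close>, then in the plane of \<open>z'\<close> and \<open>H z'\<close>. This reaches generic
  points of the span.
\<close>

lemma H_on_cone:
  assumes w: "w x \<noteq> 0" and Hk: "H k x \<noteq> 0"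
  shows "H i (\<lambda>j. r * x j + s * H j x + t * K j x) * H k x
       = H k (\<lambda>j. r * x j + s * H j x + t * K j x) * H i x"
proof -
  define y where "y u j = u 0 * x j + u 1 * H j x + u 2 * K j x" for u :: point and j
  define z where "z u j = u 0 * x j + u 2 * K j x" for u :: point and j
  define G where "G u = H i (y u) * H k x - H k (y u) * H i x" for u
  define F where "F u = u 0 * H k (z u)" for u
  have pfH: "polyfun4 (\<lambda>u. H m (y u))" "polyfun4 (\<lambda>u. H m (z u))" if "m < 4" for m
    unfolding y_def[abs_def] z_def[abs_def]
    by (rule polyfun_comp[OF polyfun_H[OF that]], intro polyfun_intros, simp_all)+
  have pfF: "polyfun4 F" unfolding F_def[abs_def] by (intro polyfun_intros pfH lt) simp
  have pfG: "polyfun4 G" unfolding G_def[abs_def] by (intro polyfun_intros pfH lt)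
  have F0: "F (\<lambda>n. if n = 0 then 1 else 0) \<noteq> 0" using Hk by (simp add: F_def z_def[abs_def])
  have "G u = 0" for u
  proof (rule polyfun_zero_generic[OF pfF pfG F0])
    fix u assume "F u \<noteq> 0"
    then have u0: "u 0 \<noteq> 0" and Hz: "H k (z u) \<noteq> 0" by (auto simp: F_def)
    define z' where "z' j = x j + (u 2 / u 0) * K j x" for j
    have zz': "z u = (\<lambda>j. u 0 * z' j)" using u0 by (auto simp: z_def z'_def distrib_left)
    have Hz': "H k z' \<noteq> 0" using Hz unfolding zz' H_homogeneous[OF lt(2)] by auto
    have par: "H m z' * H k x = H k z' * H m x" if "m < 4" for m
      unfolding z'_def by (rule H_along_slope[OF w that])
    have yeq: "H m (y u) = u 0 ^ d * H m z'" if m: "m < 4" for m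
    proof -
      have "H m (y u) = H m (\<lambda>j. u 0 * z' j + (u 1 * H k x / H k z') * H j z')"
      proof (rule polyfun_cong_point[OF polyfun_H[OF m]])
        fix j :: nat assume "j \<in> {..<4}"
        then have "H j x = H j z' * H k x / H k z'" using par[of j] Hz' by (simp add: field_simps)
        moreover have "u 0 * z' j = u 0 * x j + u 2 * K j x" using u0 by (simp add: z'_def distrib_left)
        ultimately show "y u j = u 0 * z' j + (u 1 * H k x / H k z') * H j z'"
          by (simp add: y_def mult_ac)
      qed
      then show ?thesis unfolding H_span[OF m] .
    qed
    show "G u = 0" using par[OF lt(1)] by (simp add: G_def yeq lt mult.assoc)
  qed
  from this[of "\<lambda>n. if n = 0 then r else if n = 1 then s else t"] show ?thesis
    by (simp add: G_def y_def[abs_def])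
qed

text \<open>
  Up to sign this is the determinant of the vectors \<open>v\<close>, \<open>H x\<close> and \<open>K x\<close>, restricted to the
  coordinates \<open>i\<close>, \<open>k\<close> and \<open>l\<close>; recall that \<open>K i = w\<close> and \<open>K k = 0\<close>.
\<close>

definition Th where
  "Th l v x = v l * w x * H k x - v k * w x * H l x - (v i * H k x - v k * H i x) * K l x"

lemma polyfun_Th: "l < 4 \<Longrightarrow> polyfun4 (\<lambda>x. Th l x x)"
  unfolding Th_def by (intro polyfun_intros polyfun_w polyfun_H polyfun_K lt) (simp_all add: lt)

text \<open>
  The plane spanned by \<open>H x\<close> and \<open>K x\<close> depends on \<open>u x\<close> only. If it always contained \<open>x\<close>, then
  moving \<open>x\<close> within a level set of \<open>u\<close> would show that it contains all tangent vectors of the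
  level set.
\<close>

lemma Th_tangent:
  assumes l: "l < 4" and Th0: "\<And>x. Th l x x = 0"
    and w: "w x \<noteq> 0" and Hk: "H k x \<noteq> 0" and v: "(\<Sum>b<4. \<omega> b x * v b) = 0"
  shows "Th l v x = 0"
proof -
  define \<eta> where "\<eta> = dd v (H k) x / H k x"
  define \<xi> where "\<xi> = dd v w x / w x"
  have dH: "dd v (H m) x = H m x * \<eta>" if "m < 4" for m
    using w_dd_H[OF that, of x v] w Hk v by (simp add: \<eta>_def field_simps)
  have dw: "dd v w x = w x * \<xi>" using w by (simp add: \<xi>_def)
  have "w x * dd v (K l) x = K l x * dd v w x" using slope_dd[OF l, of x v] v w by simp
  then have dK: "dd v (K l) x = K l x * \<xi>" using w by (simp add: \<xi>_def field_simps)
  have pv: "polyfun4 (\<lambda>x. x m)" if "m < 4" for m using that by (intro polyfun_var) simp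
  note pf = polyfun_w polyfun_H[OF lt(1)] polyfun_H[OF lt(2)] polyfun_H[OF l] polyfun_K[OF l]
    pv[OF lt(1)] pv[OF lt(2)] pv[OF l]
  have "0 = dd v (\<lambda>x. Th l x x) x" using Th0 by simp
  also have "\<dots> = dd v (\<lambda>x. x l * w x * H k x) x - dd v (\<lambda>x. x k * w x * H l x) x
      - dd v (\<lambda>x. (x i * H k x - x k * H i x) * K l x) x"
    unfolding Th_def
    by (subst dd_diff[of "{..<4}"], intro polyfun_intros pf, intro polyfun_intros pf,
        subst dd_diff[of "{..<4}"], (intro polyfun_intros pf)+, rule refl)
  also have "dd v (\<lambda>x. x l * w x * H k x) x
      = v l * w x * H k x + (\<xi> + \<eta>) * (x l * w x * H k x)"
    unfolding dd_mult[OF polyfun_mult[OF pf(8,1)] pf(3)] dd_mult[OF pf(8,1)]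
    by (simp add: dH lt dw l algebra_simps)
  also have "dd v (\<lambda>x. x k * w x * H l x) x
      = v k * w x * H l x + (\<xi> + \<eta>) * (x k * w x * H l x)"
    unfolding dd_mult[OF polyfun_mult[OF pf(7,1)] pf(4)] dd_mult[OF pf(7,1)]
    by (simp add: dH lt dw l algebra_simps)
  also have "dd v (\<lambda>x. (x i * H k x - x k * H i x) * K l x) x
      = (v i * H k x - v k * H i x) * K l x + (\<xi> + \<eta>) * ((x i * H k x - x k * H i x) * K l x)"
    unfolding dd_mult[OF polyfun_diff[OF polyfun_mult polyfun_mult, OF pf(6,3,7,2)] pf(5)]
        dd_diff[OF polyfun_mult polyfun_mult, OF pf(6,3,7,2)] dd_mult[OF pf(6,3)] dd_mult[OF pf(7,2)]
    by (simp add: dH dK lt l algebra_simps)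
  finally have "0 = Th l v x + (\<xi> + \<eta>) * Th l x x" by (simp add: Th_def algebra_simps)
  then show ?thesis using Th0 by simp
qed

lemma w_Hk_nz: obtains x where "w x \<noteq> 0" "H k x \<noteq> 0"
  using generic[OF polyfun_w, of x0] w_nz by blast

lemma four_indices:
  obtains l l' where "distinct [i, k, l, l']" "{i, k, l, l'} = {..<4}"
proof -
  have "card ({..<4} - {i, k}) = 2" using lt ik by (simp add: card_Diff_subset)
  then obtain l l' where "{..<4} - {i, k} = {l, l'}" "l \<noteq> l'" by (auto simp: card_2_iff)
  then have "distinct [i, k, l, l']" "{i, k, l, l'} = {..<4}" using lt ik by auto
  then show ?thesis using that by blast
qed

lemma sum_four:
  assumes "distinct [i, k, l, l']" "{i, k, l, l'} = {..<4::nat}"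
  shows "(\<Sum>b<4. f b) = f i + f k + f l + (f l' :: complex)"
proof -
  have "(\<Sum>b<4. f b) = sum f {i, k, l, l'}" using assms(2) by simp
  then show ?thesis using assms(1) by (simp add: add.assoc)
qed

text \<open>
  The tangent space of a level set has dimension 3, so it is not contained in a plane. The
  vectors \<open>v\<close> and \<open>u\<close> in the proof are tangent vectors for which one of the two determinants is
  visibly nonzero.
\<close>

lemma Th_nz: obtains l l' x where "distinct [i, k, l, l']" "{i, k, l, l'} = {..<4}" "Th l x x \<noteq> 0"
proof -
  obtain l l' where ll: "distinct [i, k, l, l']" "{i, k, l, l'} = {..<4}" by (rule four_indices)
  have lt': "l < 4" "l' < 4" using ll(2) by auto
  obtain x where w: "w x \<noteq> 0" and Hk: "H k x \<noteq> 0" by (rule w_Hk_nz)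
  have "(\<exists>x. Th l x x \<noteq> 0) \<or> (\<exists>x. Th l' x x \<noteq> 0)"
  proof (rule ccontr)
    assume "\<not> ?thesis"
    then have 0: "Th l x x = 0" "Th l' x x = 0" for x by auto
    note T = Th_tangent[OF lt'(1) 0(1) w Hk] Th_tangent[OF lt'(2) 0(2) w Hk]
    define v where "v b = (if b = l then \<omega> l' x else if b = l' then - \<omega> l x else 0)" for b
    have "(\<Sum>b<4. \<omega> b x * v b) = 0" using ll(1) by (simp add: sum_four[OF ll] v_def)
    then have "Th l v x = 0" "Th l' v x = 0" using T by auto
    then have oz: "\<omega> l x = 0" "\<omega> l' x = 0" using ll(1) w Hk by (auto simp: Th_def v_def)
    define u where "u b = (if b = l then 1 else 0 :: complex)" for b
    have "(\<Sum>b<4. \<omega> b x * u b) = 0" using ll(1) oz by (simp add: sum_four[OF ll] u_def)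
    then have "Th l u x = 0" using T(1) by auto
    then show False using ll(1) w Hk by (auto simp: Th_def u_def)
  qed
  moreover have "distinct [i, k, l', l]" "{i, k, l', l} = {..<4}" using ll by auto
  ultimately show ?thesis using that ll by blast
qed

text \<open>
  A dimension count: \<open>x\<close>, \<open>H x\<close> and \<open>K x\<close> are linearly independent and lie in the hyperplane
  that is annihilated by \<open>\<omega>\<close> at \<open>x\<close>. The coordinates \<open>r\<close>, \<open>s\<close>, \<open>t\<close> are chosen such that the
  difference \<open>y\<close> vanishes in the coordinates \<open>l\<close>, \<open>k\<close> and \<open>i\<close>, and the equation of the
  hyperplane settles the fourth one.
\<close>

lemma hyperplane_span:
  assumes ll: "distinct [i, k, l, l']" "{i, k, l, l'} = {..<4}"
    and w: "w x \<noteq> 0" and Hk: "H k x \<noteq> 0" and Th: "Th l x x \<noteq> 0"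
    and z: "(\<Sum>b<4. \<omega> b x * z b) = 0"
  obtains r s t where "\<And>j. j < 4 \<Longrightarrow> z j = r * x j + s * H j x + t * K j x"
proof -
  have lt': "l < 4" "l' < 4" using ll(2) by auto
  have idx: "b = i \<or> b = k \<or> b = l \<or> b = l'" if "b < 4" for b
  proof -
    have "b \<in> {i, k, l, l'}" unfolding ll(2) using that by simp
    then show ?thesis by simp
  qed
  have px: "\<omega> i x * x i + \<omega> k x * x k + \<omega> l x * x l + \<omega> l' x * x l' = 0"
    using om_x[OF lt(1,2), of x] by (simp add: sum_four[OF ll] \<omega>_def)
  have pH: "\<omega> i x * H i x + \<omega> k x * H k x + \<omega> l x * H l x + \<omega> l' x * H l' x = 0"
    using om_H[OF lt(1,2), of x] by (simp add: sum_four[OF ll] \<omega>_def)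
  have pK: "\<omega> i x * w x + \<omega> l x * K l x + \<omega> l' x * K l' x = 0"
    using \<omega>_K[of x] by (simp add: sum_four[OF ll] K_i K_k)
  have o': "\<omega> l' x \<noteq> 0"
  proof
    assume o'0: "\<omega> l' x = 0"
    have "\<omega> l x * Th l x x
       = w x * H k x * (\<omega> i x * x i + \<omega> k x * x k + \<omega> l x * x l)
         - w x * x k * (\<omega> i x * H i x + \<omega> k x * H k x + \<omega> l x * H l x)
         - (x i * H k x - x k * H i x) * (\<omega> i x * w x + \<omega> l x * K l x)"
      by (simp add: Th_def algebra_simps)
    also have "\<dots> = 0" using px pH pK o'0 by simp
    finally have l0: "\<omega> l x = 0" using Th by simp
    then have i0: "\<omega> i x = 0" using pK o'0 w by simp
    then have "\<omega> k x = 0" using pH l0 o'0 Hk by simp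
    then have "\<omega> b x = 0" if "b < 4" for b using l0 i0 o'0 idx[OF that] by auto
    from this[OF lt(3)] show False using w by (simp add: \<omega>_a)
  qed
  define r where "r = Th l z x / Th l x x"
  define s where "s = (z k - r * x k) / H k x"
  define t where "t = (z i - r * x i - s * H i x) / w x"
  define y where "y j = z j - r * x j - s * H j x - t * K j x" for j
  have yk: "y k = 0" using Hk by (simp add: y_def s_def K_k)
  have yi: "y i = 0" using w by (simp add: y_def t_def K_i)
  have "Th l y x = Th l z x - r * Th l x x - s * Th l (\<lambda>j. H j x) x - t * Th l (\<lambda>j. K j x) x"
    by (simp add: Th_def y_def algebra_simps)
  also have "\<dots> = 0" using Th by (simp add: r_def) (simp add: Th_def K_k K_i)
  finally have yl: "y l = 0" using yk yi w Hk by (simp add: Th_def)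
  have "(\<Sum>b<4. \<omega> b x * y b) = (\<Sum>b<4. \<omega> b x * z b) - r * (\<Sum>b<4. \<omega> b x * x b)
      - s * (\<Sum>b<4. \<omega> b x * H b x) - t * (\<Sum>b<4. \<omega> b x * K b x)"
    by (simp add: y_def sum_distrib_left sum_subtractf algebra_simps sum.distrib)
  also have "\<dots> = 0" using z om_x[OF lt(1,2), of x] om_H[OF lt(1,2), of x] \<omega>_K[of x]
    by (simp add: \<omega>_def)
  finally have "\<omega> l' x * y l' = 0" using yk yi yl by (simp add: sum_four[OF ll])
  then have "y l' = 0" using o' by simp
  then have "y j = 0" if "j < 4" for j using yk yi yl idx[OF that] by auto
  then have "z j = r * x j + s * H j x + t * K j x" if "j < 4" for j
    using that by (simp add: y_def algebra_simps)
  then show ?thesis using that by blast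
qed

text \<open>
  Here \<open>g\<close> describes genericity: at points where it does not vanish, \<open>x\<close>, \<open>H x\<close> and \<open>K x\<close> span
  the hyperplane that is annihilated by \<open>\<omega>\<close> at \<open>x\<close>.
\<close>

lemma ratio_constant_on_hyperplanes:
  obtains g where "polyfun4 g" "\<exists>x. g x \<noteq> 0" "\<And>x. g x \<noteq> 0 \<Longrightarrow> H k x \<noteq> 0"
    "\<And>x. g x \<noteq> 0 \<Longrightarrow> w x \<noteq> 0"
    "\<And>x z. g x \<noteq> 0 \<Longrightarrow> (\<Sum>b<4. \<omega> b x * z b) = 0 \<Longrightarrow> H i z * H k x = H k z * H i x"
proof -
  obtain l l' x1 where ll: "distinct [i, k, l, l']" "{i, k, l, l'} = {..<4}" and Th: "Th l x1 x1 \<noteq> 0"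
    by (rule Th_nz)
  have l: "l < 4" using ll(2) by auto
  define g where "g x = w x * H k x * Th l x x" for x
  show ?thesis
  proof (rule that[of g])
    show "polyfun4 g" unfolding g_def[abs_def]
      by (intro polyfun_mult polyfun_w polyfun_Hk polyfun_Th[OF l])
    show "\<exists>x. g x \<noteq> 0"
    proof (rule ccontr)
      assume "\<nexists>x. g x \<noteq> 0"
      then have g0: "g x = 0" for x by blast
      have "Th l x1 x1 = 0"
      proof (rule generic[where f = "\<lambda>x. Th l x x", OF polyfun_Th[OF l]])
        fix x assume "w x \<noteq> 0" "H k x \<noteq> 0"
        then show "Th l x x = 0" using g0[of x] by (simp add: g_def)
      qed
      then show False using Th by simp
    qed
    fix x z assume g: "g x \<noteq> 0" and z: "(\<Sum>b<4. \<omega> b x * z b) = 0"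
    then have nz: "w x \<noteq> 0" "H k x \<noteq> 0" "Th l x x \<noteq> 0" by (auto simp: g_def)
    obtain r s t where rst: "\<And>j. j < 4 \<Longrightarrow> z j = r * x j + s * H j x + t * K j x"
      using hyperplane_span[OF ll nz z] by blast
    have "H m z = H m (\<lambda>j. r * x j + s * H j x + t * K j x)" if "m < 4" for m
      by (rule polyfun_cong_point[OF polyfun_H[OF that]]) (use rst in auto)
    then show "H i z * H k x = H k z * H i x" using H_on_cone[OF nz(1,2)] lt by simp
  qed (auto simp: g_def)
qed

end

section \<open>The pencil of hyperplanes\<close>

lemma polyfun_prod_zero:
  assumes "finite R" "\<And>s. s \<in> R \<Longrightarrow> polyfun V (F s)" "\<And>y. (\<Prod>s\<in>R. F s y) = 0"
  shows "\<exists>s\<in>R. \<forall>y. F s y = 0"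
  using assms
proof (induction R rule: finite_induct)
  case (insert s R)
  have pf: "polyfun V (\<lambda>y. \<Prod>s\<in>R. F s y)" by (intro polyfun_prod insert.prems(1)) simp
  show ?case
  proof (cases "\<forall>y. F s y = 0")
    case False
    then obtain y0 where "F s y0 \<noteq> 0" by blast
    then have "(\<Prod>s\<in>R. F s y) = 0" for y
      by (intro polyfun_mult_eq_0[OF insert.prems(1)[of s] pf]) (use insert in auto)
    then show ?thesis using insert.IH insert.prems(1) by blast
  qed auto
qed simp

abbreviation dot :: "point \<Rightarrow> point \<Rightarrow> complex" (infixl "\<star>" 75) where
  "u \<star> v \<equiv> \<Sum>b<4. u b * v b"

lemma dot_add_right: "u \<star> (\<lambda>j. y j + t * v j) = u \<star> y + t * (u \<star> v)"
  unfolding sum_distrib_left sum.distrib[symmetric] by (rule sum.cong) (auto simp: algebra_simps)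

lemma dot_unit: "p < 4 \<Longrightarrow> u \<star> (\<lambda>b. if b = p then 1 else 0) = u p"
  by (simp add: if_distrib[of "(*) _"] cong: if_cong)

lemma polyfun_dot: "(\<And>b. b < 4 \<Longrightarrow> polyfun V (f b)) \<Longrightarrow> polyfun V (\<lambda>x. (\<lambda>b. f b x) \<star> v)"
  "(\<And>b. b < 4 \<Longrightarrow> polyfun V (f b)) \<Longrightarrow> polyfun V (\<lambda>x. v \<star> (\<lambda>b. f b x))"
  by (intro polyfun_intros; simp)+

context homogeneous_quasi_translation
begin

text \<open>
  In coordinates where \<open>al\<close> and \<open>be\<close> are the first two variables, the hypothesis says that the
  first two components of \<open>H\<close> are proportional to them. Thus \<open>al \<star> H\<close> vanishes where \<open>al\<close> does,
  first where \<open>be\<close> is nonzero and then, by moving in the direction \<open>e\<close>, on the whole hyperplane.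
  If \<open>al \<star> H\<close> were nonzero at \<open>y\<close>, then the flow would carry \<open>y\<close> to a point \<open>z\<close> of this
  hyperplane while keeping the value of \<open>H\<close>.
\<close>

lemma form_of_H_zero:
  assumes N: "\<And>y. (al \<star> (\<lambda>b. H b y)) * (be \<star> y) = (be \<star> (\<lambda>b. H b y)) * (al \<star> y)"
    and e: "al \<star> e = 0" "be \<star> e \<noteq> 0"
  shows "al \<star> (\<lambda>b. H b y) = 0"
proof -
  have pf: "polyfun4 (\<lambda>y. al \<star> (\<lambda>b. H b y))" by (intro polyfun_dot(2) polyfun_H)
  have on_hyperplane: "al \<star> (\<lambda>b. H b y) = 0" if y: "al \<star> y = 0" for y
  proof -
    define P where "P = line_poly (\<lambda>y. al \<star> (\<lambda>b. H b y)) y e"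
    have P: "poly P s = al \<star> (\<lambda>b. H b (\<lambda>j. y j + s * e j))" for s
      unfolding P_def by (rule poly_line_poly[OF pf])
    have "poly (P * [:be \<star> y, be \<star> e:]) s = 0" for s
    proof -
      have "poly (P * [:be \<star> y, be \<star> e:]) s
          = (al \<star> (\<lambda>b. H b (\<lambda>j. y j + s * e j))) * (be \<star> (\<lambda>j. y j + s * e j))"
        unfolding dot_add_right by (simp add: P algebra_simps)
      also have "\<dots> = 0" unfolding N unfolding dot_add_right by (simp add: y e(1))
      finally show ?thesis .
    qed
    then have "P * [:be \<star> y, be \<star> e:] = 0" using poly_all_0_iff_0 by blast
    moreover have "[:be \<star> y, be \<star> e:] \<noteq> 0" using e(2) by simp
    ultimately have "P = 0" unfolding mult_eq_0_iff by blast
    then show ?thesis using P[of 0] by simp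
  qed
  show ?thesis
  proof (rule ccontr)
    assume nz: "al \<star> (\<lambda>b. H b y) \<noteq> 0"
    define z where "z j = y j + (- (al \<star> y) / (al \<star> (\<lambda>b. H b y))) * H j y" for j
    have "al \<star> z = 0" unfolding z_def[abs_def] dot_add_right using nz by simp
    then have "al \<star> (\<lambda>b. H b z) = 0" by (rule on_hyperplane)
    moreover have "H b z = H b y" if "b < 4" for b
      unfolding z_def[abs_def] by (rule H_flow[OF that])
    ultimately show False using nz by simp
  qed
qed

end

context varying_ratio
begin

lemma ratio_not_constant: "\<exists>y. H i x * H k y - H k x * H i y \<noteq> 0" if "H k x \<noteq> 0"
proof (rule ccontr)
  assume "\<not> ?thesis"
  then have "H i = (\<lambda>y. (H i x / H k x) * H k y)" using that by (auto simp: field_simps)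
  then have "pd a (H i) x0 = (H i x / H k x) * pd a (H k) x0 \<and> H i x0 = (H i x / H k x) * H k x0"
    by (metis pd_mult[OF polyfun_const polyfun_Hk] pd_const mult_zero_left add_0)
  then show False using om0 by (auto simp: om_def)
qed

text \<open>
  The hyperplanes \<open>\<omega> y \<star> z = 0\<close> form a pencil, that is, they all contain the intersection of two
  of them. To see this, fix a generic \<open>x\<close>. For generic \<open>y\<close> with a different value of \<open>u\<close>, the
  vector \<open>H z\<close> at a common point \<open>z\<close> of the hyperplanes of \<open>x\<close> and \<open>y\<close> is subject to two
  different ratios \<open>H i / H k\<close>, so \<open>H k\<close> vanishes at \<open>z\<close>. On a line in the hyperplane of \<open>x\<close>
  that passes through \<open>x\<close>, \<open>H k\<close> is not identically zero and has finitely many zeros, whose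
  parameters form the set \<open>R\<close>. The point where the line meets the hyperplane of \<open>y\<close> is one of
  them, and hence it does not depend on \<open>y\<close>, because a product of polynomial functions vanishes
  only if a factor does.
\<close>

lemma pencil_exists:
  obtains x y1 where "w x \<noteq> 0" "(\<lambda>b. \<omega> b y1) \<star> x \<noteq> 0"
    "\<And>z y. (\<lambda>b. \<omega> b x) \<star> z = 0 \<Longrightarrow> (\<lambda>b. \<omega> b y1) \<star> z = 0 \<Longrightarrow> (\<lambda>b. \<omega> b y) \<star> z = 0"
proof -
  obtain g where g: "polyfun4 g" "\<exists>x. g x \<noteq> 0" "\<And>x. g x \<noteq> 0 \<Longrightarrow> H k x \<noteq> 0"
    "\<And>x. g x \<noteq> 0 \<Longrightarrow> w x \<noteq> 0"
    "\<And>x z. g x \<noteq> 0 \<Longrightarrow> (\<lambda>b. \<omega> b x) \<star> z = 0 \<Longrightarrow> H i z * H k x = H k z * H i x"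
    by (rule ratio_constant_on_hyperplanes) blast
  obtain x where x: "g x \<noteq> 0" using g(2) by blast
  have Hk: "H k x \<noteq> 0" and w: "w x \<noteq> 0" using g(3,4) x by auto
  define g' where "g' y = g y * (H i x * H k y - H k x * H i y)" for y
  have pf2: "polyfun4 (\<lambda>y. H i x * H k y - H k x * H i y)" by (intro polyfun_intros polyfun_H lt)
  have pfg': "polyfun4 g'" unfolding g'_def[abs_def] by (rule polyfun_mult[OF g(1) pf2])
  obtain y2 where "H i x * H k y2 - H k x * H i y2 \<noteq> 0" using ratio_not_constant[OF Hk] by blast
  then have "\<exists>y3. g' y3 \<noteq> 0" unfolding g'_def
    using polyfun_mult_eq_0[OF g(1) pf2 _ x, of y2] by blast
  then obtain y3 where y3: "g' y3 \<noteq> 0" ..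
  define A where "A z y = (\<lambda>b. \<omega> b y) \<star> z" for z y
  have pfA: "polyfun4 (A z)" for z unfolding A_def[abs_def] by (intro polyfun_dot(1) polyfun_\<omega>)
  have Ax: "A x x = 0" using om_x[OF lt(1,2), of x] by (simp add: A_def \<omega>_def)
  have Alin: "A (\<lambda>j. x j + s * z j) y = A x y + s * A z y" for s z y
    unfolding A_def by (rule dot_add_right)
  have multiple: "\<exists>c. \<forall>y. A z y = c * A x y" if z: "A z x = 0" for z
  proof (cases "\<forall>y. A z y = 0")
    case True
    then show ?thesis by (intro exI[of _ 0]) simp
  next
    case False
    then obtain y4 where y4: "A z y4 \<noteq> 0" by blast
    define p where "p = line_poly (H k) x z"
    have p: "poly p s = H k (\<lambda>j. x j + s * z j)" for s
      unfolding p_def by (rule poly_line_poly[OF polyfun_Hk])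
    define R where "R = {s. poly p s = 0}"
    have p0: "poly p 0 \<noteq> 0" using Hk by (simp add: p)
    then have "p \<noteq> 0" by auto
    then have finR: "finite R" unfolding R_def by (rule poly_roots_finite)
    have F: "polyfun4 (\<lambda>y. A x y + s * A z y)" for s by (intro polyfun_intros pfA)
    have "(\<Prod>s\<in>R. A x y + s * A z y) = 0" for y
    proof -
      have "\<exists>y5. g' y5 * A z y5 \<noteq> 0" using polyfun_mult_eq_0[OF pfg' pfA _ y3, of z y4] y4 by blast
      then obtain y5 where y5: "g' y5 * A z y5 \<noteq> 0" ..
      show ?thesis
      proof (rule polyfun_zero_generic[where g = "\<lambda>y. \<Prod>s\<in>R. A x y + s * A z y",
            OF polyfun_mult[OF pfg' pfA] polyfun_prod y5])
        fix y assume "g' y * A z y \<noteq> 0"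
        then have gy: "g y \<noteq> 0" and d: "H i x * H k y - H k x * H i y \<noteq> 0" and Az: "A z y \<noteq> 0"
          by (auto simp: g'_def)
        define s where "s = - A x y / A z y"
        define z' where "z' j = x j + s * z j" for j
        have s0: "A x y + s * A z y = 0" using Az by (simp add: s_def)
        have 1: "H i z' * H k x = H k z' * H i x"
          using g(5)[OF x, of z'] Alin[of s z x] Ax z by (simp add: A_def z'_def[abs_def])
        have 2: "H i z' * H k y = H k z' * H i y"
          using g(5)[OF gy, of z'] Alin[of s z y] s0 by (simp add: A_def z'_def[abs_def])
        have "H k z' * (H i x * H k y - H k x * H i y) = (H k z' * H i x) * H k y - H k x * (H k z' * H i y)"
          by (simp add: algebra_simps)
        also have "\<dots> = 0" by (simp add: 1[symmetric] 2[symmetric])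
        finally have "H k z' = 0" using d by simp
        then have "s \<in> R" by (simp add: R_def p z'_def[abs_def])
        then show "(\<Prod>s\<in>R. A x y + s * A z y) = 0" using s0 finR by (intro prod_zero) auto
      qed (rule F)
    qed
    then obtain s where s: "s \<in> R" "\<And>y. A x y + s * A z y = 0"
      using polyfun_prod_zero[OF finR, of "{..<4}" "\<lambda>s y. A x y + s * A z y"] F by blast
    have "s \<noteq> 0" using s(1) p0 by (auto simp: R_def)
    then have "A z y = (- 1 / s) * A x y" for y using s(2)[of y] by (simp add: field_simps add_eq_0_iff)
    then show ?thesis by blast
  qed
  have "\<exists>y1. A x y1 \<noteq> 0"
  proof (rule ccontr)
    assume "\<nexists>y1. A x y1 \<noteq> 0"
    then have Az0: "A z y = 0" if "A z x = 0" for z y using multiple[OF that] by auto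
    \<comment> \<open>In this case the hyperplanes would all coincide, but each contains the point \<open>y\<close> that it belongs to.\<close>
    have cross: "w x * \<omega> b y = \<omega> b x * w y" if b: "b < 4" for b y
    proof -
      define e where "e p j = (if j = p then 1 else 0 :: complex)" for p j :: nat
      have Ae: "A (\<lambda>j. w x * e b j + (- \<omega> b x) * e a j) y = w x * \<omega> b y - \<omega> b x * w y" for y
      proof -
        have "A (\<lambda>j. w x * e b j + (- \<omega> b x) * e a j) y
          = (\<lambda>b. \<omega> b y) \<star> (\<lambda>j. w x * e b j) + (- \<omega> b x) * ((\<lambda>b. \<omega> b y) \<star> e a)"
          unfolding A_def by (rule dot_add_right)
        also have "(\<lambda>b. \<omega> b y) \<star> (\<lambda>j. w x * e b j) = w x * ((\<lambda>b. \<omega> b y) \<star> e b)"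
          unfolding sum_distrib_left by (simp add: mult_ac)
        finally show ?thesis using dot_unit[OF b, of "\<lambda>b. \<omega> b y"] dot_unit[OF lt(3), of "\<lambda>b. \<omega> b y"]
          by (simp add: e_def[abs_def] \<omega>_a)
      qed
      from Ae[of x] have "A (\<lambda>j. w x * e b j + (- \<omega> b x) * e a j) x = 0" by (simp add: mult.commute)
      from Az0[OF this, of y] Ae[of y] show ?thesis by simp
    qed
    define F where "F y = (\<lambda>b. \<omega> b x) \<star> y" for y
    have pfF: "polyfun4 F" unfolding F_def by (intro polyfun_intros) auto
    have "w y * F y = 0" for y
    proof -
      have "w y * F y = (\<Sum>b<4. (\<omega> b x * w y) * y b)"
        unfolding F_def sum_distrib_left by (simp add: mult_ac)
      also have "\<dots> = (\<Sum>b<4. (w x * \<omega> b y) * y b)" by (intro sum.cong refl) (simp add: cross)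
      also have "\<dots> = w x * ((\<lambda>b. \<omega> b y) \<star> y)" unfolding sum_distrib_left by (simp add: mult.assoc)
      also have "\<dots> = 0" using om_x[OF lt(1,2), of y] by (simp add: \<omega>_def)
      finally show ?thesis .
    qed
    then have "F (\<lambda>b. if b = a then 1 else 0) = 0"
      by (rule polyfun_mult_eq_0[OF polyfun_w pfF _ w_nz])
    then show False using w dot_unit[OF lt(3), of "\<lambda>b. \<omega> b x"] by (simp add: F_def \<omega>_a)
  qed
  then obtain y1 where y1: "A x y1 \<noteq> 0" ..
  show ?thesis
  proof (rule that[OF w])
    show "(\<lambda>b. \<omega> b y1) \<star> x \<noteq> 0" using y1 by (simp add: A_def)
    fix z y assume "(\<lambda>b. \<omega> b x) \<star> z = 0" and 2: "(\<lambda>b. \<omega> b y1) \<star> z = 0"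
    then obtain c where c: "\<And>y. A z y = c * A x y" using multiple[of z] by (auto simp: A_def)
    then have "c = 0" using c[of y1] 2 y1 by (simp add: A_def)
    then show "(\<lambda>b. \<omega> b y) \<star> z = 0" using c[of y] by (simp add: A_def)
  qed
qed

text \<open>
  The forms \<open>al\<close> and \<open>be\<close> are the equations of two hyperplanes of the pencil. The gradient \<open>\<omega> y\<close>
  is a linear combination of them that annihilates both \<open>y\<close> and \<open>H y\<close>, so that the determinant
  of the values of the two forms at \<open>H y\<close> and \<open>y\<close> vanishes.
\<close>

lemma ratios_depend_on_two_forms:
  obtains al be p q where "p < 4" "q < 4" "al p * be q \<noteq> al q * be p"
    "\<And>y. al \<star> (\<lambda>b. H b y) = 0" "\<And>y. be \<star> (\<lambda>b. H b y) = 0"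
    "\<And>l m v y. l < 4 \<Longrightarrow> m < 4 \<Longrightarrow> al \<star> v = 0 \<Longrightarrow> be \<star> v = 0 \<Longrightarrow>
       H l (\<lambda>j. y j + v j) * H m y = H m (\<lambda>j. y j + v j) * H l y"
    "\<And>u. (\<And>m y s. m < 4 \<Longrightarrow> H m (\<lambda>j. y j + s * u j) = H m y) \<Longrightarrow> al \<star> u = 0 \<and> be \<star> u = 0"
proof -
  obtain x y1 where w: "w x \<noteq> 0" and y1: "(\<lambda>b. \<omega> b y1) \<star> x \<noteq> 0"
    and M: "\<And>z y. (\<lambda>b. \<omega> b x) \<star> z = 0 \<Longrightarrow> (\<lambda>b. \<omega> b y1) \<star> z = 0 \<Longrightarrow> (\<lambda>b. \<omega> b y) \<star> z = 0"
    by (rule pencil_exists) blast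
  define al where "al b = \<omega> b x" for b
  define be where "be b = \<omega> b y1" for b
  have alx: "al \<star> x = 0" using om_x[OF lt(1,2), of x] by (simp add: al_def \<omega>_def)
  have bex: "be \<star> x \<noteq> 0" using y1 by (simp add: be_def)
  have ala: "al a \<noteq> 0" using w by (simp add: al_def \<omega>_a)
  have "\<exists>q<4. al a * be q \<noteq> al q * be a"
  proof (rule ccontr)
    assume "\<not> ?thesis"
    then have "al a * be q = al q * be a" if "q < 4" for q using that by blast
    then have "al a * (be \<star> x) = (\<Sum>q<4. al q * be a * x q)"
      unfolding sum_distrib_left by (intro sum.cong) (auto simp: mult.assoc[symmetric])
    also have "\<dots> = be a * (al \<star> x)" unfolding sum_distrib_left by (simp add: mult_ac)
    finally show False using alx bex ala by simp
  qed
  then obtain q where q: "q < 4" "al a * be q \<noteq> al q * be a" by blast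
  let ?g = "\<lambda>y. (al \<star> (\<lambda>b. H b y)) * (be \<star> y) - (be \<star> (\<lambda>b. H b y)) * (al \<star> y)"
  have N: "?g y = 0" for y
  proof (rule polyfun_zero_generic[where g = "?g",
        OF polyfun_w _ w_nz])
    show "polyfun4 ?g"
      by (intro polyfun_intros polyfun_H) auto
    fix y assume wy: "w y \<noteq> 0"
    define u where "u b = H b y" for b
    define D where "D = (al \<star> u) * (be \<star> y) - (be \<star> u) * (al \<star> y)"
    have "D = 0"
    proof (rule ccontr)
      assume D: "D \<noteq> 0"
      \<comment> \<open>Otherwise every vector, in particular the unit vector \<open>e\<close>, is congruent to an element \<open>s * u + t * y\<close>
        of the span of \<open>u = H y\<close> and \<open>y\<close> modulo the common kernel of the two forms; the values of \<open>s\<close> and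
        \<open>t\<close> come from Cramer's rule. Then the gradient would vanish at \<open>y\<close>.\<close>
      define e where "e b = (if b = a then 1 else 0 :: complex)" for b
      define s where "s = ((al \<star> e) * (be \<star> y) - (be \<star> e) * (al \<star> y)) / D"
      define t where "t = ((al \<star> u) * (be \<star> e) - (be \<star> u) * (al \<star> e)) / D"
      define z where "z j = (e j + (- s) * u j) + (- t) * y j" for j
      have zdot: "f \<star> z = f \<star> e - s * (f \<star> u) - t * (f \<star> y)" for f
        unfolding z_def[abs_def] dot_add_right by simp
      have "D * (al \<star> z) = 0" "D * (be \<star> z) = 0"
        unfolding zdot s_def t_def using D by (simp_all add: field_simps) (simp_all add: D_def algebra_simps)
      then have "(\<lambda>b. \<omega> b y) \<star> z = 0" using M[of z y] D by (simp add: al_def be_def)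
      moreover have "(\<lambda>b. \<omega> b y) \<star> u = 0" using om_H[OF lt(1,2), of y] by (simp add: \<omega>_def u_def)
      moreover have "(\<lambda>b. \<omega> b y) \<star> y = 0" using om_x[OF lt(1,2), of y] by (simp add: \<omega>_def)
      ultimately have "(\<lambda>b. \<omega> b y) \<star> e = 0" unfolding zdot by simp
      then show False using wy dot_unit[OF lt(3), of "\<lambda>b. \<omega> b y"] by (simp add: e_def \<omega>_a)
    qed
    then show "?g y = 0"
      by (simp add: D_def u_def)
  qed
  show ?thesis
  proof (rule that[OF lt(3) q])
    show "al \<star> (\<lambda>b. H b y) = 0" for y
      by (rule form_of_H_zero[OF _ alx bex]) (use N in simp)
    \<comment> \<open>A vector in the kernel of \<open>be\<close> on which \<open>al\<close> is nonzero.\<close>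
    define e where "e j = be q * (if j = a then 1 else 0) + (- be a) * (if j = q then 1 else 0)" for j
    have edot: "f \<star> e = be q * f a - be a * f q" for f
    proof -
      have "f \<star> e = f \<star> (\<lambda>j. be q * (if j = a then 1 else 0)) + (- be a) * (f \<star> (\<lambda>j. if j = q then 1 else 0))"
        unfolding e_def[abs_def] by (rule dot_add_right)
      also have "f \<star> (\<lambda>j. be q * (if j = a then 1 else 0)) = be q * (f \<star> (\<lambda>j. if j = a then 1 else 0))"
        unfolding sum_distrib_left by (simp add: mult_ac)
      finally show ?thesis unfolding dot_unit[OF lt(3)] dot_unit[OF q(1)] by simp
    qed
    show "be \<star> (\<lambda>b. H b y) = 0" for y
      by (rule form_of_H_zero[of be al e]) (use N q(2) in \<open>simp_all add: edot mult.commute\<close>)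
  next
    fix l m :: nat and v y assume l: "l < 4" and m: "m < 4" and v: "al \<star> v = 0" "be \<star> v = 0"
    let ?z = "\<lambda>y j. y j + v j :: complex"
    have \<omega>v: "(\<lambda>b. \<omega> b y) \<star> v = 0" for y using M v by (simp add: al_def be_def)
    have pfo: "polyfun4 (\<lambda>y. (\<lambda>b. om l k b y) \<star> v)" if "l < 4" for l by (intro polyfun_dot(1) polyfun_om that lt)
    have omv: "(\<lambda>b. om l k b y) \<star> v = 0" if l: "l < 4" for l y
    proof (rule polyfun_mult_eq_0[OF polyfun_w pfo[OF l] _ w_nz])
      fix y
      have "w y * ((\<lambda>b. om l k b y) \<star> v) = (\<Sum>b<4. (om l k b y * w y) * v b)"
        unfolding sum_distrib_left by (simp add: mult_ac)
      also have "\<dots> = K l y * ((\<lambda>b. \<omega> b y) \<star> v)"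
        unfolding om_w[OF l] sum_distrib_left by (simp add: mult.assoc)
      finally show "w y * ((\<lambda>b. om l k b y) \<star> v) = 0" by (simp add: \<omega>v)
    qed
    have k_ratio: "H l (?z y) * H k y = H k (?z y) * H l y" if l: "l < 4" for l y
      using ratio_constant_if_om_zero[OF l lt(2), of y v 1] omv[OF l] by simp
    have pfz: "polyfun4 (\<lambda>y. H l (?z y))" if "l < 4" for l
      by (rule polyfun_comp[OF polyfun_H[OF that]]) (intro polyfun_intros, auto)
    obtain y0 where y0: "H k y0 \<noteq> 0" using Hk_nz by blast
    let ?g = "\<lambda>y. H l (?z y) * H m y - H m (?z y) * H l y"
    have "?g y = 0"
    proof (rule polyfun_zero_generic[where g = "?g", OF polyfun_Hk _ y0])
      show "polyfun4 ?g"
        by (intro polyfun_intros pfz polyfun_H l m)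
      fix y assume Hk: "H k y \<noteq> 0"
      have "(H l (?z y) * H m y - H m (?z y) * H l y) * H k y
          = (H l (?z y) * H k y) * H m y - (H m (?z y) * H k y) * H l y"
        by (simp add: algebra_simps)
      also have "\<dots> = 0" unfolding k_ratio[OF l] k_ratio[OF m] by simp
      finally show "?g y = 0" using Hk by simp
    qed
    then show "H l (\<lambda>j. y j + v j) * H m y = H m (\<lambda>j. y j + v j) * H l y" by simp
  next
    fix u assume inv: "\<And>m y s. m < 4 \<Longrightarrow> H m (\<lambda>j. y j + s * u j) = H m y"
    have "dd u (H m) y = 0" if "m < 4" for m y
    proof -
      have "((\<lambda>s. H m y) has_field_derivative dd u (H m) (\<lambda>j. y j + 0 * u j)) (at 0)"
        using dd_line[OF polyfun_H[OF that], of y u 0] unfolding inv[OF that] by simp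
      then have "dd u (H m) (\<lambda>j. y j + 0 * u j) = 0" using DERIV_const by (rule DERIV_unique)
      then show ?thesis by simp
    qed
    then have "(\<lambda>b. \<omega> b y) \<star> u = 0" for y
      using om_dd[of i k y u] lt by (simp add: \<omega>_def)
    then show "al \<star> u = 0 \<and> be \<star> u = 0" by (simp add: al_def be_def)
  qed
qed

end

context homogeneous_quasi_translation
begin

text \<open>
  The last conclusion is for the case of three variables, where it excludes the fourth variable
  from \<open>al\<close> and \<open>be\<close>.
\<close>

theorem proportional_or_pencil:
  assumes "\<not> proportional"
  obtains al be p q where "p < 4" "q < 4" "al p * be q \<noteq> al q * be p"
    "\<And>y. al \<star> (\<lambda>b. H b y) = 0" "\<And>y. be \<star> (\<lambda>b. H b y) = 0"
    "\<And>l m v y. l < 4 \<Longrightarrow> m < 4 \<Longrightarrow> al \<star> v = 0 \<Longrightarrow> be \<star> v = 0 \<Longrightarrow>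
       H l (\<lambda>j. y j + v j) * H m y = H m (\<lambda>j. y j + v j) * H l y"
    "\<And>u. (\<And>m y s. m < 4 \<Longrightarrow> H m (\<lambda>j. y j + s * u j) = H m y) \<Longrightarrow> al \<star> u = 0 \<and> be \<star> u = 0"
proof -
  obtain i k a x where ika: "i < 4" "k < 4" "a < 4" "om i k a x \<noteq> 0"
    using not_proportional_om_nonzero[OF assms] .
  interpret varying_ratio H d i k a x by unfold_locales (use assms ika in auto)
  show ?thesis
  proof (rule ratios_depend_on_two_forms, goal_cases)
    case (1 al be p q)
    show ?case by (rule that[OF 1])
  qed
qed

end

section \<open>Two components with a ratio in two variables\<close>

definition first_two :: "point \<Rightarrow> point" where
  "first_two x = (\<lambda>j. if j < 2 then x j else 0)"

lemma polyfun2_first_two: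
  assumes "polyfun V f"
  shows "polyfun {..<2} (\<lambda>x. f (first_two x))"
  unfolding first_two_def
proof (rule polyfun_comp[where g = "\<lambda>j x. if j < 2 then x j else 0", OF assms])
  show "polyfun {..<2} (\<lambda>x. if j < 2 then x j else 0)" for j
    by (cases "j < 2") (auto intro: polyfun_var polyfun_const)
qed

lemma polyfun2_cong_first_two: "polyfun {..<2} f \<Longrightarrow> f (first_two x) = f x"
  by (rule polyfun_cong_point) (auto simp: first_two_def)

lemma polyfun2_imp_polyfun4: "polyfun {..<2} f \<Longrightarrow> polyfun4 f"
  by (rule polyfun_mono) auto

text \<open>
  The function \<open>C n\<close> is the coefficient of the \<open>n\<close>-th power of the variable with index \<open>m\<close>,
  after the other variable with an index above 1 has been set to 0. The bound \<open>N\<close> is left open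
  so that two such expansions can be compared term by term.
\<close>

lemma polyfun_expand_variable:
  assumes f: "polyfun4 f" and m: "m < 4" "m \<ge> 2"
  obtains C where "\<And>n. polyfun {..<2} (C n)" "\<exists>N. \<forall>n>N. \<forall>x. C n x = 0"
    "\<And>N x y. (\<And>n x. n > N \<Longrightarrow> C n x = 0) \<Longrightarrow>
       f ((first_two x)(m := y)) = (\<Sum>n\<le>N. C n x * y ^ n)"
proof -
  define \<pi> where "\<pi> = transpose m (3::nat)"
  have \<pi>4: "\<pi> ` {..<4} = {..<4}" unfolding \<pi>_def using m by (intro transpose_image_eq) auto
  have \<pi>3: "\<pi> 3 = m" by (simp add: \<pi>_def)
  have \<pi>m: "\<pi> n \<noteq> m" if "n < 3" for n using that by (auto simp: \<pi>_def transpose_def)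
  obtain q where q: "f = eval4 \<pi> q" using eval4_surj[OF f, of \<pi>] \<pi>4 by auto
  define C where "C n x = eval4 \<pi> [:coeff q n:] (first_two x)" for n x
  have upd: "eval4 \<pi> [:r:] (x(m := y)) = eval4 \<pi> [:r:] x" for r x y
    by (rule polyfun_cong_point[OF polyfun_eval4_const]) (use \<pi>m in auto)
  have "f ((first_two x)(m := y)) = (\<Sum>n\<le>degree q. C n x * y ^ n)" for x y
  proof -
    have "eval4 \<pi> q z = (\<Sum>n\<le>degree q. eval4 \<pi> [:coeff q n:] z * z m ^ n)" for z
      by (simp add: eval4_def \<pi>3 poly_altdef[of q] poly_sum)
    then show ?thesis by (simp add: q C_def upd)
  qed
  moreover have C0: "C n x = 0" if "n > degree q" for n x
    using that by (simp add: C_def coeff_eq_0)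
  moreover have "(\<Sum>n\<le>N. C n x * y ^ n) = (\<Sum>n\<le>degree q. C n x * y ^ n)"
    if "\<And>n x. n > N \<Longrightarrow> C n x = 0" for N x y
  proof -
    have "(\<Sum>n\<le>N. C n x * y ^ n) = (\<Sum>n\<le>max N (degree q). C n x * y ^ n)"
      by (rule sum.mono_neutral_left) (use that in auto)
    also have "\<dots> = (\<Sum>n\<le>degree q. C n x * y ^ n)"
      by (rule sum.mono_neutral_right) (use C0 in auto)
    finally show ?thesis .
  qed
  moreover have "polyfun {..<2} (C n)" for n
    unfolding C_def[abs_def] by (rule polyfun2_first_two[OF polyfun_eval4])
  ultimately show ?thesis using that[of C] by (metis (no_types, lifting))
qed

text \<open>
  A divisor of a nonzero function that does not depend on some variable does not depend on it
  either, as one sees from degrees.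
\<close>

lemma polyfun_div_const_along:
  assumes a: "polyfun4 a" and r: "polyfun4 r" and a0: "polyfun4 a0"
    and eq: "\<And>x. a0 x = a x * r x" and inv: "\<And>x t. a0 (\<lambda>j. x j + t * v j) = a0 x" and nz: "a0 x0 \<noteq> 0"
  shows "a (\<lambda>j. x j + v j) = a x"
proof -
  let ?g = "\<lambda>x. a (\<lambda>j. x j + v j) - a x"
  have pf: "polyfun4 ?g"
    by (intro polyfun_diff a polyfun_comp[OF a] polyfun_add polyfun_const polyfun_var)
  have "?g x = 0"
  proof (rule polyfun_zero_generic[where g = "?g", OF a0 pf nz])
    fix x assume x: "a0 x \<noteq> 0"
    have "poly (line_poly r x v) s * poly (line_poly a x v) s = a0 x * s ^ 0" for s
      using inv[of x s] eq[of "\<lambda>j. x j + s * v j"] by (simp add: poly_line_poly[OF a] poly_line_poly[OF r] mult.commute)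
    from poly_factor_of_power_constant[OF this x, of 1] show "?g x = 0"
      by (simp add: poly_line_poly[OF a])
  qed
  then show ?thesis by simp
qed

text \<open>
  Two functions \<open>G2\<close> and \<open>G3\<close> whose ratio depends on the first two variables only are \<open>b * c\<close>
  and \<open>a * c\<close> with coprime \<open>a\<close> and \<open>b\<close>. The latter depend on the first two variables only,
  because \<open>a\<close> divides \<open>a0\<close>, which is \<open>G3\<close> with the other two variables frozen. The flow then
  preserves \<open>a\<close> and \<open>b\<close>, hence \<open>c\<close>, and moves a point by multiples of \<open>(0, 0, b, a)\<close>. Sliding
  along it to the hyperplane where the last variable is zero gives
  \<open>c x = (\<Sum>n\<le>N. C n x * (x 2 - x 3 * b x / a x) ^ n)\<close>, so \<open>c\<close> is a polynomial in
  \<open>a x * x 2 - b x * x 3\<close> with coefficients \<open>C n / a ^ n\<close>. These are polynomial: the expansion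
  coefficients \<open>E n\<close> of \<open>c\<close> on the hyperplane where the third variable is zero equal
  \<open>C n * (- b / a) ^ n\<close>, so \<open>a ^ n\<close> divides \<open>b ^ n * C n\<close> and hence \<open>C n\<close>.
\<close>

lemma two_component_structure:
  assumes G2: "polyfun4 G2" and G3: "polyfun4 G3" and nz: "G3 x0 \<noteq> 0"
    and ratio: "\<And>x v. v 0 = 0 \<Longrightarrow> v 1 = 0 \<Longrightarrow>
       G2 (\<lambda>j. x j + v j) * G3 x = G3 (\<lambda>j. x j + v j) * G2 x"
    and flow: "\<And>x t. G3 (x(2 := x 2 + t * G2 x, 3 := x 3 + t * G3 x)) = G3 x"
  obtains a b e N where "polyfun {..<2} a" "polyfun {..<2} b" "\<And>n. polyfun {..<2} (e n)"
    "\<And>x. G2 x = b x * (\<Sum>n\<le>N. e n x * (a x * x 2 - b x * x 3) ^ n)"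
    "\<And>x. G3 x = a x * (\<Sum>n\<le>N. e n x * (a x * x 2 - b x * x 3) ^ n)"
proof -
  obtain a b c where a: "polyfun4 a" and b: "polyfun4 b" and c: "polyfun4 c"
    and G2eq: "\<And>x. G2 x = b x * c x" and G3eq: "\<And>x. G3 x = a x * c x"
    and cop: "\<And>k u v. polyfun4 u \<Longrightarrow> polyfun4 v \<Longrightarrow> (\<And>x. a x ^ k * u x = b x ^ k * v x) \<Longrightarrow>
       \<exists>r. polyfun4 r \<and> (\<forall>x. v x = a x ^ k * r x)"
    using polyfun_coprime_factorization[OF G2 G3 nz] by metis
  have ax0: "a x0 \<noteq> 0" and cx0: "c x0 \<noteq> 0" using nz G3eq by auto
  define freeze where "freeze x j = (if j < 2 then x j else x0 j)" for x :: point and j :: nat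
  define a0 where "a0 x = G3 (freeze x)" for x
  define b0 where "b0 x = G2 (freeze x)" for x
  have pff: "polyfun4 (\<lambda>x. freeze x j)" for j
    unfolding freeze_def by (cases "j < 2") (auto intro: polyfun_var polyfun_const)
  have pf0: "polyfun4 a0" "polyfun4 b0" unfolding a0_def[abs_def] b0_def[abs_def]
    using polyfun_comp[where g = "\<lambda>j x. freeze x j", OF G3 pff] polyfun_comp[where g = "\<lambda>j x. freeze x j", OF G2 pff]
    by simp_all
  have freeze_shift: "freeze (\<lambda>j. x j + t * v j) = freeze x" if "v 0 = 0" "v 1 = 0" for x t v
    using that by (auto simp: freeze_def less_2_cases_iff)
  have inv0: "a0 (\<lambda>j. x j + t * v j) = a0 x" "b0 (\<lambda>j. x j + t * v j) = b0 x"
    if "v 0 = 0" "v 1 = 0" for x t v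
    by (simp_all add: a0_def b0_def freeze_shift[OF that])
  have "freeze x0 = x0" by (auto simp: freeze_def)
  then have a0x0: "a0 x0 \<noteq> 0" using nz by (simp add: a0_def)
  let ?g = "\<lambda>x. a x * b0 x - b x * a0 x"
  have cross: "?g x = 0" for x
  proof (rule polyfun_mult_eq_0[OF c _ _ cx0, where g = "?g"])
    show "polyfun4 ?g" by (intro polyfun_intros a b pf0)
    show "c x * (a x * b0 x - b x * a0 x) = 0" for x
    proof -
      have "freeze x 0 - x 0 = 0" "freeze x 1 - x 1 = 0" by (simp_all add: freeze_def)
      from ratio[of "\<lambda>j. freeze x j - x j" x, OF this]
      have "b0 x * G3 x = a0 x * G2 x" by (simp add: a0_def b0_def)
      then show ?thesis by (simp add: G2eq G3eq algebra_simps)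
    qed
  qed
  have "a x ^ 1 * b0 x = b x ^ 1 * a0 x" for x using cross[of x] by simp
  from cop[OF pf0(2,1) this] obtain r where r: "polyfun4 r" "\<And>x. a0 x = a x * r x" by auto
  have a_shift: "a (\<lambda>j. x j + v j) = a x" if "v 0 = 0" "v 1 = 0" for x v
    by (rule polyfun_div_const_along[OF a r(1) pf0(1) r(2) inv0(1)[OF that] a0x0])
  have b_shift: "b (\<lambda>j. x j + v j) = b x" if v: "v 0 = 0" "v 1 = 0" for x v
  proof -
    let ?g = "\<lambda>x. b (\<lambda>j. x j + v j) - b x"
    have pfb: "polyfun4 ?g"
      by (intro polyfun_diff b polyfun_comp[OF b] polyfun_add polyfun_const polyfun_var)
    have "?g x = 0"
    proof (rule polyfun_zero_generic[where g = "?g", OF pf0(1) pfb a0x0])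
      fix x assume x: "a0 x \<noteq> 0"
      have "b (\<lambda>j. x j + v j) * a0 x = b x * a0 x"
        using cross[of "\<lambda>j. x j + v j"] cross[of x] inv0[OF v, of x 1] a_shift[OF v, of x] by auto
      then show "?g x = 0" using x by simp
    qed
    then show ?thesis by simp
  qed
  have eq_of_shift: "f x = f y"
    if f: "polyfun4 f" and sh: "\<And>x v. v 0 = 0 \<Longrightarrow> v 1 = 0 \<Longrightarrow> f (\<lambda>j. x j + v j) = f x"
      and "x 0 = y 0" "x 1 = y 1" for f :: "point \<Rightarrow> complex" and x y
    using sh[of "\<lambda>j. x j - y j" y] that(3,4) by simp
  note a_eq = eq_of_shift[OF a a_shift] and b_eq = eq_of_shift[OF b b_shift]
  have "a = (\<lambda>x. a (first_two x))" "b = (\<lambda>x. b (first_two x))"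
    by (intro ext a_eq b_eq; simp add: first_two_def)+
  then have a2: "polyfun {..<2} a" and b2: "polyfun {..<2} b"
    using polyfun2_first_two[OF a] polyfun2_first_two[OF b] by simp_all
  have c_flow: "c (x(2 := x 2 + t * b x, 3 := x 3 + t * a x)) = c x" for x t
  proof -
    have upd: "x(2 := x 2 + t * b x, 3 := x 3 + t * a x)
        = (\<lambda>j. if j = 3 then x 3 + t * a x else if j = 2 then x 2 + t * b x else x j)" for x t
      by (auto simp: fun_eq_iff)
    let ?g = "\<lambda>x. c (x(2 := x 2 + t * b x, 3 := x 3 + t * a x)) - c x"
    have pfc: "polyfun4 ?g"
      unfolding upd
    proof (intro polyfun_diff c polyfun_comp[OF c])
      fix j :: nat assume "j \<in> {..<4}"
      then show "polyfun4 (\<lambda>x. if j = 3 then x 3 + t * a x else if j = 2 then x 2 + t * b x else x j)"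
        by (cases "j = 3"; cases "j = 2") (auto intro!: polyfun_intros a b)
    qed
    have "?g x = 0"
    proof (rule polyfun_zero_generic[where g = "?g",
          OF G3 pfc nz])
      fix x assume "G3 x \<noteq> 0"
      then have ac: "a x \<noteq> 0" "c x \<noteq> 0" by (auto simp: G3eq)
      let ?y = "x(2 := x 2 + t * b x, 3 := x 3 + t * a x)"
      have "G3 ?y = G3 x" using flow[of x "t / c x"] ac by (simp add: G2eq G3eq)
      moreover have "a ?y = a x" by (rule a_eq) auto
      ultimately show "c ?y - c x = 0" using ac by (simp add: G3eq)
    qed
    then show ?thesis by simp
  qed
  obtain C where C: "\<And>n. polyfun {..<2} (C n)" "\<exists>N. \<forall>n>N. \<forall>x. C n x = 0"
    "\<And>N x y. (\<And>n x. n > N \<Longrightarrow> C n x = 0) \<Longrightarrow> c ((first_two x)(2 := y)) = (\<Sum>n\<le>N. C n x * y ^ n)"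
    by (rule polyfun_expand_variable[OF c, of 2]) auto
  obtain E where E: "\<And>n. polyfun {..<2} (E n)" "\<exists>N. \<forall>n>N. \<forall>x. E n x = 0"
    "\<And>N x y. (\<And>n x. n > N \<Longrightarrow> E n x = 0) \<Longrightarrow> c ((first_two x)(3 := y)) = (\<Sum>n\<le>N. E n x * y ^ n)"
    by (rule polyfun_expand_variable[OF c, of 3]) auto
  obtain N1 N2 where N12: "\<forall>n>N1. \<forall>x. C n x = 0" "\<forall>n>N2. \<forall>x. E n x = 0" using C(2) E(2) by blast
  define N where "N = max N1 N2"
  have CN: "C n x = 0" "E n x = 0" if "n > N" for n x using N12 that by (auto simp: N_def)
  have slide: "c x = c ((first_two x)(2 := x 2 - x 3 * (b x / a x)))" if "a x \<noteq> 0" for x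
  proof -
    have "c ((first_two x)(2 := x 2 - x 3 * (b x / a x)))
        = c (x(2 := x 2 + (- x 3 / a x) * b x, 3 := x 3 + (- x 3 / a x) * a x))"
      by (rule polyfun_cong_point[OF c]) (use that in \<open>auto simp: first_two_def\<close>)
    then show ?thesis by (simp only: c_flow)
  qed
  have EC: "a x ^ n * ((- 1) ^ n * E n x) = b x ^ n * C n x" for n x
  proof -
    let ?g = "\<lambda>x. a x ^ n * ((- 1) ^ n * E n x) - b x ^ n * C n x"
    have pf: "polyfun4 ?g"
      by (intro polyfun_intros a b polyfun2_imp_polyfun4 E C)
    have "?g x = 0"
    proof (rule polyfun_zero_generic[where g = "?g",
          OF a pf ax0])
      fix x assume x: "a x \<noteq> 0"
      define \<rho> where "\<rho> = - b x / a x"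
      have "(\<Sum>n\<le>N. E n x * y ^ n) = (\<Sum>n\<le>N. C n x * \<rho> ^ n * y ^ n)" for y
      proof -
        let ?z = "(first_two x)(3 := y)"
        have ab: "a ?z = a x" "b ?z = b x" by (intro a_eq b_eq; simp add: first_two_def)+
        have ft: "first_two ?z = first_two x" by (auto simp: first_two_def)
        have "(\<Sum>n\<le>N. E n x * y ^ n) = c ?z" using E(3)[OF CN(2)] by simp
        also have "\<dots> = c ((first_two x)(2 := \<rho> * y))"
          using slide[of ?z] x unfolding ab ft by (simp add: \<rho>_def first_two_def mult.commute)
        also have "\<dots> = (\<Sum>n\<le>N. C n x * \<rho> ^ n * y ^ n)"
          using C(3)[OF CN(1)] by (simp add: power_mult_distrib mult.assoc)
        finally show ?thesis .
      qed
      then have "poly (\<Sum>n\<le>N. monom (E n x) n) y = poly (\<Sum>n\<le>N. monom (C n x * \<rho> ^ n) n) y" for y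
        by (simp add: poly_sum poly_monom)
      then have "(\<Sum>n\<le>N. monom (E n x) n) = (\<Sum>n\<le>N. monom (C n x * \<rho> ^ n) n)"
        by (rule poly_eq_poly_eq_iff[THEN iffD1, OF ext])
      then have "coeff (\<Sum>n\<le>N. monom (E n x) n) n = coeff (\<Sum>n\<le>N. monom (C n x * \<rho> ^ n) n) n" by simp
      then have "E n x = C n x * \<rho> ^ n"
        using CN[of n x] by (cases "n \<le> N") (auto simp: coeff_sum)
      then have "a x ^ n * ((- 1) ^ n * E n x) = C n x * ((- 1) ^ n * (a x * \<rho>) ^ n)"
        by (simp only: power_mult_distrib mult_ac)
      also have "(- 1) ^ n * (a x * \<rho>) ^ n = (- (a x * \<rho>)) ^ n" by (rule power_minus[symmetric])
      also have "- (a x * \<rho>) = b x" using x by (simp add: \<rho>_def)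
      finally show "?g x = 0" by simp
    qed
    then show ?thesis by simp
  qed
  have "\<exists>r. polyfun4 r \<and> (\<forall>x. C n x = a x ^ n * r x)" for n
    by (rule cop[OF _ _ EC]) (intro polyfun_intros polyfun2_imp_polyfun4 E C)+
  then obtain R where R: "\<And>n. polyfun4 (R n)" "\<And>n x. C n x = a x ^ n * R n x" by metis
  define e where "e n x = R n (first_two x)" for n x
  have e2: "polyfun {..<2} (e n)" for n unfolding e_def[abs_def] by (rule polyfun2_first_two[OF R(1)])
  have Ce: "C n x = a x ^ n * e n x" for n x
    using R(2)[of n "first_two x"] polyfun2_cong_first_two[OF C(1), of n x] polyfun2_cong_first_two[OF a2, of x]
    by (simp add: e_def)
  have c_eq: "c x = (\<Sum>n\<le>N. e n x * (a x * x 2 - b x * x 3) ^ n)" for x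
  proof -
    let ?g = "\<lambda>x. c x - (\<Sum>n\<le>N. e n x * (a x * x 2 - b x * x 3) ^ n)"
    have pf: "polyfun4 ?g"
      by (intro polyfun_intros c a b polyfun2_imp_polyfun4 e2) auto
    have "?g x = 0"
    proof (rule polyfun_zero_generic[where g = "?g",
          OF a pf ax0])
      fix x assume x: "a x \<noteq> 0"
      have "c x = (\<Sum>n\<le>N. C n x * (x 2 - x 3 * (b x / a x)) ^ n)"
        using slide[OF x] C(3)[OF CN(1)] by simp
      also have "\<dots> = (\<Sum>n\<le>N. e n x * (a x * x 2 - b x * x 3) ^ n)"
      proof (intro sum.cong refl)
        fix n
        have "a x * (x 2 - x 3 * (b x / a x)) = a x * x 2 - b x * x 3" using x by (simp add: right_diff_distrib)
        then show "C n x * (x 2 - x 3 * (b x / a x)) ^ n = e n x * (a x * x 2 - b x * x 3) ^ n"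
          by (simp add: Ce flip: power_mult_distrib)
      qed
      finally show "?g x = 0" by simp
    qed
    then show ?thesis by simp
  qed
  show ?thesis
    by (rule that[OF a2 b2 e2]) (simp_all only: G2eq G3eq c_eq)
qed

section \<open>Formal polynomials as functions\<close>

abbreviation "keys \<equiv> Poly_Mapping.keys"
abbreviation "lookup \<equiv> Poly_Mapping.lookup"

definition ev_monom :: "(nat \<Rightarrow>\<^sub>0 nat) \<Rightarrow> point \<Rightarrow> complex" where
  "ev_monom m x = (\<Prod>i\<in>keys m. x i ^ lookup m i)"

definition ev :: "cpoly \<Rightarrow> point \<Rightarrow> complex" where
  "ev p x = (\<Sum>m\<in>keys p. lookup p m * ev_monom m x)"

lemma ev_monom_superset:
  assumes "finite A" "keys m \<subseteq> A"
  shows "ev_monom m x = (\<Prod>i\<in>A. x i ^ lookup m i)"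
  unfolding ev_monom_def
  by (rule prod.mono_neutral_left) (use assms in \<open>auto simp: in_keys_iff\<close>)

lemma ev_monom_add: "ev_monom (m + n) x = ev_monom m x * ev_monom n x"
proof -
  let ?A = "keys m \<union> keys n"
  have "ev_monom (m + n) x = (\<Prod>i\<in>?A. x i ^ lookup (m + n) i)"
    by (rule ev_monom_superset) (auto simp: keys_add)
  also have "\<dots> = (\<Prod>i\<in>?A. x i ^ lookup m i) * (\<Prod>i\<in>?A. x i ^ lookup n i)"
    by (simp add: lookup_add power_add prod.distrib)
  also have "\<dots> = ev_monom m x * ev_monom n x"
    by (simp add: ev_monom_superset[of ?A])
  finally show ?thesis .
qed

lemma ev_add [simp]: "ev (p + q) x = ev p x + ev q x"
  unfolding ev_def by (rule setsum_keys_plus_distrib) (simp_all add: distrib_right)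

lemma ev_zero [simp]: "ev 0 x = 0" by (simp add: ev_def)

lemma ev_sum: "ev (\<Sum>i\<in>I. f i) x = (\<Sum>i\<in>I. ev (f i) x)"
  by (induction I rule: infinite_finite_induct) auto

lemma ev_single: "ev (Poly_Mapping.single m c) x = c * ev_monom m x"
  by (simp add: ev_def)

lemma poly_mapping_eq_sum_single:
  "p = (\<Sum>m\<in>keys p. Poly_Mapping.single m (lookup p m))"
proof (rule poly_mapping_eqI)
  fix k
  show "lookup p k
    = lookup (\<Sum>m\<in>keys p. Poly_Mapping.single m (lookup p m)) k"
    by (cases "k \<in> keys p")
       (auto simp: lookup_sum lookup_single when_def in_keys_iff)
qed

lemma ev_mult [simp]: "ev (p * q) x = ev p x * ev q x"
proof -
  let ?s = "\<lambda>p m. Poly_Mapping.single m (lookup p m :: complex)"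
  have "p * q = (\<Sum>m\<in>keys p. ?s p m) * (\<Sum>n\<in>keys q. ?s q n)"
    using poly_mapping_eq_sum_single by metis
  then have "ev (p * q) x = (\<Sum>m\<in>keys p. \<Sum>n\<in>keys q.
      ev (Poly_Mapping.single (m + n) (lookup p m * lookup q n)) x)"
    by (simp add: sum_product ev_sum mult_single)
  also have "\<dots> = ev p x * ev q x"
    unfolding ev_def[of p] ev_def[of q] sum_product by (simp add: ev_single ev_monom_add mult_ac)
  finally show ?thesis .
qed

lemma ev_Const [simp]: "ev (Const c) x = c"
  by (simp add: Const_def ev_single) (simp add: ev_monom_def)

lemma ev_X [simp]: "ev (X i) x = x i"
  by (simp add: X_def ev_single) (simp add: ev_monom_def)

lemma ev_one [simp]: "ev 1 x = 1"
  using ev_Const[of 1 x] by (simp add: Const_def)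

lemma ev_uminus [simp]: "ev (- p) x = - ev p x"
  using ev_add[of p "- p" x] by (simp add: add_eq_0_iff)

lemma ev_diff [simp]: "ev (p - q) x = ev p x - ev q x"
  using ev_add[of p "- q" x] by simp

lemma ev_power [simp]: "ev (p ^ k) x = ev p x ^ k"
  by (induction k) auto

lemma ev_prod: "ev (\<Prod>i\<in>I. f i) x = (\<Prod>i\<in>I. ev (f i) x)"
  by (induction I rule: infinite_finite_induct) auto

lemma ev_subst_poly: "ev (subst_poly \<sigma> p) x = ev p (\<lambda>i. ev (\<sigma> i) x)"
  unfolding subst_poly_def by (simp add: ev_sum ev_prod) (simp add: ev_def ev_monom_def)

text \<open>
  Monomials are multiplicative functions of the point, and pairwise different because some
  coordinate tells them apart when it is set to 2 and the others are set to 1. Distinct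
  multiplicative functions are linearly independent by Dedekind's argument: rescaling the point
  by \<open>y\<close> and subtracting \<open>ev_monom n y\<close> times the original relation removes the monomial \<open>n\<close>.
\<close>

lemma monomials_independent:
  assumes "finite M" "\<And>x. (\<Sum>m\<in>M. c m * ev_monom m x) = 0" "m \<in> M"
  shows "c m = 0"
  using assms
proof (induction M arbitrary: c m rule: finite_induct)
  case (insert n M)
  have eq: "c n * ev_monom n x + (\<Sum>m\<in>M. c m * ev_monom m x) = 0" for x
    using insert.prems(1)[of x] insert.hyps by simp
  have mult: "ev_monom m (\<lambda>i. x i * y i) = ev_monom m x * ev_monom m y" for m x y
    by (simp add: ev_monom_def power_mult_distrib prod.distrib)
  have M0: "c m = 0" if m: "m \<in> M" for m
  proof -
    have "m \<noteq> n" using m insert.hyps by auto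
    then obtain i where i: "lookup m i \<noteq> lookup n i"
      using poly_mapping_eqI by metis
    define y where "y j = (if j = i then 2 else 1 :: complex)" for j
    have evy: "ev_monom m y = 2 ^ lookup m i" for m
    proof -
      have "ev_monom m y = (\<Prod>j\<in>insert i (keys m). y j ^ lookup m j)"
        by (rule ev_monom_superset) auto
      also have "\<dots> = (\<Prod>j\<in>insert i (keys m). if j = i then 2 ^ lookup m i else 1)"
        by (intro prod.cong refl) (auto simp: y_def)
      also have "\<dots> = 2 ^ lookup m i" by simp
      finally show ?thesis .
    qed
    have "(\<Sum>m\<in>M. (c m * (ev_monom m y - ev_monom n y)) * ev_monom m x) = 0" for x
    proof -
      have "(\<Sum>m\<in>M. (c m * (ev_monom m y - ev_monom n y)) * ev_monom m x)
        = (c n * ev_monom n (\<lambda>i. x i * y i) + (\<Sum>m\<in>M. c m * ev_monom m (\<lambda>i. x i * y i)))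
          - ev_monom n y * (c n * ev_monom n x + (\<Sum>m\<in>M. c m * ev_monom m x))"
        by (simp add: mult algebra_simps sum_subtractf sum_distrib_left)
      then show ?thesis unfolding eq by simp
    qed
    then have "c m * (ev_monom m y - ev_monom n y) = 0"
      by (rule insert.IH[where c = "\<lambda>m. c m * (ev_monom m y - ev_monom n y)"]) (rule m)
    moreover have "ev_monom m y \<noteq> ev_monom n y"
    proof
      assume "ev_monom m y = ev_monom n y"
      then have "(of_nat (2 ^ lookup m i) :: complex) = of_nat (2 ^ lookup n i)"
        by (simp add: evy)
      then have "(2::nat) ^ lookup m i = 2 ^ lookup n i"
        by (simp only: of_nat_eq_iff)
      then show False using i by simp
    qed
    ultimately show ?thesis by simp
  qed
  have "c n = 0" using eq[of "\<lambda>_. 1"] M0 by (simp add: ev_monom_def)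
  then show ?case using insert.prems(2) M0 by auto
qed simp

lemma ev_inject:
  assumes "\<And>x. ev p x = ev q x"
  shows "p = q"
proof -
  have "(\<Sum>m\<in>keys (p - q). lookup (p - q) m * ev_monom m x) = 0" for x
    using assms[of x] ev_diff[of p q x] by (simp add: ev_def)
  then have "lookup (p - q) m = 0" if "m \<in> keys (p - q)" for m
    by (rule monomials_independent[OF finite_keys _ that])
  then have "lookup (p - q) m = 0" for m by (cases "m \<in> keys (p - q)") (auto simp: in_keys_iff)
  then have "p - q = 0" by (intro poly_mapping_eqI) simp
  then show ?thesis by (simp only: right_minus_eq)
qed

lemma subalgebra_generated: "subalgebra (generated_subalgebra G)"
  unfolding generated_subalgebra_def by (rule hull_in) (auto simp: subalgebra_def)

lemma generated_closed:
  "Const c \<in> generated_subalgebra G"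
  "p \<in> generated_subalgebra G \<Longrightarrow> q \<in> generated_subalgebra G \<Longrightarrow> p + q \<in> generated_subalgebra G"
  "p \<in> generated_subalgebra G \<Longrightarrow> q \<in> generated_subalgebra G \<Longrightarrow> p * q \<in> generated_subalgebra G"
  "p \<in> G \<Longrightarrow> p \<in> generated_subalgebra G"
  using subalgebra_generated[of G] by (auto simp: subalgebra_def generated_subalgebra_def hull_inc)

lemma generated_closed_power:
  "p \<in> generated_subalgebra G \<Longrightarrow> p ^ k \<in> generated_subalgebra G"
  using generated_closed(1)[of 1 G] by (induction k) (auto simp: Const_def intro: generated_closed(3))

lemma generated_closed_sum:
  "(\<And>i. i \<in> I \<Longrightarrow> f i \<in> generated_subalgebra G) \<Longrightarrow> (\<Sum>i\<in>I. f i) \<in> generated_subalgebra G"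
  using generated_closed(1)[of 0 G]
  by (induction I rule: infinite_finite_induct) (auto simp: Const_def intro: generated_closed(2))

lemma generated_mono: "A \<subseteq> B \<Longrightarrow> generated_subalgebra A \<subseteq> generated_subalgebra B"
  unfolding generated_subalgebra_def by (rule hull_mono)

lemma polyfun_ev_poly_ring:
  assumes "p \<in> poly_ring n"
  shows "polyfun {..<n} (ev p)"
proof -
  have "X ` {..<n} \<subseteq> {p. polyfun {..<n} (ev p)}"
    using polyfun_var[of _ "{..<n}"] by (auto simp: ev_X[abs_def])
  moreover have "subalgebra {p. polyfun {..<n} (ev p)}"
    unfolding subalgebra_def
    by (auto simp: ev_Const[abs_def] ev_add[abs_def] ev_mult[abs_def]
        intro: polyfun_const polyfun_add polyfun_mult)
  ultimately have "poly_ring n \<subseteq> {p. polyfun {..<n} (ev p)}"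
    unfolding poly_ring_def generated_subalgebra_def by (rule hull_minimal)
  then show ?thesis using assms by auto
qed

lemma polyfun_lift:
  assumes "polyfun V f"
  obtains p where "p \<in> generated_subalgebra (X ` V)" "\<And>x. ev p x = f x"
proof -
  have "\<exists>p\<in>generated_subalgebra (X ` V). \<forall>x. ev p x = f x"
    using assms
  proof (induction rule: polyfun.induct)
    case (polyfun_const c)
    show ?case by (rule bexI[OF _ generated_closed(1)[of c]]) simp
  next
    case (polyfun_var i)
    then show ?case by (intro bexI[OF _ generated_closed(4)[of "X i"]]) auto
  next
    case (polyfun_add f g)
    then obtain p q where "p \<in> generated_subalgebra (X ` V)" "q \<in> generated_subalgebra (X ` V)"
      "\<forall>x. ev p x = f x" "\<forall>x. ev q x = g x" by blast
    then show ?case by (intro bexI[OF _ generated_closed(2)[of p _ q]]) auto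
  next
    case (polyfun_mult f g)
    then obtain p q where "p \<in> generated_subalgebra (X ` V)" "q \<in> generated_subalgebra (X ` V)"
      "\<forall>x. ev p x = f x" "\<forall>x. ev q x = g x" by blast
    then show ?case by (intro bexI[OF _ generated_closed(3)[of p _ q]]) auto
  qed
  then show ?thesis using that by blast
qed

lemma ev_homogeneous:
  assumes "homogeneous_of_degree d p"
  shows "ev p (\<lambda>j. s * x j) = s ^ d * ev p x"
proof -
  have "ev_monom m (\<lambda>j. s * x j) = s ^ d * ev_monom m x" if "m \<in> keys p" for m
  proof -
    have "ev_monom m (\<lambda>j. s * x j) = s ^ total_degree_monom m * ev_monom m x"
      by (simp add: ev_monom_def power_mult_distrib prod.distrib total_degree_monom_def power_sum)
    then show ?thesis using assms that by (simp add: homogeneous_of_degree_def)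
  qed
  then show ?thesis unfolding ev_def sum_distrib_left by (intro sum.cong refl) (simp add: mult_ac)
qed

definition apply_mat :: "complex mat \<Rightarrow> point \<Rightarrow> point" where
  "apply_mat A x i = (\<Sum>j<dim_col A. A $$ (i, j) * x j)"

lemma apply_mat_mult:
  assumes "A \<in> carrier_mat n n" "B \<in> carrier_mat n n" "i < n"
  shows "apply_mat A (apply_mat B x) i = apply_mat (A * B) x i"
proof -
  have "apply_mat A (apply_mat B x) i = (\<Sum>j<n. \<Sum>k<n. A $$ (i, j) * (B $$ (j, k) * x k))"
    using assms by (simp add: apply_mat_def sum_distrib_left)
  also have "\<dots> = (\<Sum>k<n. \<Sum>j<n. A $$ (i, j) * (B $$ (j, k) * x k))" by (rule sum.swap)
  also have "\<dots> = (\<Sum>k<n. (\<Sum>j<n. A $$ (i, j) * B $$ (j, k)) * x k)"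
    by (simp add: sum_distrib_right mult.assoc)
  also have "\<dots> = apply_mat (A * B) x i"
    using assms by (simp add: apply_mat_def scalar_prod_def lessThan_atLeast0)
  finally show ?thesis .
qed

lemma apply_mat_one: "i < n \<Longrightarrow> apply_mat (1\<^sub>m n) x i = x i"
  by (simp add: apply_mat_def if_distrib[of "\<lambda>c. c * _"] cong: if_cong)

lemma apply_mat_add: "apply_mat A (\<lambda>j. x j + t * y j) i = apply_mat A x i + t * apply_mat A y i"
  unfolding apply_mat_def sum_distrib_left sum.distrib[symmetric]
  by (rule sum.cong) (auto simp: algebra_simps)

lemma matrix_inverse_if_injective:
  assumes A: "A \<in> carrier_mat n n"
    and inj: "\<And>x j. (\<And>i. i < n \<Longrightarrow> apply_mat A x i = 0) \<Longrightarrow> j < n \<Longrightarrow> x j = 0"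
  obtains B where "B \<in> carrier_mat n n" "A * B = 1\<^sub>m n" "B * A = 1\<^sub>m n"
proof -
  have "det A \<noteq> 0"
  proof
    assume "det A = 0"
    then obtain v where v: "v \<in> carrier_vec n" "v \<noteq> 0\<^sub>v n" "A *\<^sub>v v = 0\<^sub>v n"
      using det_0_iff_vec_prod_zero[OF A] by blast
    have "apply_mat A (\<lambda>j. v $ j) i = 0" if "i < n" for i
    proof -
      have "(A *\<^sub>v v) $ i = 0" using v that by simp
      then show ?thesis using that v(1) A
        by (simp add: apply_mat_def scalar_prod_def lessThan_atLeast0)
    qed
    then have "v $ j = 0" if "j < n" for j using inj[of "\<lambda>j. v $ j"] that by simp
    then have "v = 0\<^sub>v n" using v(1) by (intro eq_vecI) auto
    then show False using v(2) by simp
  qed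
  then have "A \<in> Units (ring_mat TYPE(complex) n ())" by (rule det_non_zero_imp_unit[OF A])
  then show ?thesis using that by (auto simp: Units_def ring_mat_def)
qed

lemma ev_linear_conjugate:
  assumes "S \<in> carrier_mat n n" "T \<in> carrier_mat n n" "poly_map n H" "i < n"
  shows "ev (linear_conjugate n S T H $ i) x = apply_mat S (\<lambda>j. ev (H $ j) (apply_mat T x)) i"
proof -
  have H: "H \<in> carrier_vec n" "\<And>j. j < n \<Longrightarrow> polyfun {..<n} (ev (H $ j))"
    using assms(3) polyfun_ev_poly_ring by (auto simp: poly_map_def)
  have Tx: "ev ((map_mat Const T *\<^sub>v xvec n) $ k) x = apply_mat T x k" if "k < n" for k
    using assms that by (simp add: apply_mat_def xvec_def scalar_prod_def lessThan_atLeast0 ev_sum)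
  have "ev (linear_conjugate n S T H $ i) x
      = (\<Sum>j<n. S $$ (i, j) * ev (H $ j) (\<lambda>k. ev ((map_mat Const T *\<^sub>v xvec n) $ k) x))"
    using assms H(1)
    by (simp add: linear_conjugate_def subst_vec_def scalar_prod_def lessThan_atLeast0 ev_sum ev_subst_poly)
  also have "\<dots> = (\<Sum>j<n. S $$ (i, j) * ev (H $ j) (apply_mat T x))"
    by (intro sum.cong refl arg_cong2[of _ _ _ _ "(*)"] polyfun_cong_point[OF H(2)]) (auto simp: Tx)
  finally show ?thesis using assms by (simp add: apply_mat_def)
qed

lemma quasi_translation_shift:
  assumes "quasi_translation n H" "i < n"
  shows "ev (H $ i) (\<lambda>j. x j + (if j < n then ev (H $ j) x else 0)) = ev (H $ i) x"
proof -
  have pm: "H \<in> carrier_vec n" "\<And>j. j < n \<Longrightarrow> polyfun {..<n} (ev (H $ j))"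
    and eq: "subst_vec (xvec n - H) (xvec n + H) = xvec n"
    using assms(1) polyfun_ev_poly_ring by (auto simp: quasi_translation_def poly_map_def)
  define y where "y j = ev ((xvec n + H) $ j) x" for j
  have yj: "y j = x j + ev (H $ j) x" if "j < n" for j using pm(1) that by (simp add: y_def xvec_def)
  have "subst_poly (\<lambda>j. (xvec n + H) $ j) ((xvec n - H) $ i) = X i"
    using arg_cong[OF eq, of "\<lambda>v. v $ i"] assms(2) pm(1) by (simp add: subst_vec_def xvec_def)
  then have "ev ((xvec n - H) $ i) y = x i" using ev_subst_poly[of "\<lambda>j. (xvec n + H) $ j" "(xvec n - H) $ i" x]
    by (simp add: y_def[abs_def])
  then have "y i - ev (H $ i) y = x i" using pm(1) assms(2) by (simp add: xvec_def)
  then have "ev (H $ i) y = ev (H $ i) x" using yj[OF assms(2)] by simp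
  moreover have "ev (H $ i) (\<lambda>j. x j + (if j < n then ev (H $ j) x else 0)) = ev (H $ i) y"
    by (rule polyfun_cong_point[OF pm(2)[OF assms(2)]]) (simp add: yj)
  ultimately show ?thesis by simp
qed

section \<open>Linear normal forms\<close>

text \<open>
  If the last variable and the last component are absent, then the two independent linear forms
  that annihilate \<open>H\<close> involve the first three variables only. So \<open>H\<close> is everywhere a multiple of
  their cross product \<open>c\<close>.
\<close>

lemma (in homogeneous_quasi_translation) three_variables_proportional:
  assumes H3: "\<And>x. H 3 x = 0" and indep: "\<And>m x y. m < 4 \<Longrightarrow> (\<And>j. j < 3 \<Longrightarrow> x j = y j) \<Longrightarrow> H m x = H m y"
  shows proportional
proof (rule ccontr)
  assume np: "\<not> proportional"
  obtain al be p q where pq: "p < 4" "q < 4" "al p * be q \<noteq> al q * be p"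
    and alH: "\<And>y. al \<star> (\<lambda>b. H b y) = 0" and beH: "\<And>y. be \<star> (\<lambda>b. H b y) = 0"
    and inv: "\<And>u. (\<And>m y s. m < 4 \<Longrightarrow> H m (\<lambda>j. y j + s * u j) = H m y) \<Longrightarrow> al \<star> u = 0 \<and> be \<star> u = 0"
  proof (rule proportional_or_pencil[OF np], goal_cases)
    case (1 al be p q)
    show ?case by (rule 1(1)[OF 1(2-6) 1(8)])
  qed
  define e where "e j = (if j = 3 then 1 else 0 :: complex)" for j :: nat
  have "H m (\<lambda>j. y j + s * e j) = H m y" if "m < 4" for m y s
    by (rule indep[OF that]) (simp add: e_def)
  from inv[of e, OF this] have "al \<star> e = 0" "be \<star> e = 0" by auto
  then have z: "al 3 = 0" "be 3 = 0"
    using dot_unit[of 3 al] dot_unit[of 3 be] by (simp_all add: e_def[abs_def])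
  have s4: "(\<Sum>b<4. f b) = f 0 + f 1 + f 2 + (f 3 :: complex)" for f :: "nat \<Rightarrow> complex"
    by (simp add: eval_nat_numeral)
  define c where "c j = (if j = 0 then al 1 * be 2 - al 2 * be 1
     else if j = 1 then al 2 * be 0 - al 0 * be 2
     else if j = 2 then al 0 * be 1 - al 1 * be 0 else 0)" for j :: nat
  have A: "al 0 * H 0 y + al 1 * H 1 y + al 2 * H 2 y = 0" for y
    using alH[of y] z by (simp add: s4)
  have B: "be 0 * H 0 y + be 1 * H 1 y + be 2 * H 2 y = 0" for y
    using beH[of y] z by (simp add: s4)
  have c01: "c 0 * H 1 y = c 1 * H 0 y" for y
  proof -
    have "c 0 * H 1 y - c 1 * H 0 y
       = be 2 * (al 0 * H 0 y + al 1 * H 1 y + al 2 * H 2 y)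
         - al 2 * (be 0 * H 0 y + be 1 * H 1 y + be 2 * H 2 y)"
      by (simp add: c_def algebra_simps)
    then show ?thesis unfolding A B by simp
  qed
  have c02: "c 0 * H 2 y = c 2 * H 0 y" for y
  proof -
    have "c 0 * H 2 y - c 2 * H 0 y
       = al 1 * (be 0 * H 0 y + be 1 * H 1 y + be 2 * H 2 y)
         - be 1 * (al 0 * H 0 y + al 1 * H 1 y + al 2 * H 2 y)"
      by (simp add: c_def algebra_simps)
    then show ?thesis unfolding A B by simp
  qed
  have c12: "c 1 * H 2 y = c 2 * H 1 y" for y
  proof -
    have "c 1 * H 2 y - c 2 * H 1 y
       = be 0 * (al 0 * H 0 y + al 1 * H 1 y + al 2 * H 2 y)
         - al 0 * (be 0 * H 0 y + be 1 * H 1 y + be 2 * H 2 y)"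
      by (simp add: c_def algebra_simps)
    then show ?thesis unfolding A B by simp
  qed
  have idx: "l = 0 \<or> l = 1 \<or> l = 2 \<or> l = 3" if "l < 4" for l :: nat using that by linarith
  have cross: "c l * H m y = c m * H l y" if "l < 4" "m < 4" for l m y
    using idx[OF that(1)] idx[OF that(2)] c01[of y] c02[of y] c12[of y] H3[of y]
    by (elim disjE) (simp_all add: c_def[of 3])
  have "\<exists>m<3. c m \<noteq> 0"
  proof (rule ccontr)
    assume "\<not> ?thesis"
    then have "c 0 = 0" "c 1 = 0" "c 2 = 0" by auto
    then show False using pq(3) idx[OF pq(1)] idx[OF pq(2)] z
      by (elim disjE) (simp_all add: c_def)
  qed
  then obtain m where m: "m < 3" "c m \<noteq> 0" by blast
  have eq: "H l y = c l * (H m y * (1 / c m))" if "l < 4" for l y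
    using cross[OF that, of m y] m by (simp add: field_simps)
  have "polyfun4 (\<lambda>y. H m y * (1 / c m))"
    using m by (intro polyfun_mult polyfun_const polyfun_H) simp
  then have proportional unfolding proportional_def
    by (intro exI[of _ c] exI[of _ "\<lambda>y. H m y * (1 / c m)"] conjI allI impI) (assumption, rule eq)
  then show False using np by simp
qed

text \<open>
  The other columns are the unit vectors except the one with index \<open>m\<close>; together with \<open>c\<close> they
  are independent because \<open>c m \<noteq> 0\<close>.
\<close>

lemma matrix_with_last_column:
  assumes m: "m < n" and c: "c m \<noteq> (0 :: complex)"
  obtains T S where "T \<in> carrier_mat n n" "S \<in> carrier_mat n n" "T * S = 1\<^sub>m n" "S * T = 1\<^sub>m n"
    "\<And>i. i < n \<Longrightarrow> T $$ (i, n - 1) = c i"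
proof -
  define T where "T = mat n n (\<lambda>(i, j). if j = n - 1 then c i
     else if j = m then (if i = n - 1 then 1 else 0) else if i = j then 1 else 0)"
  have T: "T \<in> carrier_mat n n" by (simp add: T_def)
  have row: "apply_mat T x i = c i * x (n - 1)
      + (if m \<noteq> n - 1 \<and> i = n - 1 then x m else 0) + (if i \<noteq> n - 1 \<and> i \<noteq> m then x i else 0)"
    if i: "i < n" for x i
  proof -
    have "apply_mat T x i = (\<Sum>j<n. (if j = n - 1 then c i * x j else 0)
       + (if j = m then (if m \<noteq> n - 1 \<and> i = n - 1 then x j else 0) else 0)
       + (if j = i then (if i \<noteq> n - 1 \<and> i \<noteq> m then x j else 0) else 0))"
      using i unfolding apply_mat_def T_def by (intro sum.cong) auto
    also have "\<dots> = c i * x (n - 1)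
      + (if m \<noteq> n - 1 \<and> i = n - 1 then x m else 0) + (if i \<noteq> n - 1 \<and> i \<noteq> m then x i else 0)"
      using i m by (simp add: sum.distrib)
    finally show ?thesis .
  qed
  obtain S where "S \<in> carrier_mat n n" "T * S = 1\<^sub>m n" "S * T = 1\<^sub>m n"
  proof (rule matrix_inverse_if_injective[OF T])
    fix x j assume Tx: "\<And>i. i < n \<Longrightarrow> apply_mat T x i = 0" and j: "j < n"
    have last: "x (n - 1) = 0"
      using row[OF m, of x] Tx[OF m] c by (cases "m = n - 1") auto
    have rows: "(if m \<noteq> n - 1 \<and> i = n - 1 then x m else 0) + (if i \<noteq> n - 1 \<and> i \<noteq> m then x i else 0) = 0"
      if "i < n" for i using row[OF that, of x] Tx[OF that] last by simp
    have "n - 1 < n" using m by simp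
    then show "x j = 0" using rows[OF j] rows[of "n - 1"] last m
      by (cases "j = n - 1"; cases "j = m") (auto split: if_splits)
  qed
  then show ?thesis using that[OF T] m by (simp add: T_def)
qed

text \<open>
  The remaining rows are the unit vectors with the two indices \<open>r\<close> and \<open>s\<close> other than \<open>p\<close> and
  \<open>q\<close>.
\<close>

lemma matrix_with_first_rows:
  assumes pq: "p < 4" "q < 4" and D: "al p * be q \<noteq> al q * (be p :: complex)"
  obtains S T where "S \<in> carrier_mat 4 4" "T \<in> carrier_mat 4 4" "S * T = 1\<^sub>m 4" "T * S = 1\<^sub>m 4"
    "\<And>x. apply_mat S x 0 = al \<star> x" "\<And>x. apply_mat S x 1 = be \<star> x"
proof -
  have "p \<noteq> q" using D by auto
  then have "card ({..<4} - {p, q}) = 2" using pq by (simp add: card_Diff_subset)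
  then obtain r s where rs: "{..<4} - {p, q} = {r, s}" "r \<noteq> s" by (auto simp: card_2_iff)
  then have rs4: "r < 4" "s < 4" and dist: "distinct [p, q, r, s]" using \<open>p \<noteq> q\<close> by auto
  have all: "j = p \<or> j = q \<or> j = r \<or> j = s" if "j < 4" for j
  proof -
    have "j \<in> {p, q} \<union> ({..<4} - {p, q})" using that by auto
    then show ?thesis unfolding rs(1) by auto
  qed
  have set: "{..<4} = {p, q, r, s}" using all pq rs4 by auto
  define S where "S = mat 4 4 (\<lambda>(i, j). if i = 0 then al j else if i = 1 then be j
     else if i = 2 then (if j = r then 1 else 0) else (if j = s then 1 else 0))"
  have S: "S \<in> carrier_mat 4 4" by (simp add: S_def)
  have S0: "apply_mat S x 0 = al \<star> x" and S1: "apply_mat S x 1 = be \<star> x" for x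
    by (simp_all add: apply_mat_def S_def)
  have S2: "apply_mat S x 2 = x r" and S3: "apply_mat S x 3 = x s" for x
    using rs4 by (simp_all add: apply_mat_def S_def if_distrib[of "\<lambda>c. c * _"] cong: if_cong)
  obtain T where "T \<in> carrier_mat 4 4" "S * T = 1\<^sub>m 4" "T * S = 1\<^sub>m 4"
  proof (rule matrix_inverse_if_injective[OF S])
    fix x j assume Sx: "\<And>i. i < 4 \<Longrightarrow> apply_mat S x i = 0" and j: "j < (4::nat)"
    have xr: "x r = 0" using Sx[of 2] S2 by simp
    have xs: "x s = 0" using Sx[of 3] S3 by simp
    have a: "al p * x p + al q * x q = 0"
      using Sx[of 0] S0[of x] dist xr xs unfolding set by simp
    have b: "be p * x p + be q * x q = 0"
      using Sx[of 1] S1[of x] dist xr xs unfolding set by simp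
    have "(al p * be q - al q * be p) * x p
        = be q * (al p * x p + al q * x q) - al q * (be p * x p + be q * x q)"
      by (simp add: algebra_simps)
    then have xp: "x p = 0" using D by (simp add: a b)
    have "(al p * be q - al q * be p) * x q
        = al p * (be p * x p + be q * x q) - be p * (al p * x p + al q * x q)"
      by (simp add: algebra_simps)
    then have xq: "x q = 0" using D by (simp add: a b)
    show "x j = 0" using all[OF j] xp xq xr xs by auto
  qed
  then show ?thesis using that S S0 S1 by blast
qed

text \<open>
  Components with an index beyond \<open>n\<close> are set to 0 because the entries of a vector have no
  specified values there.
\<close>

abbreviation components :: "nat \<Rightarrow> cpoly vec \<Rightarrow> nat \<Rightarrow> point \<Rightarrow> complex" where
  "components n H \<equiv> \<lambda>j x. if j < n then ev (H $ j) x else 0"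

lemma homogeneous_quasi_translation_of_vec:
  assumes n: "n \<le> 4" and qt: "quasi_translation n H" and hm: "homogeneous_map n H"
  obtains d where "homogeneous_quasi_translation (components n H) d"
proof -
  have pf: "polyfun {..<n} (ev (H $ j))" if "j < n" for j
    using qt that polyfun_ev_poly_ring by (auto simp: quasi_translation_def poly_map_def)
  obtain d where d: "\<And>i. i < n \<Longrightarrow> H $ i = 0 \<or> homogeneous_of_degree d (H $ i)"
    using hm by (auto simp: homogeneous_map_def)
  have "homogeneous_quasi_translation (components n H) d"
  proof
    fix i :: nat assume "i < 4"
    show "polyfun4 (\<lambda>x. if i < n then ev (H $ i) x else 0)"
      using polyfun_mono[OF pf[of i], of "{..<4}"] n by (cases "i < n") (auto intro: polyfun_const)
    show "(if i < n then ev (H $ i) (\<lambda>j. s * x j) else 0) = s ^ d * (if i < n then ev (H $ i) x else 0)" for s x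
      using d[of i] ev_homogeneous[of d "H $ i" s x] by auto
    show "(if i < n then ev (H $ i) (\<lambda>j. x j + (if j < n then ev (H $ j) x else 0)) else 0)
        = (if i < n then ev (H $ i) x else 0)" for x
      using quasi_translation_shift[OF qt, of i x] by simp
  qed
  then show ?thesis by (rule that)
qed

text \<open>
  If \<open>H = c * f\<close> for a constant vector \<open>c\<close>, then \<open>f\<close> is invariant under translations by
  multiples of \<open>c\<close>, since these are reached by the flow wherever \<open>f\<close> is nonzero. In coordinates
  in which \<open>c\<close> is the last basis vector, \<open>f\<close> does not depend on the last variable.
\<close>

lemma proportional_normal_form:
  assumes n: "n \<le> 4" "n > 0" and qt: "quasi_translation n H"
    and loc: "homogeneous_quasi_translation (components n H) d"
    and proportional: "homogeneous_quasi_translation.proportional (components n H)"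
  obtains T S F where "T \<in> carrier_mat n n" "S \<in> carrier_mat n n" "T * S = 1\<^sub>m n" "S * T = 1\<^sub>m n"
    "polyfun {..<n - 1} F"
    "\<And>i x. i < n \<Longrightarrow> ev (linear_conjugate n S T H $ i) x = (if i = n - 1 then F x else 0)"
proof -
  interpret homogeneous_quasi_translation "components n H" d by (rule loc)
  have pm: "poly_map n H" using qt by (simp add: quasi_translation_def)
  have pf: "polyfun {..<n} (ev (H $ j))" if "j < n" for j
    using pm that polyfun_ev_poly_ring by (auto simp: poly_map_def)
  obtain c f m where m: "m < n" and cm: "c m \<noteq> 0" and f: "polyfun {..<n} f"
    and cf: "\<And>l x. l < n \<Longrightarrow> ev (H $ l) x = c l * f x"
  proof (cases "\<exists>m<n. \<exists>x. ev (H $ m) x \<noteq> 0")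
    case True
    then obtain m x where m: "m < n" "ev (H $ m) x \<noteq> 0" by blast
    obtain c f where cf: "\<forall>l<4. \<forall>x. (if l < n then ev (H $ l) x else 0) = c l * f x"
      using proportional unfolding proportional_def by blast
    have cf': "ev (H $ l) x = c l * f x" if l: "l < n" for l x
    proof -
      have "l < 4" using l n(1) by simp
      then have "(if l < n then ev (H $ l) x else 0) = c l * f x" using cf by blast
      then show ?thesis using l by simp
    qed
    have cm: "c m \<noteq> 0" using cf'[OF m(1), of x] m(2) by auto
    have "f x = (1 / c m) * ev (H $ m) x" for x using cf'[OF m(1), of x] cm by simp
    then have "f = (\<lambda>x. (1 / c m) * ev (H $ m) x)" by (rule ext)
    then have "polyfun {..<n} f" using polyfun_mult[OF polyfun_const pf[OF m(1)], of "1 / c m"] by simp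
    then show ?thesis using that[OF m(1) cm _ cf'] by blast
  next
    case False
    \<comment> \<open>For \<open>H = 0\<close> any nonzero vector will do.\<close>
    then show ?thesis using that[of 0 "\<lambda>_. 1" "\<lambda>_. 0"] n(2) by (auto intro: polyfun_const)
  qed
  have f4: "polyfun4 f" by (rule polyfun_mono[OF f]) (use n(1) in auto)
  have f_inv: "f (\<lambda>j. x j + t * c j) = f x" for x t
  proof (cases "\<exists>x0. f x0 \<noteq> 0")
    case True
    then obtain x0 where x0: "f x0 \<noteq> 0" ..
    let ?g = "\<lambda>x. f (\<lambda>j. x j + t * c j) - f x"
    have pfd: "polyfun4 ?g"
      by (intro polyfun_diff f4 polyfun_comp[OF f4] polyfun_add polyfun_const polyfun_var)
    have "?g x = 0"
    proof (rule polyfun_zero_generic[where g = "?g", OF f4 pfd x0])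
      fix x assume fx: "f x \<noteq> 0"
      have "f (\<lambda>j. x j + t * c j)
          = f (\<lambda>j. x j + (t / f x) * (if j < n then ev (H $ j) x else 0))"
        by (rule polyfun_cong_point[OF f]) (use fx in \<open>simp add: cf\<close>)
      moreover have "c m * f (\<lambda>j. x j + (t / f x) * (if j < n then ev (H $ j) x else 0)) = c m * f x"
        using H_flow[of m x "t / f x"] m n(1) cf[OF m] by simp
      ultimately show "?g x = 0" using cm by simp
    qed
    then show ?thesis by simp
  next
    case False
    then show ?thesis by simp
  qed
  obtain T S where TS: "T \<in> carrier_mat n n" "S \<in> carrier_mat n n" "T * S = 1\<^sub>m n" "S * T = 1\<^sub>m n"
    and Tc: "\<And>i. i < n \<Longrightarrow> T $$ (i, n - 1) = c i"
    using matrix_with_last_column[OF m, of c] cm by blast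
  define e where "e j = (if j = n - 1 then 1 else 0 :: complex)" for j
  have Te: "apply_mat T e i = c i" if "i < n" for i
    using TS(1) n(2) Tc[OF that] by (simp add: apply_mat_def e_def if_distrib[of "(*) _"] cong: if_cong)
  have Sc: "apply_mat S c i = e i" if "i < n" for i
  proof -
    have "apply_mat S c i = apply_mat S (apply_mat T e) i"
      using TS(2) unfolding apply_mat_def[of S] by (intro sum.cong) (auto simp: Te)
    also have "\<dots> = e i" using apply_mat_mult[OF TS(2,1) that] TS(4) apply_mat_one[OF that] by simp
    finally show ?thesis .
  qed
  define F where "F x = f (apply_mat T x)" for x
  have TF: "polyfun {..<n} F" unfolding F_def[abs_def]
  proof (rule polyfun_comp[where g = "\<lambda>i x. apply_mat T x i", OF f, simplified])
    show "polyfun {..<n} (\<lambda>x. apply_mat T x i)" for i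
      unfolding apply_mat_def using TS(1) by (intro polyfun_intros) auto
  qed
  have F_inv: "F x = F (\<lambda>j. if j < n - 1 then x j else 0)" for x
  proof -
    have "F (\<lambda>j. if j < n - 1 then x j else 0) = F (\<lambda>j. x j + (- x (n - 1)) * e j)"
      by (rule polyfun_cong_point[OF TF]) (auto simp: e_def)
    also have "\<dots> = f (\<lambda>j. apply_mat T x j + (- x (n - 1)) * c j)"
      unfolding F_def by (rule polyfun_cong_point[OF f]) (simp only: apply_mat_add Te lessThan_iff)
    also have "\<dots> = F x" unfolding f_inv F_def ..
    finally show ?thesis ..
  qed
  have "polyfun {..<n - 1} (\<lambda>x. F (\<lambda>j. if j < n - 1 then x j else 0))"
  proof (rule polyfun_comp[where g = "\<lambda>j x. if j < n - 1 then x j else 0", OF TF])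
    show "polyfun {..<n - 1} (\<lambda>x. if j < n - 1 then x j else 0)" for j
      by (cases "j < n - 1") (auto intro: polyfun_var polyfun_const)
  qed
  then have F: "polyfun {..<n - 1} F" using F_inv by simp
  have "ev (linear_conjugate n S T H $ i) x = (if i = n - 1 then F x else 0)" if i: "i < n" for i x
  proof -
    have "ev (linear_conjugate n S T H $ i) x = apply_mat S (\<lambda>j. ev (H $ j) (apply_mat T x)) i"
      by (rule ev_linear_conjugate[OF TS(2,1) pm i])
    also have "\<dots> = apply_mat S c i * F x"
      using TS(2) unfolding apply_mat_def sum_distrib_right
      by (intro sum.cong) (auto simp: cf F_def apply_mat_def[abs_def])
    finally show ?thesis using Sc[OF i] by (simp add: e_def)
  qed
  then show ?thesis using that[OF TS F] by blast
qed

text \<open>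
  In coordinates that start with the two linear forms \<open>al\<close> and \<open>be\<close>, the first two components
  vanish, and the ratio of the other two depends on the first two variables only.
\<close>

lemma pencil_normal_form:
  assumes qt: "quasi_translation 4 H"
    and loc: "homogeneous_quasi_translation (components 4 H) d"
    and np: "\<not> homogeneous_quasi_translation.proportional (components 4 H)"
  obtains T S a b e N where "T \<in> carrier_mat 4 4" "S \<in> carrier_mat 4 4" "T * S = 1\<^sub>m 4" "S * T = 1\<^sub>m 4"
    "polyfun {..<2} a" "polyfun {..<2} b" "\<And>n. polyfun {..<2} (e n)"
    "\<And>x. ev (linear_conjugate 4 S T H $ 0) x = 0" "\<And>x. ev (linear_conjugate 4 S T H $ 1) x = 0"
    "\<And>x. ev (linear_conjugate 4 S T H $ 2) x = b x * (\<Sum>n\<le>N. e n x * (a x * x 2 - b x * x 3) ^ n)"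
    "\<And>x. ev (linear_conjugate 4 S T H $ 3) x = a x * (\<Sum>n\<le>N. e n x * (a x * x 2 - b x * x 3) ^ n)"
proof -
  define h where "h j x = (if j < 4 then ev (H $ j) x else 0)" for j x
  interpret homogeneous_quasi_translation h d using loc unfolding h_def[abs_def] .
  have np: "\<not> proportional" using np unfolding h_def[abs_def] .
  have pm: "poly_map 4 H" using qt by (simp add: quasi_translation_def)
  obtain al be p q where pq: "p < 4" "q < 4" "al p * be q \<noteq> al q * be p"
    and alh: "\<And>y. al \<star> (\<lambda>b. h b y) = 0" and beh: "\<And>y. be \<star> (\<lambda>b. h b y) = 0"
    and ratio: "\<And>l m v y. l < 4 \<Longrightarrow> m < 4 \<Longrightarrow> al \<star> v = 0 \<Longrightarrow> be \<star> v = 0 \<Longrightarrow>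
       h l (\<lambda>j. y j + v j) * h m y = h m (\<lambda>j. y j + v j) * h l y"
  proof (rule proportional_or_pencil[OF np], goal_cases)
    case (1 al be p q)
    show ?case by (rule 1(1)[OF 1(2-7)])
  qed
  obtain S T where ST: "S \<in> carrier_mat 4 4" "T \<in> carrier_mat 4 4" "S * T = 1\<^sub>m 4" "T * S = 1\<^sub>m 4"
    and S0: "\<And>x. apply_mat S x 0 = al \<star> x" and S1: "\<And>x. apply_mat S x 1 = be \<star> x"
    using matrix_with_first_rows[OF pq] by blast
  define G where "G i x = apply_mat S (\<lambda>j. h j (apply_mat T x)) i" for i x
  have cols: "dim_col S = 4" "dim_col T = 4" using ST by auto
  have apply_cong: "apply_mat A u i = apply_mat A v i" if "dim_col A = 4" "\<And>j. j < 4 \<Longrightarrow> u j = v j" for A u v i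
    using that by (simp add: apply_mat_def)
  have TS: "apply_mat T (apply_mat S y) j = y j" if "j < 4" for y j
    using apply_mat_mult[OF ST(2,1) that] ST(4) apply_mat_one[OF that] by simp
  have ST': "apply_mat S (apply_mat T y) j = y j" if "j < 4" for y j
    using apply_mat_mult[OF ST(1,2) that] ST(3) apply_mat_one[OF that] by simp
  have pfT: "polyfun4 (\<lambda>x. h j (apply_mat T x))" if "j < 4" for j
  proof (rule polyfun_comp[where g = "\<lambda>i x. apply_mat T x i", OF polyfun_H[OF that], simplified])
    show "polyfun4 (\<lambda>x. apply_mat T x i)" for i
      unfolding apply_mat_def cols by (intro polyfun_intros) auto
  qed
  have pfG: "polyfun4 (G i)" for i
    unfolding G_def[abs_def] apply_mat_def[of S] cols by (intro polyfun_intros pfT) auto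
  have G01: "G 0 x = 0" "G 1 x = 0" for x unfolding G_def S0 S1 by (rule alh beh)+
  have evG: "ev (linear_conjugate 4 S T H $ i) x = G i x" if "i < 4" for i x
  proof -
    have "ev (linear_conjugate 4 S T H $ i) x = apply_mat S (\<lambda>j. ev (H $ j) (apply_mat T x)) i"
      by (rule ev_linear_conjugate[OF ST(1,2) pm that])
    also have "\<dots> = G i x" unfolding G_def by (rule apply_cong[OF cols(1)]) (simp add: h_def)
    finally show ?thesis .
  qed
  have TG: "apply_mat T (\<lambda>i. G i x) j = h j (apply_mat T x)" if "j < 4" for x j
    unfolding G_def by (rule TS[OF that])
  have flow: "G i (\<lambda>j. x j + t * G j x) = G i x" for i x t
    unfolding G_def[of i]
  proof (rule apply_cong[OF cols(1)])
    fix l :: nat assume l: "l < 4"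
    have "h l (apply_mat T (\<lambda>j. x j + t * G j x)) = h l (\<lambda>j. apply_mat T x j + t * h j (apply_mat T x))"
      by (rule polyfun_cong_point[OF polyfun_H[OF l]]) (simp only: apply_mat_add TG lessThan_iff)
    then show "h l (apply_mat T (\<lambda>j. x j + t * G j x)) = h l (apply_mat T x)" by (simp only: H_flow[OF l])
  qed
  have ratioG: "G 2 (\<lambda>j. x j + v j) * G 3 x = G 3 (\<lambda>j. x j + v j) * G 2 x" if v: "v 0 = 0" "v 1 = 0" for x v
  proof -
    let ?y = "apply_mat T x" and ?u = "apply_mat T v"
    have u: "al \<star> ?u = 0" "be \<star> ?u = 0" using v ST'[of 0 v] ST'[of 1 v] unfolding S0 S1 by simp_all
    have hT: "apply_mat T (\<lambda>j. x j + v j) = (\<lambda>j. ?y j + ?u j)"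
      by (rule ext) (use apply_mat_add[of T x 1 v] in simp)
    have r: "h l (\<lambda>j. ?y j + ?u j) * h m ?y = h m (\<lambda>j. ?y j + ?u j) * h l ?y" if "l < 4" "m < 4" for l m
      by (rule ratio[OF that u])
    have "G 2 (\<lambda>j. x j + v j) * G 3 x
        = (\<Sum>l<4. \<Sum>m<4. S $$ (2, l) * S $$ (3, m) * (h l (\<lambda>j. ?y j + ?u j) * h m ?y))"
      unfolding G_def apply_mat_def[of S] cols sum_product
      by (intro sum.cong refl) (simp add: hT)
    also have "\<dots> = (\<Sum>l<4. \<Sum>m<4. S $$ (2, l) * S $$ (3, m) * (h m (\<lambda>j. ?y j + ?u j) * h l ?y))"
      by (intro sum.cong refl) (simp add: r)
    also have "\<dots> = (\<Sum>m<4. \<Sum>l<4. S $$ (2, l) * S $$ (3, m) * (h m (\<lambda>j. ?y j + ?u j) * h l ?y))"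
      by (rule sum.swap)
    also have "\<dots> = G 3 (\<lambda>j. x j + v j) * G 2 x"
      unfolding G_def apply_mat_def[of S] cols sum_product
      by (intro sum.cong refl) (simp add: hT)
    finally show ?thesis .
  qed
  \<comment> \<open>If the last component vanished as well, then only one would be left and the components of \<open>H\<close>
    would be proportional.\<close>
  have "\<exists>x0. G 3 x0 \<noteq> 0"
  proof (rule ccontr)
    assume "\<nexists>x0. G 3 x0 \<noteq> 0"
    then have G3: "G 3 x = 0" for x by blast
    have s4: "(\<Sum>b<4. f b) = f 0 + f 1 + f 2 + (f 3 :: complex)" for f :: "nat \<Rightarrow> complex"
      by (simp add: eval_nat_numeral)
    have hl: "h l y = T $$ (l, 2) * G 2 (apply_mat S y)" if l: "l < 4" for l y
    proof -
      have "h l y = h l (apply_mat T (apply_mat S y))"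
        by (rule polyfun_cong_point[OF polyfun_H[OF l]]) (simp add: TS)
      also have "\<dots> = apply_mat T (\<lambda>i. G i (apply_mat S y)) l" by (rule TG[OF l, symmetric])
      also have "\<dots> = T $$ (l, 2) * G 2 (apply_mat S y)"
        unfolding apply_mat_def[of T] cols s4 by (simp add: G01 G01[simplified] G3)
      finally show ?thesis .
    qed
    have "polyfun4 (\<lambda>y. G 2 (apply_mat S y))"
    proof (rule polyfun_comp[where g = "\<lambda>i x. apply_mat S x i", OF pfG, simplified])
      show "polyfun4 (\<lambda>x. apply_mat S x i)" for i
        unfolding apply_mat_def cols by (intro polyfun_intros) auto
    qed
    then have proportional unfolding proportional_def
      by (intro exI[of _ "\<lambda>l. T $$ (l, 2)"] exI[of _ "\<lambda>y. G 2 (apply_mat S y)"] conjI allI impI)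
         (assumption, rule hl)
    then show False using np by simp
  qed
  then obtain x0 where x0: "G 3 x0 \<noteq> 0" ..
  have flow3: "G 3 (x(2 := x 2 + t * G 2 x, 3 := x 3 + t * G 3 x)) = G 3 x" for x t
  proof -
    have "G 3 (x(2 := x 2 + t * G 2 x, 3 := x 3 + t * G 3 x)) = G 3 (\<lambda>j. x j + t * G j x)"
    proof (rule polyfun_cong_point[OF pfG])
      fix i :: nat assume "i \<in> {..<4}"
      then have "i = 0 \<or> i = 1 \<or> i = 2 \<or> i = 3" by auto
      then show "(x(2 := x 2 + t * G 2 x, 3 := x 3 + t * G 3 x)) i = x i + t * G i x"
        using G01[of x] by (elim disjE) simp_all
    qed
    then show ?thesis by (simp only: flow)
  qed
  show ?thesis
  proof (rule two_component_structure[of "G 2" "G 3" x0, OF pfG pfG x0], goal_cases)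
    case (1 x v)
    show ?case by (rule ratioG[OF 1])
  next
    case (2 x t)
    show ?case by (rule flow3)
  next
    case (3 a b e N)
    show ?case
    proof (rule that[OF ST(2,1,4,3) 3(1,2,3)])
      show "ev (linear_conjugate 4 S T H $ 0) x = 0" "ev (linear_conjugate 4 S T H $ 1) x = 0" for x
        using evG[of 0 x] evG[of 1 x] unfolding G01 by simp_all
      show "ev (linear_conjugate 4 S T H $ 2) x = b x * (\<Sum>n\<le>N. e n x * (a x * x 2 - b x * x 3) ^ n)" for x
        unfolding 3(4)[symmetric] by (rule evG) simp
      show "ev (linear_conjugate 4 S T H $ 3) x = a x * (\<Sum>n\<le>N. e n x * (a x * x 2 - b x * x 3) ^ n)" for x
        unfolding 3(5)[symmetric] by (rule evG) simp
    qed
  qed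
qed

theorem corollary5p9:
  fixes n :: nat and H :: "cpoly vec"
  assumes "n \<le> 4"
    and "quasi_translation n H"
    and "homogeneous_map n H"
  shows "\<exists>T\<in>carrier_mat n n. \<exists>S\<in>carrier_mat n n.
           T * S = 1\<^sub>m n \<and> S * T = 1\<^sub>m n \<and>
           (n = 3 \<longrightarrow>
             (\<exists>g\<in>generated_subalgebra {X 0, X 1}.
                linear_conjugate n S T H = vec_of_list [0, 0, g])) \<and>
           (n = 4 \<longrightarrow>
             (\<exists>a\<in>generated_subalgebra {X 0, X 1}. \<exists>b\<in>generated_subalgebra {X 0, X 1}.
                \<exists>g\<in>generated_subalgebra {X 0, X 1, a * X 2 - b * X 3}.
                  linear_conjugate n S T H = vec_of_list [0, 0, b * g, a * g]))"
proof -
  obtain d where loc: "homogeneous_quasi_translation (components n H) d"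
    using homogeneous_quasi_translation_of_vec[OF assms] .
  interpret homogeneous_quasi_translation "components n H" d by (rule loc)
  have "{..<2} = {0, 1::nat}" "{..<3} = {0, 1, 2::nat}" by auto
  then have X2: "X ` {..<2} = {X 0, X 1}" and X3: "X ` {..<3} = {X 0, X 1, X 2}" by simp_all
  have pf: "polyfun {..<n} (ev (H $ j))" if "j < n" for j
    using assms(2) that polyfun_ev_poly_ring by (auto simp: quasi_translation_def poly_map_def)
  have dim: "dim_vec (linear_conjugate n S T H) = n" if "S \<in> carrier_mat n n" for S T
    using that by (simp add: linear_conjugate_def)
  have eq3: "linear_conjugate n S T H = vec_of_list [g0, g1, g2]"
    if "n = 3" "S \<in> carrier_mat n n"
      "\<And>x. ev (linear_conjugate n S T H $ 0) x = ev g0 x"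
      "\<And>x. ev (linear_conjugate n S T H $ 1) x = ev g1 x"
      "\<And>x. ev (linear_conjugate n S T H $ 2) x = ev g2 x" for S T g0 g1 g2
  proof (rule eq_vecI)
    fix i assume "i < dim_vec (vec_of_list [g0, g1, g2])"
    then have "i = 0 \<or> i = 1 \<or> i = 2" by auto
    then show "linear_conjugate n S T H $ i = vec_of_list [g0, g1, g2] $ i"
      using that(3-5)[THEN ev_inject] by (elim disjE) (simp_all add: eval_nat_numeral)
  qed (use dim[OF that(2), of T] that(1) in simp)
  have eq4: "linear_conjugate n S T H = vec_of_list [g0, g1, g2, g3]"
    if "n = 4" "S \<in> carrier_mat n n"
      "\<And>x. ev (linear_conjugate n S T H $ 0) x = ev g0 x"
      "\<And>x. ev (linear_conjugate n S T H $ 1) x = ev g1 x"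
      "\<And>x. ev (linear_conjugate n S T H $ 2) x = ev g2 x"
      "\<And>x. ev (linear_conjugate n S T H $ 3) x = ev g3 x" for S T g0 g1 g2 g3
  proof (rule eq_vecI)
    fix i assume "i < dim_vec (vec_of_list [g0, g1, g2, g3])"
    then have "i = 0 \<or> i = 1 \<or> i = 2 \<or> i = 3" by auto
    then show "linear_conjugate n S T H $ i = vec_of_list [g0, g1, g2, g3] $ i"
      using that(3-6)[THEN ev_inject] by (elim disjE) (simp_all add: eval_nat_numeral)
  qed (use dim[OF that(2), of T] that(1) in simp)
  consider "n < 3" | "n = 3" | "n = 4" "\<not> proportional" | "n = 4" "proportional"
    using assms(1) by linarith
  then show ?thesis
  proof cases
    case 1
    then show ?thesis by (intro bexI[of _ "1\<^sub>m n"]) auto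
  next
    case 2
    have proportional
    proof (rule three_variables_proportional)
      show "(if m < n then ev (H $ m) x else 0) = (if m < n then ev (H $ m) y else 0)"
        if "\<And>j. j < 3 \<Longrightarrow> x j = y j" for m x y
        using polyfun_cong_point[OF pf[of m], of x y] that 2 by auto
    qed (simp add: 2)
    then obtain T S F where TS: "T \<in> carrier_mat n n" "S \<in> carrier_mat n n" "T * S = 1\<^sub>m n" "S * T = 1\<^sub>m n"
      and F: "polyfun {..<n - 1} F"
      and lc: "\<And>i x. i < n \<Longrightarrow> ev (linear_conjugate n S T H $ i) x = (if i = n - 1 then F x else 0)"
      using proportional_normal_form[OF assms(1) _ assms(2) loc] 2 by auto
    have "n - 1 = 2" using 2 by simp
    with F have "polyfun {..<2} F" by simp
    then obtain g where g: "g \<in> generated_subalgebra {X 0, X 1}" "\<And>x. ev g x = F x"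
      using polyfun_lift X2 by metis
    have "linear_conjugate n S T H = vec_of_list [0, 0, g]"
      by (rule eq3[OF 2 TS(2)]) (use lc g(2) 2 in simp_all)
    then show ?thesis using TS g(1) 2 by (intro bexI[OF _ TS(1)] bexI[OF _ TS(2)]) auto
  next
    case 3
    note n4 = 3(1) and varying = 3(2)
    obtain T S a b e N where TS: "T \<in> carrier_mat 4 4" "S \<in> carrier_mat 4 4" "T * S = 1\<^sub>m 4" "S * T = 1\<^sub>m 4"
      and pfs: "polyfun {..<2} a" "polyfun {..<2} b" "\<And>n. polyfun {..<2} (e n)"
      and lc: "\<And>x. ev (linear_conjugate 4 S T H $ 0) x = 0" "\<And>x. ev (linear_conjugate 4 S T H $ 1) x = 0"
        "\<And>x. ev (linear_conjugate 4 S T H $ 2) x = b x * (\<Sum>n\<le>N. e n x * (a x * x 2 - b x * x 3) ^ n)"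
        "\<And>x. ev (linear_conjugate 4 S T H $ 3) x = a x * (\<Sum>n\<le>N. e n x * (a x * x 2 - b x * x 3) ^ n)"
    proof (rule pencil_normal_form[of H d], goal_cases)
      case 1
      show ?case using assms(2) n4 by simp
    next
      case 2
      show ?case using loc unfolding n4 .
    next
      case 3
      show ?case using varying unfolding n4 .
    next
      case (4 T S a b e N)
      show ?case by (rule 4(1)[OF 4(2-12)])
    qed
    obtain A where A: "A \<in> generated_subalgebra {X 0, X 1}" "\<And>x. ev A x = a x"
      using polyfun_lift[OF pfs(1)] X2 by metis
    obtain B where B: "B \<in> generated_subalgebra {X 0, X 1}" "\<And>x. ev B x = b x"
      using polyfun_lift[OF pfs(2)] X2 by metis
    have "\<exists>E. E \<in> generated_subalgebra {X 0, X 1} \<and> (\<forall>x. ev E x = e n x)" for n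
      using polyfun_lift[OF pfs(3)[of n]] X2 by metis
    then obtain E where E: "\<And>n. E n \<in> generated_subalgebra {X 0, X 1}" "\<And>n x. ev (E n) x = e n x"
      by metis
    define g where "g = (\<Sum>n\<le>N. E n * (A * X 2 - B * X 3) ^ n)"
    let ?G = "{X 0, X 1, A * X 2 - B * X 3}"
    have EG: "E n \<in> generated_subalgebra ?G" for n
      using generated_mono[of "{X 0, X 1}" ?G] E(1) by auto
    have "A * X 2 - B * X 3 \<in> generated_subalgebra ?G" by (rule generated_closed(4)) simp
    then have g: "g \<in> generated_subalgebra ?G" unfolding g_def
      by (intro generated_closed_sum generated_closed(3) generated_closed_power EG)
    have evg: "ev g x = (\<Sum>n\<le>N. e n x * (a x * x 2 - b x * x 3) ^ n)" for x
      by (simp add: g_def ev_sum A B E)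
    have "linear_conjugate n S T H = vec_of_list [0, 0, B * g, A * g]"
      by (rule eq4) (use TS(2) 3(1) lc in \<open>simp_all add: evg A B\<close>)
    then have normal: "\<exists>a\<in>generated_subalgebra {X 0, X 1}. \<exists>b\<in>generated_subalgebra {X 0, X 1}.
        \<exists>g\<in>generated_subalgebra {X 0, X 1, a * X 2 - b * X 3}.
          linear_conjugate n S T H = vec_of_list [0, 0, b * g, a * g]"
      by (intro bexI[OF _ A(1)] bexI[OF _ B(1)] bexI[OF _ g])
    show ?thesis
      by (rule bexI[of _ T], rule bexI[of _ S], intro conjI impI) (use TS n4 normal in simp_all)
  next
    case 4
    then obtain T S F where TS: "T \<in> carrier_mat n n" "S \<in> carrier_mat n n" "T * S = 1\<^sub>m n" "S * T = 1\<^sub>m n"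
      and F: "polyfun {..<n - 1} F"
      and lc: "\<And>i x. i < n \<Longrightarrow> ev (linear_conjugate n S T H $ i) x = (if i = n - 1 then F x else 0)"
      using proportional_normal_form[OF assms(1) _ assms(2) loc] by auto
    have "n - 1 = 3" using 4 by simp
    with F have "polyfun {..<3} F" by simp
    then obtain g where g: "g \<in> generated_subalgebra {X 0, X 1, X 2}" "\<And>x. ev g x = F x"
      using polyfun_lift X3 by metis
    \<comment> \<open>The choice \<open>a = 1\<close>, \<open>b = 0\<close> makes \<open>X 2\<close> the third generator.\<close>
    have g': "g \<in> generated_subalgebra {X 0, X 1, Const 1 * X 2 - Const 0 * X 3}"
      using g(1) by (simp add: Const_def)
    have "linear_conjugate n S T H = vec_of_list [0, 0, Const 0 * g, Const 1 * g]"
      by (rule eq4[OF 4(1) TS(2)]) (use lc g(2) 4(1) in simp_all)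
    then have normal: "\<exists>a\<in>generated_subalgebra {X 0, X 1}. \<exists>b\<in>generated_subalgebra {X 0, X 1}.
        \<exists>g\<in>generated_subalgebra {X 0, X 1, a * X 2 - b * X 3}.
          linear_conjugate n S T H = vec_of_list [0, 0, b * g, a * g]"
      by (intro bexI[OF _ generated_closed(1)[of 1]] bexI[OF _ generated_closed(1)[of 0]] bexI[OF _ g'])
    show ?thesis
      by (rule bexI[of _ T], rule bexI[of _ S], intro conjI impI) (use TS 4(1) normal in simp_all)
  qed
qed

end
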